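(* Let $\Omega_0>0$ be a constant and let the angular velocity be $\Omega(\varepsilon)=\Omega_0/\varepsilon$. Then, as $\varepsilon\to0^+$, $$\big\||\Psi^{\mathrm{GP}}_\varepsilon|^2-\rho^{\mathrm{TF}}\big\|_{L^1(\mathcal{B}_1)}=O\big(\sqrt{\varepsilon|\log\varepsilon|}\big),$$ where $\Psi^{\mathrm{GP}}_\varepsilon$ is any $L^2$-normalized minimizer of the GP functional; i.e. there exist $C>0$ and $\varepsilon_0>0$ depending on $\Omega_0$ only such that the left side is at most $C\sqrt{\varepsilon|\log\varepsilon|}$ for all $0<\varepsilon<\varepsilon_0$ and every minimizer.
   Context: $\mathcal{B}_1\subset\mathbb{R}^2$ is the unit disc centered at the origin, $d\vec r$ is two-dimensional Lebesgue measure, $r=|\vec r|$, and $L=-i\partial_\vartheta$ in polar coordinates $(r,\vartheta)$. For $\varepsilon>0$ and angular velocity $\Omega(\varepsilon)$, the Gross-Pitaevskii (GP) functional on complex-valued $\Psi\in H^1(\mathcal{B}_1)$ is $$\mathcal{E}^{\mathrm{GP}}[\Psi]=\int_{\mathcal{B}_1}d\vec r\,\Big\{|\nabla\Psi|^2-\Omega(\varepsilon)\Psi^*L\Psi+\frac{|\Psi|^4}{\varepsilon^2}\Big\},$$ and $\Psi^{\mathrm{GP}}_\varepsilon$ denotes any minimizer of it over $\Psi\in H^1(\mathcal{B}_1)$ with $\|\Psi\|_{L^2(\mathcal{B}_1)}=1$ (minimizers exist but need not be unique). The Thomas-Fermi functional, for given $\Omega_0>0$, is $\mathcal{E}^{\mathrm{TF}}[\rho]=\int_{\mathcal{B}_1}d\vec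 r\,\{\rho^2-\frac{\Omega_0^2r^2\rho}{4}\}$ on $\{\rho\in L^2(\mathcal{B}_1):\rho\ge0\}$; $\rho^{\mathrm{TF}}$ is its unique minimizer subject to $\int_{\mathcal{B}_1}\rho\,d\vec r=1$. Explicitly, $$\rho^{\mathrm{TF}}(r)=\begin{cases}\frac1\pi-\frac{\Omega_0^2}{16}(1-2r^2)&\text{if }\Omega_0\le\frac{4}{\sqrt\pi},\\[2pt]\Big[\frac{\Omega_0^2}{8}(r^2-1)+\frac{\Omega_0}{2\sqrt\pi}\Big]_+&\text{if }\Omega_0>\frac{4}{\sqrt\pi},\end{cases}$$ where $[\cdot]_+$ denotes the positive part. *)

theory Defs
  imports "HOL-Analysis.Analysis"
begin

definition unit_disc :: "(real ^ 2) set" where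
  "unit_disc = ball 0 1"

abbreviation disc_measure :: "(real ^ 2) measure" where
  "disc_measure \<equiv> lebesgue_on unit_disc"

text \<open>
  Elements of \<open>L\<^sup>2\<close> and \<open>H\<^sup>1\<close> are represented by functions on the whole plane of which only the
  values on the disc matter, and these only almost everywhere. All notions below are
  independent of the representative.
\<close>

definition L2_disc :: "(real ^ 2 \<Rightarrow> 'a :: euclidean_space) set" where
  "L2_disc = {f. f \<in> borel_measurable disc_measure \<and>
     integrable disc_measure (\<lambda>x. (norm (f x))\<^sup>2)}"

definition L2_norm_disc :: "(real ^ 2 \<Rightarrow> 'a :: euclidean_space) \<Rightarrow> real" where
  "L2_norm_disc f = sqrt (LINT x|disc_measure. (norm (f x))\<^sup>2)"

definition L1_norm_disc :: "(real ^ 2 \<Rightarrow> 'a :: euclidean_space) \<Rightarrow> real" where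
  "L1_norm_disc f = (LINT x|disc_measure. norm (f x))"

definition partial_deriv :: "2 \<Rightarrow> (real ^ 2 \<Rightarrow> real) \<Rightarrow> real ^ 2 \<Rightarrow> real" where
  "partial_deriv i f x = frechet_derivative f (at x) (axis i 1)"

primrec C_k :: "nat \<Rightarrow> (real ^ 2 \<Rightarrow> real) \<Rightarrow> bool" where
  "C_k 0 f \<longleftrightarrow> continuous_on UNIV f"
| "C_k (Suc k) f \<longleftrightarrow> (\<forall>x. f differentiable (at x)) \<and> (\<forall>i. C_k k (partial_deriv i f))"

text \<open>The space \<open>C\<^sub>c\<^sup>\<infinity>\<close> of the open disc, its elements extended by zero to the plane.
  Real-valued test functions suffice, also for the weak derivatives of complex functions.\<close>

definition test_function :: "(real ^ 2 \<Rightarrow> real) \<Rightarrow> bool" where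
  "test_function \<phi> \<longleftrightarrow> (\<forall>k. C_k k \<phi>) \<and>
     (\<exists>K. compact K \<and> K \<subseteq> unit_disc \<and> (\<forall>x. x \<notin> K \<longrightarrow> \<phi> x = 0))"

definition is_weak_partial ::
    "2 \<Rightarrow> (real ^ 2 \<Rightarrow> complex) \<Rightarrow> (real ^ 2 \<Rightarrow> complex) \<Rightarrow> bool" where
  "is_weak_partial i \<Psi> g \<longleftrightarrow> (\<forall>\<phi>. test_function \<phi> \<longrightarrow>
     (LINT x|disc_measure. partial_deriv i \<phi> x *\<^sub>R \<Psi> x) =
     - (LINT x|disc_measure. \<phi> x *\<^sub>R g x))"

definition H1_disc :: "(real ^ 2 \<Rightarrow> complex) set" where
  "H1_disc = {\<Psi> \<in> L2_disc. \<forall>i. \<exists>g \<in> L2_disc. is_weak_partial i \<Psi> g}"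

text \<open>For \<open>\<Psi>\<close> in \<open>H\<^sup>1\<close> this is determined up to a null set of the disc.\<close>

definition weak_partial :: "2 \<Rightarrow> (real ^ 2 \<Rightarrow> complex) \<Rightarrow> real ^ 2 \<Rightarrow> complex" where
  "weak_partial i \<Psi> = (SOME g. g \<in> L2_disc \<and> is_weak_partial i \<Psi> g)"

definition grad_norm_sq :: "(real ^ 2 \<Rightarrow> complex) \<Rightarrow> real ^ 2 \<Rightarrow> real" where
  "grad_norm_sq \<Psi> x = (\<Sum>i\<in>UNIV. (norm (weak_partial i \<Psi> x))\<^sup>2)"

text \<open>\<open>L = - \<i> \<partial>\<^sub>\<theta>\<close> in Cartesian coordinates, where \<open>\<partial>\<^sub>\<theta> = x\<^sub>1 \<partial>\<^sub>2 - x\<^sub>2 \<partial>\<^sub>1\<close>.\<close>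

definition ang_mom :: "(real ^ 2 \<Rightarrow> complex) \<Rightarrow> real ^ 2 \<Rightarrow> complex" where
  "ang_mom \<Psi> x =
     - \<i> * (of_real (x $ 1) * weak_partial 2 \<Psi> x - of_real (x $ 2) * weak_partial 1 \<Psi> x)"

text \<open>
  The integral of \<open>\<Psi>\<^sup>* L \<Psi>\<close> is real because \<open>L\<close> is symmetric on the disc, but its integrand is in
  general complex, whence the real part. On \<open>H\<^sup>1\<close> the first integrand is integrable. The quartic
  term is an extended nonnegative integral, so that the conventional value 0 of a divergent
  Bochner integral plays no role; it is finite on \<open>H\<^sup>1\<close> by the embedding of \<open>H\<^sup>1\<close> into \<open>L\<^sup>4\<close>.
\<close>

definition GP_energy :: "real \<Rightarrow> real \<Rightarrow> (real ^ 2 \<Rightarrow> complex) \<Rightarrow> ereal" where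
  "GP_energy \<epsilon> \<Omega> \<Psi> =
     ereal (Re (LINT x|disc_measure.
       of_real (grad_norm_sq \<Psi> x) - of_real \<Omega> * (cnj (\<Psi> x) * ang_mom \<Psi> x)))
     + enn2ereal (\<integral>\<^sup>+ x. ennreal ((norm (\<Psi> x)) ^ 4 / \<epsilon>\<^sup>2) \<partial>disc_measure)"

definition GP_minimizer :: "real \<Rightarrow> real \<Rightarrow> (real ^ 2 \<Rightarrow> complex) \<Rightarrow> bool" where
  "GP_minimizer \<epsilon> \<Omega> \<Psi> \<longleftrightarrow> \<Psi> \<in> H1_disc \<and> L2_norm_disc \<Psi> = 1 \<and>
     (\<forall>\<Phi> \<in> H1_disc. L2_norm_disc \<Phi> = 1 \<longrightarrow> GP_energy \<epsilon> \<Omega> \<Psi> \<le> GP_energy \<epsilon> \<Omega> \<Phi>)"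

definition TF_energy :: "real \<Rightarrow> (real ^ 2 \<Rightarrow> real) \<Rightarrow> real" where
  "TF_energy \<Omega>\<^sub>0 \<rho> = (LINT x|disc_measure. (\<rho> x)\<^sup>2 - \<Omega>\<^sub>0\<^sup>2 * (norm x)\<^sup>2 * \<rho> x / 4)"

definition TF_domain :: "(real ^ 2 \<Rightarrow> real) set" where
  "TF_domain = {\<rho> \<in> L2_disc. AE x in disc_measure. 0 \<le> \<rho> x}"

definition TF_minimizer :: "real \<Rightarrow> (real ^ 2 \<Rightarrow> real) \<Rightarrow> bool" where
  "TF_minimizer \<Omega>\<^sub>0 \<rho> \<longleftrightarrow> \<rho> \<in> TF_domain \<and> (LINT x|disc_measure. \<rho> x) = 1 \<and>
     (\<forall>\<sigma> \<in> TF_domain. (LINT x|disc_measure. \<sigma> x) = 1 \<longrightarrow> TF_energy \<Omega>\<^sub>0 \<rho> \<le> TF_energy \<Omega>\<^sub>0 \<sigma>)"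

text \<open>
  The minimizer exists and is unique almost everywhere; hence a choice rather than a definite
  description. Explicitly, almost everywhere on the disc, with \<open>r = norm x\<close>, it is
  \<open>1 / pi - \<Omega>\<^sub>0\<^sup>2 / 16 * (1 - 2 * r\<^sup>2)\<close> if \<open>\<Omega>\<^sub>0 \<le> 4 / sqrt pi\<close>, and otherwise
  \<open>max 0 (\<Omega>\<^sub>0\<^sup>2 / 8 * (r\<^sup>2 - 1) + \<Omega>\<^sub>0 / (2 * sqrt pi))\<close>.
\<close>

definition rho_TF :: "real \<Rightarrow> real ^ 2 \<Rightarrow> real" where
  "rho_TF \<Omega>\<^sub>0 = (SOME \<rho>. TF_minimizer \<Omega>\<^sub>0 \<rho>)"

end

theory Submission
  imports Defs "HOL-Real_Asymp.Real_Asymp"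
begin

text \<open>
  Completing the square bounds the GP energy of \<open>\<Psi>\<close> from below by the TF energy of \<open>|\<Psi>|\<^sup>2\<close> divided
  by \<open>\<epsilon>\<^sup>2\<close>, and by convexity the TF energy exceeds its minimum by at least the squared \<open>L\<^sup>2\<close> distance
  to the minimizer. So it suffices to find a trial state whose energy is the TF energy divided by
  \<open>\<epsilon>\<^sup>2\<close> plus \<open>O(|ln \<epsilon>| / \<epsilon>)\<close>; Cauchy-Schwarz then yields the \<open>L\<^sup>1\<close> bound.

  The trial state is \<open>f w / sqrt (|w|\<^sup>2 + \<epsilon>)\<close>, with \<open>f\<^sup>2\<close> a smoothed multiple of the TF density and \<open>w\<close> a
  sum of plane waves localized to strips of width \<open>\<Omega> powr (-1/2)\<close>. Its covariant derivatives are
  \<open>O(sqrt \<Omega>)\<close> and its zeros form a lattice, so that both the kinetic energy and the loss of density are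
  governed by the integral of \<open>1 / (|w|\<^sup>2 + \<epsilon>)\<close>. Averaging over the translations of the lattice
  shows that this integral is \<open>O(|ln \<epsilon>|)\<close> for some translation.
\<close>

section \<open>Weak derivatives on the disc\<close>

text \<open>A state of constant phase leaves, after completing the square, a kinetic energy of order
  \<Omega>^2, as large as the TF energy over \<epsilon>^2. The phase must therefore follow a vector
  potential with curl \<Omega>, which forces zeros, one per area of order 1 / \<Omega>. Near a
  simple zero in the plane 1 / |w|^2 just fails to be integrable: this is the origin of the
  logarithm. The cutoff \<epsilon> balances two errors. The vortices cost a kinetic energy of
  \<Omega> times the integral of h = 1 / (|w|^2 + \<epsilon>), and they remove the fraction
  \<epsilon> h of the density; on the scale of the TF functional both are O(\<epsilon> |ln
  \<epsilon>|). The average over shifts is bounded at each fixed point, uniformly in the point, so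
  neither the position of the zeros nor the cells cut by the boundary circle enter. The density is
  smoothed because the square root of a density vanishing linearly at the edge of a hole has a
  gradient that is not square integrable.\<close>

lemma partial_deriv_eqI:
  assumes "(f has_derivative f') (at x)"
  shows "partial_deriv i f x = f' (axis i 1)"
  using frechet_derivative_at[OF assms] by (simp add: partial_deriv_def)

text \<open>The recursion passes to the partial derivatives, so descent to a lower class needs an
  induction, whose base case is that differentiability implies continuity. The product rule depends
  on it, because it leaves one factor undifferentiated.\<close>

lemma C_k_SucD: "C_k (Suc k) f \<Longrightarrow> C_k k f"
proof (induction k arbitrary: f)
  case 0
  then show ?case
    by (auto intro!: differentiable_imp_continuous_on simp: differentiable_on_def
        intro: differentiable_at_withinI)
next
  case (Suc k)
  then show ?case by (metis C_k.simps(2))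
qed

lemma C_k_const: "C_k k (\<lambda>x. c)"
proof (induction k arbitrary: c)
  case (Suc k)
  have "partial_deriv i (\<lambda>x. c) = (\<lambda>x. 0)" for i
    by (rule ext, subst partial_deriv_eqI[of _ "\<lambda>_. 0"]) auto
  with Suc show ?case by simp
qed simp

lemma C_k_add: "C_k k f \<Longrightarrow> C_k k g \<Longrightarrow> C_k k (\<lambda>x. f x + g x)"
proof (induction k arbitrary: f g)
  case (Suc k)
  then have d: "(f has_derivative frechet_derivative f (at x)) (at x)"
      "(g has_derivative frechet_derivative g (at x)) (at x)" for x
    by (simp_all flip: frechet_derivative_works)
  have "partial_deriv i (\<lambda>x. f x + g x) = (\<lambda>x. partial_deriv i f x + partial_deriv i g x)" for i
    by (rule ext, subst partial_deriv_eqI[OF has_derivative_add[OF d]]) (simp add: partial_deriv_def)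
  with Suc show ?case by (auto intro!: derivative_intros)
qed (auto intro: continuous_intros)

lemma C_k_mult: "C_k k f \<Longrightarrow> C_k k g \<Longrightarrow> C_k k (\<lambda>x. f x * g x)"
proof (induction k arbitrary: f g)
  case (Suc k)
  then have d: "(f has_derivative frechet_derivative f (at x)) (at x)"
      "(g has_derivative frechet_derivative g (at x)) (at x)" for x
    by (simp_all flip: frechet_derivative_works)
  have *: "partial_deriv i (\<lambda>x. f x * g x)
      = (\<lambda>x. f x * partial_deriv i g x + partial_deriv i f x * g x)" for i
    by (rule ext, subst partial_deriv_eqI[OF has_derivative_mult[OF d]]) (simp add: partial_deriv_def)
  have "C_k k (\<lambda>x. f x * partial_deriv i g x + partial_deriv i f x * g x)" for i
    using Suc.prems by (intro C_k_add Suc.IH) (auto intro: C_k_SucD)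
  moreover have "(\<lambda>x. f x * g x) differentiable (at x)" for x
    using Suc.prems by (auto intro!: derivative_intros)
  ultimately show ?case by (simp add: *)
qed (auto intro: continuous_intros)

section \<open>Smooth bumps supported in boxes\<close>

definition flat_exp :: "real poly \<Rightarrow> real \<Rightarrow> real" where
  "flat_exp p t = (if t \<le> 0 then 0 else poly p (1 / t) * exp (- (1 / t)))"

lemma poly_mult_exp_tendsto_0:
  fixes p :: "real poly"
  shows "((\<lambda>s. poly p s * exp (- s)) \<longlongrightarrow> 0) at_top"
proof -
  have "((\<lambda>s. \<Sum>i\<le>degree p. coeff p i * (s ^ i * exp (- s))) \<longlongrightarrow> (\<Sum>i\<le>degree p. coeff p i * 0)) at_top"
    by (intro tendsto_intros) (real_asymp)
  then show ?thesis by (simp add: poly_altdef sum_distrib_right mult.assoc)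
qed

text \<open>The case distinction matters only at \<open>t = 0\<close>, where the exponential beats every polynomial
  in \<open>1 / t\<close>; this class of functions is closed under differentiation.\<close>
lemma flat_exp_has_derivative:
  "(flat_exp p has_real_derivative flat_exp ([:0, 0, 1:] * (p - pderiv p)) t) (at t)"
proof -
  consider "t < 0" | "t > 0" | "t = 0" by linarith
  then show ?thesis
  proof cases
    case 1
    have "((\<lambda>_. 0) has_real_derivative 0) (at t)" by simp
    moreover have "\<forall>\<^sub>F x in nhds t. flat_exp p x = 0"
      using eventually_nhds_in_open[of "{..<0}" t] 1
      by (auto simp: flat_exp_def elim: eventually_mono)
    ultimately show ?thesis using 1
      by (subst DERIV_cong_ev[OF refl _ refl]) (auto simp: flat_exp_def)
  next
    case 2
    \<comment> \<open>With s = 1 / t the derivative is s^2 (p(s) - p'(s)) exp(-s), whence the factor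
      \<open>[:0, 0, 1:]\<close>.\<close>
    have "((\<lambda>t. poly p (1 / t) * exp (- (1 / t))) has_real_derivative
        flat_exp ([:0, 0, 1:] * (p - pderiv p)) t) (at t)"
      using 2 by (auto intro!: derivative_eq_intros simp: flat_exp_def field_simps power2_eq_square)
    moreover have "\<forall>\<^sub>F x in nhds t. flat_exp p x = poly p (1 / x) * exp (- (1 / x))"
      using eventually_nhds_in_open[of "{0<..}" t] 2
      by (auto simp: flat_exp_def elim: eventually_mono)
    ultimately show ?thesis
      by (subst DERIV_cong_ev[OF refl _ refl]) auto
  next
    case 3
    have "((\<lambda>y. flat_exp p y / y) \<longlongrightarrow> 0) (at_right 0)"
    proof -
      have "((\<lambda>s. poly ([:0,1:] * p) s * exp (- s)) \<longlongrightarrow> 0) at_top"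
        by (rule poly_mult_exp_tendsto_0)
      then have "((\<lambda>y. poly ([:0,1:] * p) (inverse y) * exp (- inverse y)) \<longlongrightarrow> 0) (at_right (0::real))"
        by (rule filterlim_compose[OF _ filterlim_inverse_at_top_right])
      then show ?thesis
        by (rule Lim_transform_eventually)
          (auto simp: eventually_at_right_less eventually_at_filter flat_exp_def field_simps)
    qed
    moreover have "((\<lambda>y. flat_exp p y / y) \<longlongrightarrow> 0) (at_left 0)"
      by (rule tendsto_eventually) (auto simp: eventually_at_filter flat_exp_def)
    ultimately have "((\<lambda>y. flat_exp p y / y) \<longlongrightarrow> 0) (at 0)"
      by (simp add: filterlim_at_split)
    then show ?thesis using 3
      by (simp add: has_field_derivative_iff flat_exp_def)
  qed
qed

lemma C_k_flat_exp:
  fixes i :: 2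
  shows "C_k k (\<lambda>x. flat_exp p (c * x $ i + d))"
proof (induction k arbitrary: p)
  case 0
  have "continuous_on UNIV (flat_exp p)"
    using flat_exp_has_derivative by (meson DERIV_isCont continuous_at_imp_continuous_on)
  then have "continuous_on UNIV (\<lambda>x::real^2. flat_exp p (c * x $ i + d))"
    by (rule continuous_on_compose2) (auto intro!: continuous_intros)
  then show ?case by simp
next
  case (Suc k)
  let ?q = "[:0, 0, 1:] * (p - pderiv p)"
  have d: "((\<lambda>x::real^2. flat_exp p (c * x $ i + d)) has_derivative
      (\<lambda>v. flat_exp ?q (c * x $ i + d) * (c * v $ i))) (at x)" for x
  proof -
    have "((\<lambda>x::real^2. c * x $ i + d) has_derivative (\<lambda>v. c * v $ i)) (at x)"
      by (auto intro!: derivative_eq_intros bounded_linear.has_derivative[OF bounded_linear_vec_nth])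
    from has_derivative_compose[OF this flat_exp_has_derivative[unfolded has_field_derivative_def]]
    show ?thesis by simp
  qed
  have pd: "partial_deriv j (\<lambda>x. flat_exp p (c * x $ i + d))
      = (\<lambda>x. (c * axis j 1 $ i) * flat_exp ?q (c * x $ i + d))" for j
    by (rule ext, subst partial_deriv_eqI[OF d]) simp
  have "C_k k (\<lambda>x. (c * axis j 1 $ i) * flat_exp ?q (c * x $ i + d))" for j
    by (intro C_k_mult C_k_const Suc)
  with d show ?case unfolding C_k.simps pd differentiable_def by blast
qed

text \<open>Each side of the box contributes a factor exp(-1 / (n d)), where d is the distance to
  that side; inside the box it tends to 1 as n grows. The arguments have the affine form for which
  smoothness was proved.\<close>

definition box_bump :: "real \<Rightarrow> real^2 \<Rightarrow> real^2 \<Rightarrow> real^2 \<Rightarrow> real" where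
  "box_bump n a b x =
     (flat_exp 1 (n * x $ 1 + - (n * a $ 1)) * flat_exp 1 (- n * x $ 1 + n * b $ 1)) *
     (flat_exp 1 (n * x $ 2 + - (n * a $ 2)) * flat_exp 1 (- n * x $ 2 + n * b $ 2))"

lemma flat_exp_1_bounds: "0 \<le> flat_exp 1 t" "flat_exp 1 t \<le> 1"
  by (auto simp: flat_exp_def)

lemma flat_exp_eq_0: "t \<le> 0 \<Longrightarrow> flat_exp p t = 0"
  by (auto simp: flat_exp_def)

lemma box_bump_bounds: "0 \<le> box_bump n a b x" "box_bump n a b x \<le> 1"
  unfolding box_bump_def by (auto intro!: mult_nonneg_nonneg mult_le_one flat_exp_1_bounds)

lemma box_bump_outside:
  assumes "n \<ge> 0" "x \<notin> box a b"
  shows "box_bump n a b x = 0"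
proof -
  from assms obtain i where "x $ i \<le> a $ i \<or> b $ i \<le> x $ i"
    by (auto simp: mem_box_cart not_less)
  moreover have "i = 1 \<or> i = 2" by (rule exhaust_2)
  ultimately show ?thesis
    using mult_left_mono[of _ _ n] assms unfolding box_bump_def
    by (auto simp: flat_exp_eq_0)
qed

lemma test_function_box_bump:
  assumes "n \<ge> 0" "cbox a b \<subseteq> unit_disc"
  shows "test_function (box_bump n a b)"
  unfolding test_function_def
proof (intro conjI allI exI[of _ "cbox a b"] impI)
  show "C_k k (box_bump n a b)" for k
    unfolding box_bump_def by (intro C_k_mult C_k_flat_exp)
  show "box_bump n a b x = 0" if "x \<notin> cbox a b" for x
    using that assms box_subset_cbox[of a b] by (intro box_bump_outside) auto
qed (use assms in auto)

lemma box_bump_tendsto: "(\<lambda>n. box_bump (real n) a b x) \<longlonglongrightarrow> indicator (box a b) x"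
proof (cases "x \<in> box a b")
  case True
  have *: "(\<lambda>n. flat_exp 1 (real n * t)) \<longlonglongrightarrow> 1" if "t > 0" for t
  proof -
    have "(\<lambda>n. exp (- (1 / (real n * t)))) \<longlonglongrightarrow> 1" using that by real_asymp
    then show ?thesis
      by (rule Lim_transform_eventually)
        (use that in \<open>auto simp: flat_exp_def mult_le_0_iff intro!: eventually_sequentiallyI[of 1]\<close>)
  qed
  have "(\<lambda>n. (flat_exp 1 (real n * (x $ 1 - a $ 1)) * flat_exp 1 (real n * (b $ 1 - x $ 1))) *
     (flat_exp 1 (real n * (x $ 2 - a $ 2)) * flat_exp 1 (real n * (b $ 2 - x $ 2))))
     \<longlonglongrightarrow> (1 * 1) * (1 * 1)"
    by (intro tendsto_mult *) (use True in \<open>auto simp: mem_box_cart\<close>)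
  with True show ?thesis by (simp add: box_bump_def algebra_simps)
next
  case False
  then show ?thesis by (simp add: box_bump_outside)
qed

section \<open>Integration on the disc\<close>

lemma unit_disc_sets [simp]: "unit_disc \<in> sets lebesgue" "unit_disc \<in> sets borel"
  by (auto simp: unit_disc_def)

lemma unit_disc_lmeasurable [simp]: "unit_disc \<in> lmeasurable"
  by (simp add: unit_disc_def)

interpretation disc: finite_measure disc_measure
  by (rule finite_measure_lebesgue_on) simp

lemma norm_le_1_unit_disc: "x \<in> unit_disc \<Longrightarrow> norm x \<le> 1"
  by (simp add: unit_disc_def)

text \<open>Passes from the completed measure of the disc to \<open>lborel\<close>, where
  translation invariance is at hand; Borel integrands do not see the completion.\<close>

lemma integral_disc_borel:
  fixes f :: "real^2 \<Rightarrow> 'b::{banach, second_countable_topology}"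
  assumes f: "f \<in> borel_measurable borel"
  shows "(LINT x|disc_measure. f x) = (LINT x|lborel. indicator unit_disc x *\<^sub>R f x)"
proof -
  have "(LINT x|disc_measure. f x) = (LINT x|lebesgue. indicator unit_disc x *\<^sub>R f x)"
    by (rule integral_restrict_space) simp
  also have "\<dots> = (LINT x|lborel. indicator unit_disc x *\<^sub>R f x)"
    using f by (intro integral_completion borel_measurable_scaleR borel_measurable_indicator) auto
  finally show ?thesis .
qed

lemma nn_integral_disc_borel:
  "(\<integral>\<^sup>+x. f x \<partial>disc_measure) = (\<integral>\<^sup>+x. f x * indicator unit_disc x \<partial>lborel)"
  by (subst nn_integral_restrict_space) (auto simp: nn_integral_completion)

lemma continuous_imp_measurable_disc:
  fixes f :: "real^2 \<Rightarrow> 'b::euclidean_space"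
  shows "continuous_on UNIV f \<Longrightarrow> f \<in> borel_measurable disc_measure"
  by (rule continuous_imp_measurable_on_sets_lebesgue) (auto intro: continuous_on_subset)

lemma continuous_bounded_disc:
  fixes f :: "real^2 \<Rightarrow> 'b::euclidean_space"
  assumes "continuous_on UNIV f"
  obtains B where "B > 0" "\<And>x. x \<in> unit_disc \<Longrightarrow> norm (f x) \<le> B"
proof -
  have "compact (f ` cball 0 1)"
    using assms by (intro compact_continuous_image) (auto intro: continuous_on_subset)
  then obtain B where "B > 0" "\<And>x. x \<in> cball 0 1 \<Longrightarrow> norm (f x) \<le> B"
    using bounded_pos[of "f ` cball 0 1"] by (auto dest: compact_imp_bounded)
  then show ?thesis using that by (auto simp: norm_le_1_unit_disc)
qed

lemma integrable_continuous_mult_disc: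
  fixes f :: "real^2 \<Rightarrow> real" and g :: "real^2 \<Rightarrow> 'b::euclidean_space"
  assumes f: "continuous_on UNIV f" and g: "integrable disc_measure g"
  shows "integrable disc_measure (\<lambda>x. f x *\<^sub>R g x)"
proof -
  obtain B where B: "\<And>x. x \<in> unit_disc \<Longrightarrow> norm (f x) \<le> B"
    using continuous_bounded_disc[OF f] by metis
  show ?thesis
  proof (rule Bochner_Integration.integrable_bound)
    show "integrable disc_measure (\<lambda>x. B * norm (g x))" using g by auto
    show "(\<lambda>x. f x *\<^sub>R g x) \<in> borel_measurable disc_measure"
      using continuous_imp_measurable_disc[OF f] g by measurable
    show "AE x in disc_measure. norm (f x *\<^sub>R g x) \<le> norm (B * norm (g x))"
      using B by (intro AE_I2) (fastforce simp: abs_mult intro!: mult_right_mono)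
  qed
qed

lemma integrable_continuous_disc:
  fixes f :: "real^2 \<Rightarrow> 'b::euclidean_space"
  assumes f: "continuous_on UNIV f"
  shows "integrable disc_measure f"
proof -
  obtain B where B: "\<And>x. x \<in> unit_disc \<Longrightarrow> norm (f x) \<le> B"
    using continuous_bounded_disc[OF f] by metis
  show ?thesis
    by (rule disc.integrable_const_bound[where B = B])
      (auto intro!: AE_I2 B continuous_imp_measurable_disc f)
qed

lemma L2_disc_continuous:
  fixes f :: "real^2 \<Rightarrow> 'b::euclidean_space"
  assumes "continuous_on UNIV f"
  shows "f \<in> L2_disc"
  using assms unfolding L2_disc_def
  by (auto intro!: continuous_imp_measurable_disc integrable_continuous_disc continuous_intros)

lemma L2_disc_integrable:
  fixes f :: "real^2 \<Rightarrow> 'b::euclidean_space"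
  assumes "f \<in> L2_disc"
  shows "integrable disc_measure f"
proof (rule Bochner_Integration.integrable_bound)
  show "integrable disc_measure (\<lambda>x. 1 + (norm (f x))\<^sup>2)"
    using assms by (auto simp: L2_disc_def)
  have "t \<le> 1 + t\<^sup>2" for t :: real
    using zero_le_power2[of "t - 1/2"] by (simp add: power2_eq_square algebra_simps)
  then show "AE x in disc_measure. norm (f x) \<le> norm (1 + (norm (f x))\<^sup>2)"
    by (auto simp: abs_of_nonneg)
qed (use assms in \<open>auto simp: L2_disc_def\<close>)

lemma test_function_continuous:
  "test_function \<phi> \<Longrightarrow> continuous_on UNIV \<phi>"
  "test_function \<phi> \<Longrightarrow> continuous_on UNIV (partial_deriv i \<phi>)"
proof -
  assume "test_function \<phi>"
  then have "C_k 0 \<phi>" "C_k (Suc 0) \<phi>" unfolding test_function_def by blast+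
  then show "continuous_on UNIV \<phi>" "continuous_on UNIV (partial_deriv i \<phi>)" by auto
qed

section \<open>Uniqueness of weak derivatives\<close>

text \<open>By Lebesgue differentiation f is almost everywhere the limit of its averages over small
  cubes with the given point as a corner. For a point of an open set these cubes eventually lie
  inside the set, where the averages vanish.\<close>

lemma AE_zero_of_box_integrals_zero:
  fixes f :: "'a::euclidean_space \<Rightarrow> 'b::euclidean_space"
  assumes "open U" and int: "\<And>a b. f integrable_on cbox a b"
    and zero: "\<And>a b. cbox a b \<subseteq> U \<Longrightarrow> integral (cbox a b) f = 0"
  shows "AE x in lebesgue_on U. f x = 0"
proof -
  obtain N where N: "negligible N"
    and conv: "\<And>x e. x \<notin> N \<Longrightarrow> 0 < e \<Longrightarrow> \<exists>d>0. \<forall>h. 0 < h \<and> h < d \<longrightarrow>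
        norm (integral (cbox x (x + h *\<^sub>R One)) f /\<^sub>R h ^ DIM('a) - f x) < e"
    by (rule integrable_ccontinuous_explicit[of f]) (use int in auto)
  have "f x = 0" if x: "x \<in> U" "x \<notin> N" for x
  proof (rule ccontr)
    assume "f x \<noteq> 0"
    with conv[OF x(2), of "norm (f x)"] obtain d where d: "d > 0"
      "\<And>h. 0 < h \<Longrightarrow> h < d \<Longrightarrow>
        norm (integral (cbox x (x + h *\<^sub>R One)) f /\<^sub>R h ^ DIM('a) - f x) < norm (f x)"
      by auto
    obtain e where e: "e > 0" "cball x e \<subseteq> U"
      using \<open>open U\<close> x(1) open_contains_cball by blast
    \<comment> \<open>The l1 norm bounds the distance from the corner within a cube of side h by h *
      DIM('a), so the second bound keeps the cube in the ball; d is halved because h < d must be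
      strict.\<close>
    define h where "h = min (d / 2) (e / DIM('a))"
    have h: "0 < h" "h < d"
      using d(1) e(1) by (auto simp: h_def min_less_iff_disj)
    have "h \<le> e / DIM('a)" by (simp add: h_def)
    then have h': "h * DIM('a) \<le> e" by (simp add: pos_le_divide_eq)
    have "cbox x (x + h *\<^sub>R One) \<subseteq> cball x e"
    proof
      fix y assume y: "y \<in> cbox x (x + h *\<^sub>R One)"
      have "norm (y - x) \<le> (\<Sum>b\<in>Basis. \<bar>(y - x) \<bullet> b\<bar>)" by (rule norm_le_l1)
      also have "\<dots> \<le> (\<Sum>b\<in>(Basis::'a set). h)"
        using y by (intro sum_mono) (auto simp: mem_box algebra_simps)
      finally show "y \<in> cball x e" using h' by (simp add: dist_norm norm_minus_commute mult.commute)
    qed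
    then have "integral (cbox x (x + h *\<^sub>R One)) f = 0"
      using zero e(2) by blast
    with d(2)[OF h] show False by simp
  qed
  then have "AE x in lebesgue. x \<in> U \<longrightarrow> f x = 0"
    using N by (intro AE_I'[of N]) (auto simp: negligible_iff_null_sets)
  then show ?thesis
    using \<open>open U\<close> by (subst AE_restrict_space_iff) auto
qed

text \<open>The fundamental lemma of the calculus of variations: smooth bumps increase to the
  indicators of boxes, and Lebesgue differentiation over boxes does the rest.\<close>
lemma test_function_integrals_zero_imp_AE_zero:
  fixes h :: "real^2 \<Rightarrow> complex"
  assumes h: "integrable disc_measure h"
    and zero: "\<And>\<phi>. test_function \<phi> \<Longrightarrow> (LINT x|disc_measure. \<phi> x *\<^sub>R h x) = 0"
  shows "AE x in disc_measure. h x = 0"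
proof -
  define f where "f = (\<lambda>x. indicator unit_disc x *\<^sub>R h x)"
  have f: "integrable lebesgue f"
    using h unfolding f_def by (subst (asm) integrable_restrict_space) auto
  have *: "set_integrable lebesgue S f" if "S \<in> sets lebesgue" for S
    unfolding set_integrable_def using f that by (intro integrable_mult_indicator)
  have "AE x in disc_measure. f x = 0"
  proof (rule AE_zero_of_box_integrals_zero)
    show "open unit_disc" by (simp add: unit_disc_def)
    show "f integrable_on cbox a b" for a b
      by (intro set_lebesgue_integral_eq_integral *) auto
    fix a b assume ab: "cbox a b \<subseteq> unit_disc"
    have "(\<lambda>n. LINT x|disc_measure. box_bump (real n) a b x *\<^sub>R h x)
        \<longlonglongrightarrow> (LINT x|disc_measure. indicator (box a b) x *\<^sub>R h x)"
    proof (rule integral_dominated_convergence[where w = "\<lambda>x. norm (h x)"])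
      show "(\<lambda>x. indicator (box a b) x *\<^sub>R h x) \<in> borel_measurable disc_measure"
      proof (intro borel_measurable_scaleR borel_measurable_indicator)
        have "box a b \<subseteq> unit_disc" using ab box_subset_cbox[of a b] by blast
        then show "box a b \<in> sets disc_measure"
          by (subst sets_restrict_space_iff) auto
      qed (use h in auto)
      show "(\<lambda>x. box_bump (real n) a b x *\<^sub>R h x) \<in> borel_measurable disc_measure" for n
        using h test_function_continuous(1)[OF test_function_box_bump[OF _ ab], of "real n"]
        by (intro borel_measurable_integrable integrable_continuous_mult_disc) auto
      show "AE x in disc_measure. (\<lambda>n. box_bump (real n) a b x *\<^sub>R h x)
          \<longlonglongrightarrow> indicator (box a b) x *\<^sub>R h x"
        by (intro AE_I2 tendsto_intros box_bump_tendsto)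
      show "AE x in disc_measure. norm (box_bump (real n) a b x *\<^sub>R h x) \<le> norm (h x)" for n
        by (intro AE_I2) (auto simp: box_bump_bounds abs_of_nonneg intro!: mult_left_le_one_le)
    qed (use h in auto)
    moreover have "(LINT x|disc_measure. box_bump (real n) a b x *\<^sub>R h x) = 0" for n
      using zero test_function_box_bump[OF _ ab] by simp
    ultimately have 0: "(LINT x|disc_measure. indicator (box a b) x *\<^sub>R h x) = 0"
      by (simp add: LIMSEQ_const_iff)
    \<comment> \<open>The bumps converge to the indicator of the open box, whereas the
      differentiation argument uses closed ones.\<close>
    have "integral (cbox a b) f = integral (box a b) f"
      by (rule integral_open_interval[symmetric])
    also have "\<dots> = (LINT x:box a b|lebesgue. f x)"
      by (intro set_lebesgue_integral_eq_integral(2)[symmetric] *) auto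
    also have "\<dots> = (LINT x|lebesgue. indicator unit_disc x *\<^sub>R (indicator (box a b) x *\<^sub>R h x))"
      unfolding set_lebesgue_integral_def f_def by (simp add: mult.commute)
    also have "\<dots> = 0"
      using 0 by (subst (asm) integral_restrict_space) auto
    finally show "integral (cbox a b) f = 0" .
  qed
  then show ?thesis
    by (rule AE_mp) (auto intro!: AE_I2 simp: f_def)
qed

section \<open>Classical derivatives are weak derivatives\<close>

text \<open>Recentring the line turns derivatives at parameter 0, known from every base point, into
  derivatives at every parameter. Hypotheses on directional derivatives can thus be stated at 0
  only, and the mean value inequality still applies along segments.\<close>

lemma has_vector_derivative_along_line:
  fixes F :: "'a::real_normed_vector \<Rightarrow> 'b::real_normed_vector"
  assumes "\<And>x. ((\<lambda>s. F (x + s *\<^sub>R e)) has_vector_derivative G x) (at 0)"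
  shows "((\<lambda>s. F (x + s *\<^sub>R e)) has_vector_derivative G (x + s *\<^sub>R e)) (at s)"
proof -
  have "((\<lambda>t. F ((x + s *\<^sub>R e) + t *\<^sub>R e)) has_vector_derivative G (x + s *\<^sub>R e)) (at (s - s))"
    using assms[of "x + s *\<^sub>R e"] by simp
  moreover have "((\<lambda>t. t - s) has_vector_derivative 1) (at s)"
    by (auto intro!: derivative_eq_intros)
  ultimately have "(((\<lambda>t. F ((x + s *\<^sub>R e) + t *\<^sub>R e)) \<circ> (\<lambda>t. t - s)) has_vector_derivative
     1 *\<^sub>R G (x + s *\<^sub>R e)) (at s)"
    by (intro vector_diff_chain_at)
  then show ?thesis by (simp add: o_def algebra_simps)
qed

lemma integral_translation_lborel:
  fixes F :: "'a::euclidean_space \<Rightarrow> 'b::{banach, second_countable_topology}"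
  assumes "F \<in> borel_measurable borel"
  shows "(LINT x|lborel. F (x + c)) = (LINT x|lborel. F x)"
proof -
  have "(LINT x|lborel. F x) = (LINT x|distr lborel borel ((+) c). F x)"
    by (simp only: lborel_distr_plus)
  also have "\<dots> = (LINT x|lborel. F (c + x))"
    using assms by (subst integral_distr) auto
  finally show ?thesis by (simp add: add.commute)
qed

text \<open>Difference quotients have integral zero by translation invariance.\<close>
lemma integral_directional_derivative_eq_0:
  fixes F :: "'a::euclidean_space \<Rightarrow> 'b::euclidean_space"
  assumes deriv: "\<And>x. ((\<lambda>s. F (x + s *\<^sub>R e)) has_vector_derivative G x) (at 0)"
    and F: "continuous_on UNIV F" and G: "continuous_on UNIV G"
    and supp: "\<And>x. norm x > R \<Longrightarrow> F x = 0"
  shows "(LINT x|lborel. G x) = 0"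
proof -
  define t where "t = (\<lambda>n. 1 / real (Suc n))"
  have t: "0 < t n" "t n \<le> 1" for n by (auto simp: t_def divide_simps)
  define D where "D = (\<lambda>n x. (F (x + t n *\<^sub>R e) - F x) /\<^sub>R t n)"
  have tends: "t \<longlonglongrightarrow> 0" unfolding t_def using LIMSEQ_inverse_real_of_nat by (simp add: inverse_eq_divide)
  have F_meas: "F \<in> borel_measurable borel" and G_meas: "G \<in> borel_measurable borel"
    using F G by (auto intro: borel_measurable_continuous_onI)
  have F_int: "integrable lborel F"
  proof -
    have "integrable lborel (\<lambda>x. indicator (cball 0 R) x *\<^sub>R F x)"
      using F by (intro borel_integrable_compact) (auto intro: continuous_on_subset)
    also have "(\<lambda>x. indicator (cball 0 R) x *\<^sub>R F x) = F"
      using supp by (auto simp: indicator_def fun_eq_iff)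
    finally show ?thesis .
  qed
  have D_int: "(LINT x|lborel. D n x) = 0" for n
  proof -
    have "integrable lborel (\<lambda>x. F (t n *\<^sub>R e + x))"
      using F_int F_meas by (subst (asm) lborel_distr_plus[of "t n *\<^sub>R e", symmetric])
        (simp add: integrable_distr_eq)
    then show ?thesis unfolding D_def using F_int
      by (simp add: integral_translation_lborel[OF F_meas] add.commute)
  qed
  \<comment> \<open>If norm x exceeds R + norm e, both points of the difference quotient lie outside
    the support of F. Otherwise the segment between them stays within radius R + 2 * norm e, where
    \<open>B\<close> bounds the derivative and hence the quotient.\<close>
  have "compact (G ` cball 0 (R + 2 * norm e))"
    using G by (intro compact_continuous_image) (auto intro: continuous_on_subset)
  then obtain B where B: "B > 0" "\<And>x. norm x \<le> R + 2 * norm e \<Longrightarrow> norm (G x) \<le> B"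
    using bounded_pos[of "G ` cball 0 (R + 2 * norm e)"] by (auto dest: compact_imp_bounded)
  have "(\<lambda>n. LINT x|lborel. D n x) \<longlonglongrightarrow> (LINT x|lborel. G x)"
  proof (rule integral_dominated_convergence[where w = "\<lambda>x. indicator (cball 0 (R + norm e)) x *\<^sub>R B"])
    show "AE x in lborel. (\<lambda>n. D n x) \<longlonglongrightarrow> G x"
    proof (rule AE_I2)
      fix x
      have "((\<lambda>s. (F (x + s *\<^sub>R e) - F x) /\<^sub>R s) \<longlongrightarrow> G x) (at 0)"
      proof -
        have "((\<lambda>s. norm (F (x + s *\<^sub>R e) - F x - s *\<^sub>R G x) / norm s) \<longlongrightarrow> 0) (at 0)"
          using deriv[of x] by (simp add: has_vector_derivative_def has_derivative_at)
        then have "((\<lambda>s. norm ((F (x + s *\<^sub>R e) - F x) /\<^sub>R s - G x)) \<longlongrightarrow> 0) (at 0)"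
        proof (rule Lim_transform_eventually)
          have "norm (v - s *\<^sub>R w) / norm s = norm (v /\<^sub>R s - w)" if "s \<noteq> 0" for s and v w :: 'b
          proof -
            have "v /\<^sub>R s - w = (v - s *\<^sub>R w) /\<^sub>R s" using that by (simp add: scaleR_diff_right)
            then show ?thesis by (simp add: divide_inverse mult.commute)
          qed
          then show "\<forall>\<^sub>F s in at 0. norm (F (x + s *\<^sub>R e) - F x - s *\<^sub>R G x) / norm s
              = norm ((F (x + s *\<^sub>R e) - F x) /\<^sub>R s - G x)"
            by (auto simp: eventually_at_filter)
        qed
        then show ?thesis by (simp add: tendsto_norm_zero_iff LIM_zero_iff)
      qed
      moreover have "filterlim t (at 0) sequentially"
        unfolding filterlim_at using tends t(1) by (auto simp: less_imp_neq[symmetric])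
      ultimately show "(\<lambda>n. D n x) \<longlonglongrightarrow> G x"
        unfolding D_def by (rule filterlim_compose)
    qed
    show "AE x in lborel. norm (D n x) \<le> indicator (cball 0 (R + norm e)) x *\<^sub>R B" for n
    proof (rule AE_I2)
      fix x
      show "norm (D n x) \<le> indicator (cball 0 (R + norm e)) x *\<^sub>R B"
      proof (cases "norm x \<le> R + norm e")
        case True
        have "norm (F (x + t n *\<^sub>R e) - F (x + 0 *\<^sub>R e)) \<le> B * norm (t n - 0)"
        proof (rule differentiable_bound[of "{0..t n}"])
          fix s assume s: "s \<in> {0..t n}"
          show "((\<lambda>s. F (x + s *\<^sub>R e)) has_derivative (\<lambda>r. r *\<^sub>R G (x + s *\<^sub>R e))) (at s within {0..t n})"
            using has_vector_derivative_along_line[of F e G x s, OF deriv]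
            by (auto simp: has_vector_derivative_def intro: has_derivative_at_withinI)
          have "norm (x + s *\<^sub>R e) \<le> norm x + \<bar>s\<bar> * norm e"
            using norm_triangle_ineq[of x "s *\<^sub>R e"] by simp
          also have "\<dots> \<le> R + 2 * norm e"
            using True s t(2)[of n] mult_right_mono[of s 1 "norm e"] by auto
          finally show "onorm (\<lambda>r. r *\<^sub>R G (x + s *\<^sub>R e)) \<le> B"
            using B(2) by (auto simp: onorm_scaleR_left bounded_linear_ident onorm_id)
        qed (use t(1)[of n] in auto)
        then have "norm (F (x + t n *\<^sub>R e) - F x) \<le> B * t n" using t(1)[of n] by simp
        moreover have "norm (D n x) = norm (F (x + t n *\<^sub>R e) - F x) / t n"
          unfolding D_def norm_scaleR using t(1)[of n] by (simp add: divide_inverse)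
        ultimately show ?thesis
          using True t(1)[of n] by (simp add: pos_divide_le_eq)
      next
        case False
        have "norm x \<le> norm (x + t n *\<^sub>R e) + norm (t n *\<^sub>R e)"
          using norm_triangle_ineq4[of "x + t n *\<^sub>R e" "t n *\<^sub>R e"] by simp
        also have "norm (t n *\<^sub>R e) \<le> norm e"
          using t(1)[of n] mult_right_mono[OF t(2)[of n] norm_ge_zero[of e]] by simp
        finally have "norm (x + t n *\<^sub>R e) > R" using False by simp
        moreover have "norm x > R" using False norm_ge_zero[of e] by linarith
        ultimately show ?thesis using B(1) by (simp add: D_def supp)
      qed
    qed
    show "integrable lborel (\<lambda>x. indicator (cball 0 (R + norm e)) x *\<^sub>R B)"
      by (intro borel_integrable_compact) auto
    show "G \<in> borel_measurable lborel" using G_meas by simp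
    show "D n \<in> borel_measurable lborel" for n
      unfolding D_def using F_meas by measurable
  qed
  then show ?thesis by (simp add: D_int LIMSEQ_const_iff)
qed

text \<open>Integration by parts without boundary terms: the product of \<Phi> with a test function
  has compact support in the disc, so its directional derivative has integral zero over the whole
  plane.\<close>

lemma is_weak_partial_classical:
  assumes deriv: "\<And>x. ((\<lambda>s. \<Phi> (x + s *\<^sub>R axis i 1)) has_vector_derivative G x) (at 0)"
    and \<Phi>: "continuous_on UNIV \<Phi>" and G: "continuous_on UNIV G"
  shows "is_weak_partial i \<Phi> G"
  unfolding is_weak_partial_def
proof (intro allI impI)
  fix \<phi> :: "real^2 \<Rightarrow> real" assume \<phi>: "test_function \<phi>"
  note cont = test_function_continuous[OF \<phi>]
  obtain K where K: "compact K" "K \<subseteq> unit_disc" "\<And>x. x \<notin> K \<Longrightarrow> \<phi> x = 0"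
    using \<phi> by (auto simp: test_function_def)
  let ?e = "axis i 1 :: real^2"
  define D where "D = (\<lambda>x. \<phi> x *\<^sub>R G x + partial_deriv i \<phi> x *\<^sub>R \<Phi> x)"
  have D_cont: "continuous_on UNIV D"
    unfolding D_def using cont \<Phi> G by (intro continuous_intros)
  have D: "((\<lambda>s. \<phi> (x + s *\<^sub>R ?e) *\<^sub>R \<Phi> (x + s *\<^sub>R ?e)) has_vector_derivative D x) (at 0)" for x
  proof -
    have "C_k (Suc 0) \<phi>" using \<phi> unfolding test_function_def by blast
    then have "(\<phi> has_derivative frechet_derivative \<phi> (at x)) (at (x + 0 *\<^sub>R ?e))"
      by (simp flip: frechet_derivative_works)
    moreover have "((\<lambda>s. x + s *\<^sub>R ?e) has_vector_derivative ?e) (at 0)"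
      by (auto intro!: derivative_eq_intros)
    ultimately have "((\<phi> \<circ> (\<lambda>s. x + s *\<^sub>R ?e)) has_vector_derivative
        frechet_derivative \<phi> (at x) ?e) (at 0)"
      by (intro vector_derivative_diff_chain_within) (auto intro: has_derivative_at_withinI)
    then have "((\<lambda>s. \<phi> (x + s *\<^sub>R ?e)) has_real_derivative partial_deriv i \<phi> x) (at 0)"
      by (simp add: has_real_derivative_iff_has_vector_derivative partial_deriv_def o_def)
    from has_vector_derivative_scaleR[OF this deriv[of x]]
    show ?thesis by (simp add: D_def)
  qed
  \<comment> \<open>The complement of \<open>K\<close> is open, so the product vanishes along a
    short piece of the line through x, and its derivative \<open>D\<close> is zero by uniqueness.
    This lets the integral over the disc be taken over the plane.\<close>
  have D_0: "D x = 0" if "x \<notin> K" for x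
  proof -
    have "open (- K)" using K(1) by (simp add: compact_imp_closed open_Compl)
    then have "open ((\<lambda>s. x + s *\<^sub>R ?e) -` (- K))"
      by (rule open_vimage) (auto intro!: continuous_intros)
    then have "((\<lambda>s. \<phi> (x + s *\<^sub>R ?e) *\<^sub>R \<Phi> (x + s *\<^sub>R ?e)) has_vector_derivative 0) (at 0)"
    proof (rule has_vector_derivative_transform_within_open[rotated])
      show "0 \<in> (\<lambda>s. x + s *\<^sub>R ?e) -` (- K)" using \<open>x \<notin> K\<close> by simp
      show "0 = \<phi> (x + s *\<^sub>R ?e) *\<^sub>R \<Phi> (x + s *\<^sub>R ?e)" if "s \<in> (\<lambda>s. x + s *\<^sub>R ?e) -` (- K)" for s
        using that K(3) by simp
    qed simp
    with D show ?thesis by (rule vector_derivative_unique_at)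
  qed
  have "(LINT x|disc_measure. D x) = (LINT x|lborel. indicator unit_disc x *\<^sub>R D x)"
    using D_cont by (intro integral_disc_borel borel_measurable_continuous_onI)
  also have "(\<lambda>x. indicator unit_disc x *\<^sub>R D x) = D"
    using D_0 K(2) by (auto simp: indicator_def fun_eq_iff)
  also have "(LINT x|lborel. D x) = 0"
  proof (rule integral_directional_derivative_eq_0[OF D])
    show "continuous_on UNIV (\<lambda>x. \<phi> x *\<^sub>R \<Phi> x)" using cont \<Phi> by (intro continuous_intros)
    show "\<phi> x *\<^sub>R \<Phi> x = 0" if "norm x > 1" for x
      using that K(2,3) norm_le_1_unit_disc[of x] by fastforce
  qed (rule D_cont)
  finally show "(LINT x|disc_measure. partial_deriv i \<phi> x *\<^sub>R \<Phi> x) = - (LINT x|disc_measure. \<phi> x *\<^sub>R G x)"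
    unfolding D_def using cont \<Phi> G
    by (subst (asm) Bochner_Integration.integral_add)
      (auto intro!: integrable_continuous_disc continuous_intros simp: add_eq_0_iff)
qed

text \<open>\<open>weak_partial\<close> is a choice, so its values can be reached only through
  uniqueness: the difference of two weak derivatives integrates to zero against every test
  function.\<close>

lemma weak_partial_classical:
  assumes deriv: "\<And>x. ((\<lambda>s. \<Phi> (x + s *\<^sub>R axis i 1)) has_vector_derivative G x) (at 0)"
    and \<Phi>: "continuous_on UNIV \<Phi>" and G: "continuous_on UNIV G"
  shows "AE x in disc_measure. weak_partial i \<Phi> x = G x"
proof -
  have weak: "is_weak_partial i \<Phi> G" by (rule is_weak_partial_classical[OF assms])
  define g where "g = weak_partial i \<Phi>"
  have "g \<in> L2_disc \<and> is_weak_partial i \<Phi> g"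
    unfolding g_def weak_partial_def by (rule someI[of _ G]) (use weak L2_disc_continuous[OF G] in auto)
  then have g: "integrable disc_measure g" "is_weak_partial i \<Phi> g"
    using L2_disc_integrable by auto
  note G_int = integrable_continuous_disc[OF G]
  have "AE x in disc_measure. g x - G x = 0"
  proof (rule test_function_integrals_zero_imp_AE_zero)
    fix \<phi> assume \<phi>: "test_function \<phi>"
    note cont = test_function_continuous(1)[OF \<phi>]
    have "(LINT x|disc_measure. \<phi> x *\<^sub>R g x) = (LINT x|disc_measure. \<phi> x *\<^sub>R G x)"
      using weak[unfolded is_weak_partial_def, rule_format, OF \<phi>]
        g(2)[unfolded is_weak_partial_def, rule_format, OF \<phi>] by simp
    then show "(LINT x|disc_measure. \<phi> x *\<^sub>R (g x - G x)) = 0"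
      using integrable_continuous_mult_disc[OF cont g(1)] integrable_continuous_mult_disc[OF cont G_int]
      by (simp add: scaleR_diff_right)
  qed (use g G_int in auto)
  then show ?thesis by (simp add: g_def)
qed

section \<open>The Thomas-Fermi functional and the energy lower bound\<close>

lemma measure_disc:
  "measure disc_measure (space disc_measure) = measure lborel unit_disc" "0 < measure lborel unit_disc"
  using content_ball_pos[of 1 "0::real^2"] by (auto simp: unit_disc_def measure_restrict_space)

text \<open>The variance of |f| for the normalized measure is nonnegative. Expanding it around the
  mean \<open>a\<close> gives Cauchy-Schwarz against the constant 1.\<close>

lemma L1_norm_disc_le:
  fixes f :: "real^2 \<Rightarrow> real"
  assumes "f \<in> L2_disc"
  shows "(L1_norm_disc f)\<^sup>2 \<le> measure disc_measure (space disc_measure) * (LINT x|disc_measure. (f x)\<^sup>2)"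
proof -
  define m where "m = measure disc_measure (space disc_measure)"
  define a where "a = L1_norm_disc f / m"
  have m: "m > 0" unfolding m_def measure_disc(1) by (rule measure_disc(2))
  have int: "integrable disc_measure f" "integrable disc_measure (\<lambda>x. (f x)\<^sup>2)"
    using L2_disc_integrable[OF assms] assms by (auto simp: L2_disc_def)
  have "0 \<le> (LINT x|disc_measure. (\<bar>f x\<bar> - a)\<^sup>2)" by simp
  also have "\<dots> = (LINT x|disc_measure. (f x)\<^sup>2 - 2 * a * \<bar>f x\<bar> + a\<^sup>2)"
    by (intro Bochner_Integration.integral_cong) (auto simp: power2_diff)
  also have "\<dots> = (LINT x|disc_measure. (f x)\<^sup>2) - 2 * a * L1_norm_disc f + m * a\<^sup>2"
    using int by (simp add: L1_norm_disc_def m_def)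
  also have "\<dots> = (LINT x|disc_measure. (f x)\<^sup>2) - (L1_norm_disc f)\<^sup>2 / m"
    using m by (simp add: a_def power2_eq_square field_simps)
  finally show ?thesis using m by (simp add: field_simps m_def)
qed

section \<open>The Thomas-Fermi minimizer\<close>

text \<open>The solution of the Euler-Lagrange equation with the constraint of nonnegativity.
  Leaving \<open>l\<close> to be fixed by the mass treats the density with a hole and the one
  without at once.\<close>

definition TF_profile :: "real \<Rightarrow> real \<Rightarrow> real^2 \<Rightarrow> real" where
  "TF_profile \<Omega>\<^sub>0 l x = max 0 (\<Omega>\<^sub>0\<^sup>2 / 8 * (norm x)\<^sup>2 + l)"

lemma continuous_on_TF_profile: "continuous_on UNIV (TF_profile \<Omega>\<^sub>0 l)"
  unfolding TF_profile_def by (intro continuous_intros)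

lemma TF_profile_in_domain: "TF_profile \<Omega>\<^sub>0 l \<in> TF_domain"
  using L2_disc_continuous[OF continuous_on_TF_profile]
  by (auto simp: TF_domain_def TF_profile_def)

text \<open>The mass is Lipschitz in l with the area as constant. It is zero at -\<Omega>0^2 / 8,
  where the profile vanishes on the disc, and at least 1 at the inverse area, so the intermediate
  value theorem applies.\<close>

lemma TF_profile_normalized_exists:
  obtains l where "(LINT x|disc_measure. TF_profile \<Omega>\<^sub>0 l x) = 1"
proof -
  define m where "m = measure disc_measure (space disc_measure)"
  have m: "m > 0" unfolding m_def measure_disc(1) by (rule measure_disc(2))
  define M where "M = (\<lambda>l. LINT x|disc_measure. TF_profile \<Omega>\<^sub>0 l x)"
  note int = integrable_continuous_disc[OF continuous_on_TF_profile]
  have lip: "\<bar>M a - M b\<bar> \<le> m * \<bar>a - b\<bar>" for a b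
  proof -
    have "\<bar>M a - M b\<bar> = \<bar>LINT x|disc_measure. TF_profile \<Omega>\<^sub>0 a x - TF_profile \<Omega>\<^sub>0 b x\<bar>"
      unfolding M_def using int by simp
    also have "\<dots> \<le> (LINT x|disc_measure. \<bar>TF_profile \<Omega>\<^sub>0 a x - TF_profile \<Omega>\<^sub>0 b x\<bar>)"
      by (rule integral_abs_bound)
    also have "\<dots> \<le> (LINT x|disc_measure. \<bar>a - b\<bar>)"
    proof (rule integral_mono)
      show "integrable disc_measure (\<lambda>x. \<bar>TF_profile \<Omega>\<^sub>0 a x - TF_profile \<Omega>\<^sub>0 b x\<bar>)"
        by (rule integrable_abs[OF Bochner_Integration.integrable_diff[OF int int]])
      show "\<bar>TF_profile \<Omega>\<^sub>0 a x - TF_profile \<Omega>\<^sub>0 b x\<bar> \<le> \<bar>a - b\<bar>" for x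
        by (auto simp: TF_profile_def)
    qed simp
    finally show ?thesis by (simp add: m_def)
  qed
  have "\<exists>l\<ge>-(\<Omega>\<^sub>0\<^sup>2/8). l \<le> 1 / m \<and> M l = 1"
  proof (rule IVT')
    have "M (-(\<Omega>\<^sub>0\<^sup>2/8)) = (LINT x|disc_measure. 0)"
      unfolding M_def
    proof (rule Bochner_Integration.integral_cong)
      fix x assume "x \<in> space disc_measure"
      then have "(norm x)\<^sup>2 \<le> 1" by (auto simp: power_le_one norm_le_1_unit_disc)
      then have "\<Omega>\<^sub>0\<^sup>2 / 8 * (norm x)\<^sup>2 \<le> \<Omega>\<^sub>0\<^sup>2 / 8 * 1" by (intro mult_left_mono) auto
      then show "TF_profile \<Omega>\<^sub>0 (-(\<Omega>\<^sub>0\<^sup>2/8)) x = 0" by (simp add: TF_profile_def)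
    qed simp
    then show "M (-(\<Omega>\<^sub>0\<^sup>2/8)) \<le> 1" by simp
    have "(LINT x|disc_measure. 1 / m) \<le> M (1 / m)"
      unfolding M_def using int by (intro integral_mono) (auto simp: TF_profile_def le_max_iff_disj)
    then show "1 \<le> M (1 / m)" using m by (simp add: m_def)
    have "- (\<Omega>\<^sub>0\<^sup>2 / 8) \<le> 0" "0 \<le> 1 / m" using m by auto
    then show "- (\<Omega>\<^sub>0\<^sup>2 / 8) \<le> 1 / m" by linarith
    show "continuous_on {- (\<Omega>\<^sub>0\<^sup>2 / 8)..1 / m} M"
    proof (rule continuous_onI)
      fix a e :: real assume "e > 0"
      then show "\<exists>d>0. \<forall>b\<in>{- (\<Omega>\<^sub>0\<^sup>2 / 8)..1 / m}. dist b a < d \<longrightarrow> dist (M b) (M a) \<le> e"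
        using lip m
        by (intro exI[of _ "e / m"]) (auto simp: dist_real_def pos_less_divide_eq mult.commute
            intro: order_trans[OF _ less_imp_le])
    qed
  qed
  then show ?thesis using that by (auto simp: M_def)
qed

lemma TF_energy_integrable:
  assumes "\<rho> \<in> L2_disc"
  shows "integrable disc_measure (\<lambda>x. (\<rho> x)\<^sup>2 - \<Omega>\<^sub>0\<^sup>2 * (norm x)\<^sup>2 * \<rho> x / 4)"
proof -
  have "integrable disc_measure (\<lambda>x. (\<Omega>\<^sub>0\<^sup>2 * (norm x)\<^sup>2 / 4) *\<^sub>R \<rho> x)"
    by (intro integrable_continuous_mult_disc L2_disc_integrable assms) (auto intro!: continuous_intros)
  then show ?thesis using assms by (auto simp: L2_disc_def)
qed

lemma L2_disc_diff:
  fixes f g :: "real^2 \<Rightarrow> real"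
  assumes "f \<in> L2_disc" "g \<in> L2_disc"
  shows "(\<lambda>x. f x - g x) \<in> L2_disc"
  unfolding L2_disc_def
proof (intro CollectI conjI)
  have meas: "f \<in> borel_measurable disc_measure" "g \<in> borel_measurable disc_measure"
    using assms by (auto simp: L2_disc_def)
  then show "(\<lambda>x. f x - g x) \<in> borel_measurable disc_measure" by simp
  show "integrable disc_measure (\<lambda>x. (norm (f x - g x))\<^sup>2)"
  proof (rule Bochner_Integration.integrable_bound)
    show "integrable disc_measure (\<lambda>x. 2 * (norm (f x))\<^sup>2 + 2 * (norm (g x))\<^sup>2)"
      using assms by (auto simp: L2_disc_def)
    have "(a - b)\<^sup>2 \<le> 2 * a\<^sup>2 + 2 * b\<^sup>2" for a b :: real
      using zero_le_power2[of "a + b"] by (simp add: power2_sum power2_diff)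
    then show "AE x in disc_measure. norm ((norm (f x - g x))\<^sup>2) \<le> norm (2 * (norm (f x))\<^sup>2 + 2 * (norm (g x))\<^sup>2)"
      by (auto intro!: AE_I2)
  qed (use meas in simp)
qed

text \<open>Below, the variational inequality is the pointwise bound by the Lagrange multiplier \<open>2 * l\<close>:
  \<open>2 * \<rho> - \<Omega>\<^sub>0\<^sup>2 * r\<^sup>2 / 4 \<ge> 2 * l\<close>, with equality where \<open>\<rho> > 0\<close>.\<close>
lemma TF_energy_gap:
  assumes l: "(LINT x|disc_measure. TF_profile \<Omega>\<^sub>0 l x) = 1"
    and \<sigma>: "\<sigma> \<in> TF_domain" "(LINT x|disc_measure. \<sigma> x) = 1"
  shows "(LINT x|disc_measure. (\<sigma> x - TF_profile \<Omega>\<^sub>0 l x)\<^sup>2)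
    \<le> TF_energy \<Omega>\<^sub>0 \<sigma> - TF_energy \<Omega>\<^sub>0 (TF_profile \<Omega>\<^sub>0 l)"
proof -
  define \<rho> where "\<rho> = TF_profile \<Omega>\<^sub>0 l"
  have \<rho>: "\<rho> \<in> TF_domain" unfolding \<rho>_def by (rule TF_profile_in_domain)
  have L2: "\<rho> \<in> L2_disc" "\<sigma> \<in> L2_disc" using \<rho> \<sigma> by (auto simp: TF_domain_def)
  note int = TF_energy_integrable[OF L2(1)] TF_energy_integrable[OF L2(2)]
    L2_disc_integrable[OF L2(1)] L2_disc_integrable[OF L2(2)]
  have sq: "integrable disc_measure (\<lambda>x. (\<sigma> x - \<rho> x)\<^sup>2)"
    using L2_disc_diff[OF L2(2,1)] by (simp add: L2_disc_def)
  \<comment> \<open>Both densities have mass 1, so the multiplier term can be added without changing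
    the integral; only with it does the comparison hold pointwise.\<close>
  have "(LINT x|disc_measure. (\<sigma> x - \<rho> x)\<^sup>2)
      = (LINT x|disc_measure. (\<sigma> x - \<rho> x)\<^sup>2 + 2 * l * (\<sigma> x - \<rho> x))"
    using int(3,4) sq \<sigma>(2) l by (simp add: \<rho>_def)
  also have "\<dots> \<le> (LINT x|disc_measure. ((\<sigma> x)\<^sup>2 - \<Omega>\<^sub>0\<^sup>2 * (norm x)\<^sup>2 * \<sigma> x / 4)
      - ((\<rho> x)\<^sup>2 - \<Omega>\<^sub>0\<^sup>2 * (norm x)\<^sup>2 * \<rho> x / 4))"
  proof (rule integral_mono_AE)
    show "AE x in disc_measure. (\<sigma> x - \<rho> x)\<^sup>2 + 2 * l * (\<sigma> x - \<rho> x)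
       \<le> ((\<sigma> x)\<^sup>2 - \<Omega>\<^sub>0\<^sup>2 * (norm x)\<^sup>2 * \<sigma> x / 4) - ((\<rho> x)\<^sup>2 - \<Omega>\<^sub>0\<^sup>2 * (norm x)\<^sup>2 * \<rho> x / 4)"
      using \<sigma>(1) unfolding TF_domain_def
    proof (elim CollectE conjE AE_mp, intro AE_I2 impI)
      fix x assume s: "0 \<le> \<sigma> x"
      define q where "q = \<Omega>\<^sub>0\<^sup>2 * (norm x)\<^sup>2 / 8"
      \<comment> \<open>The two sides of the pointwise inequality differ by exactly twice this
        product.\<close>
      have "0 \<le> (\<rho> x - q - l) * (\<sigma> x - \<rho> x)"
      proof (cases "q + l \<ge> 0")
        case True
        then have "\<rho> x = q + l" by (simp add: \<rho>_def TF_profile_def q_def)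
        then show ?thesis by simp
      next
        case False
        then have "\<rho> x = 0" by (simp add: \<rho>_def TF_profile_def q_def)
        then show ?thesis using False s by (auto intro!: mult_nonneg_nonneg)
      qed
      moreover have "\<Omega>\<^sub>0\<^sup>2 * (norm x)\<^sup>2 * \<sigma> x / 4 = 2 * q * \<sigma> x" "\<Omega>\<^sub>0\<^sup>2 * (norm x)\<^sup>2 * \<rho> x / 4 = 2 * q * \<rho> x"
        by (simp_all add: q_def)
      ultimately show "(\<sigma> x - \<rho> x)\<^sup>2 + 2 * l * (\<sigma> x - \<rho> x)
         \<le> ((\<sigma> x)\<^sup>2 - \<Omega>\<^sub>0\<^sup>2 * (norm x)\<^sup>2 * \<sigma> x / 4) - ((\<rho> x)\<^sup>2 - \<Omega>\<^sub>0\<^sup>2 * (norm x)\<^sup>2 * \<rho> x / 4)"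
        by (simp only:) (simp add: algebra_simps power2_eq_square)
    qed
    show "integrable disc_measure (\<lambda>x. (\<sigma> x - \<rho> x)\<^sup>2 + 2 * l * (\<sigma> x - \<rho> x))"
      using int sq by (intro Bochner_Integration.integrable_add integrable_mult_right Bochner_Integration.integrable_diff) auto
    show "integrable disc_measure (\<lambda>x. ((\<sigma> x)\<^sup>2 - \<Omega>\<^sub>0\<^sup>2 * (norm x)\<^sup>2 * \<sigma> x / 4)
        - ((\<rho> x)\<^sup>2 - \<Omega>\<^sub>0\<^sup>2 * (norm x)\<^sup>2 * \<rho> x / 4))"
      by (rule Bochner_Integration.integrable_diff[OF int(2) int(1)])
  qed
  also have "\<dots> = TF_energy \<Omega>\<^sub>0 \<sigma> - TF_energy \<Omega>\<^sub>0 \<rho>"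
    unfolding TF_energy_def using int(1,2) by (rule Bochner_Integration.integral_diff[rotated])
  finally show ?thesis by (simp add: \<rho>_def)
qed

text \<open>The profile is a minimizer, so the choice behind \<open>rho_TF\<close> is a minimizer
  too, and the energy gap leaves no L2 distance between them. From here on the profile can replace
  \<open>rho_TF\<close> under integrals, for which measurability is recorded as well.\<close>

lemma rho_TF_AE_eq_profile:
  assumes l: "(LINT x|disc_measure. TF_profile \<Omega>\<^sub>0 l x) = 1"
  shows "rho_TF \<Omega>\<^sub>0 \<in> borel_measurable disc_measure"
    "AE x in disc_measure. rho_TF \<Omega>\<^sub>0 x = TF_profile \<Omega>\<^sub>0 l x"
proof -
  let ?\<rho> = "TF_profile \<Omega>\<^sub>0 l"
  have "TF_minimizer \<Omega>\<^sub>0 ?\<rho>"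
    unfolding TF_minimizer_def
  proof (intro conjI ballI impI)
    fix \<sigma> assume "\<sigma> \<in> TF_domain" "(LINT x|disc_measure. \<sigma> x) = 1"
    from TF_energy_gap[OF l this] have "0 \<le> TF_energy \<Omega>\<^sub>0 \<sigma> - TF_energy \<Omega>\<^sub>0 ?\<rho>"
      by (rule order_trans[rotated]) simp
    then show "TF_energy \<Omega>\<^sub>0 ?\<rho> \<le> TF_energy \<Omega>\<^sub>0 \<sigma>" by simp
  qed (use l TF_profile_in_domain in auto)
  then have "TF_minimizer \<Omega>\<^sub>0 (rho_TF \<Omega>\<^sub>0)" unfolding rho_TF_def by (rule someI[of "TF_minimizer \<Omega>\<^sub>0"])
  then have min: "rho_TF \<Omega>\<^sub>0 \<in> TF_domain" "(LINT x|disc_measure. rho_TF \<Omega>\<^sub>0 x) = 1"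
    "TF_energy \<Omega>\<^sub>0 (rho_TF \<Omega>\<^sub>0) \<le> TF_energy \<Omega>\<^sub>0 ?\<rho>"
    using l TF_profile_in_domain by (auto simp: TF_minimizer_def)
  then show "rho_TF \<Omega>\<^sub>0 \<in> borel_measurable disc_measure" by (simp add: TF_domain_def L2_disc_def)
  have "(\<lambda>x. rho_TF \<Omega>\<^sub>0 x - ?\<rho> x) \<in> L2_disc"
    using min(1) TF_profile_in_domain by (intro L2_disc_diff) (auto simp: TF_domain_def)
  then have "integrable disc_measure (\<lambda>x. (rho_TF \<Omega>\<^sub>0 x - ?\<rho> x)\<^sup>2)" by (simp add: L2_disc_def)
  moreover have "(LINT x|disc_measure. (rho_TF \<Omega>\<^sub>0 x - ?\<rho> x)\<^sup>2) = 0"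
    using TF_energy_gap[OF l min(1,2)] min(3) by (intro antisym) auto
  ultimately have "AE x in disc_measure. (rho_TF \<Omega>\<^sub>0 x - ?\<rho> x)\<^sup>2 = 0"
    by (subst (asm) integral_nonneg_eq_0_iff_AE) auto
  then show "AE x in disc_measure. rho_TF \<Omega>\<^sub>0 x = ?\<rho> x" by simp
qed

text \<open>Completing the square with the vector potential \<open>(-\<Omega> y / 2, \<Omega> x / 2)\<close>.\<close>
lemma magnetic_square:
  fixes p g\<^sub>1 g\<^sub>2 :: complex and X Y \<Omega> :: real
  shows "(cmod g\<^sub>1)\<^sup>2 + (cmod g\<^sub>2)\<^sup>2 - \<Omega> * Re (cnj p * (- \<i> * (of_real X * g\<^sub>2 - of_real Y * g\<^sub>1)))
    = (cmod (g\<^sub>1 + \<i> * of_real (\<Omega> * Y / 2) * p))\<^sup>2 + (cmod (g\<^sub>2 - \<i> * of_real (\<Omega> * X / 2) * p))\<^sup>2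
      - \<Omega>\<^sup>2 * (X\<^sup>2 + Y\<^sup>2) * (cmod p)\<^sup>2 / 4"
  unfolding cmod_power2 by simp (simp add: power2_eq_square algebra_simps)

section \<open>The GP energy with the square completed\<close>

lemma norm_vec2: "(norm (x :: real^2))\<^sup>2 = (x $ 1)\<^sup>2 + (x $ 2)\<^sup>2"
  by (simp add: norm_vec_def L2_set_def sum_2)

lemma L2_disc_mult_integrable:
  fixes f g :: "real^2 \<Rightarrow> complex"
  assumes "f \<in> L2_disc" "g \<in> L2_disc"
  shows "integrable disc_measure (\<lambda>x. cnj (f x) * g x)"
proof (rule Bochner_Integration.integrable_bound)
  show "integrable disc_measure (\<lambda>x. (norm (f x))\<^sup>2 + (norm (g x))\<^sup>2)"
    using assms by (auto simp: L2_disc_def)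
  have "f \<in> borel_measurable disc_measure" "g \<in> borel_measurable disc_measure"
    using assms by (auto simp: L2_disc_def)
  then show "(\<lambda>x. cnj (f x) * g x) \<in> borel_measurable disc_measure" 
    by (intro borel_measurable_times borel_measurable_continuous_on[where f = cnj])
      (auto intro: continuous_intros)
  have "a * b \<le> a\<^sup>2 + b\<^sup>2" for a b :: real
    using zero_le_power2[of "a - b"] zero_le_power2[of "a + b"] by (simp add: power2_sum power2_diff)
  then show "AE x in disc_measure. norm (cnj (f x) * g x) \<le> norm ((norm (f x))\<^sup>2 + (norm (g x))\<^sup>2)"
    by (auto intro!: AE_I2 simp: norm_mult)
qed

text \<open>Products of two L2 functions are integrable and the coordinates are bounded on the disc.
  This is what allows the real part to be moved under the integral, where the square is
  completed.\<close>

lemma GP_kinetic_integrable: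
  fixes \<Psi> g\<^sub>1 g\<^sub>2 :: "real^2 \<Rightarrow> complex"
  assumes L2: "\<Psi> \<in> L2_disc" "g\<^sub>1 \<in> L2_disc" "g\<^sub>2 \<in> L2_disc"
  shows "integrable disc_measure (\<lambda>x. of_real ((norm (g\<^sub>1 x))\<^sup>2 + (norm (g\<^sub>2 x))\<^sup>2) - of_real \<Omega> *
     (cnj (\<Psi> x) * (- \<i> * (of_real (x $ 1) * g\<^sub>2 x - of_real (x $ 2) * g\<^sub>1 x))))"
proof -
  have "integrable disc_measure (\<lambda>x. (x $ 1) *\<^sub>R (cnj (\<Psi> x) * g\<^sub>2 x))"
    "integrable disc_measure (\<lambda>x. (x $ 2) *\<^sub>R (cnj (\<Psi> x) * g\<^sub>1 x))"
    using L2 by (auto intro!: integrable_continuous_mult_disc L2_disc_mult_integrable continuous_intros)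
  then have "integrable disc_measure (\<lambda>x. of_real \<Omega> * (- \<i> *
      ((x $ 1) *\<^sub>R (cnj (\<Psi> x) * g\<^sub>2 x) - (x $ 2) *\<^sub>R (cnj (\<Psi> x) * g\<^sub>1 x))))"
    by (intro integrable_mult_right Bochner_Integration.integrable_diff)
  moreover have "integrable disc_measure (\<lambda>x. of_real ((norm (g\<^sub>1 x))\<^sup>2 + (norm (g\<^sub>2 x))\<^sup>2) :: complex)"
    using L2 by (intro integrable_of_real Bochner_Integration.integrable_add) (auto simp: L2_disc_def)
  ultimately have "integrable disc_measure (\<lambda>x. of_real ((norm (g\<^sub>1 x))\<^sup>2 + (norm (g\<^sub>2 x))\<^sup>2) - of_real \<Omega> * (- \<i> *
      ((x $ 1) *\<^sub>R (cnj (\<Psi> x) * g\<^sub>2 x) - (x $ 2) *\<^sub>R (cnj (\<Psi> x) * g\<^sub>1 x))))"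
    by (intro Bochner_Integration.integrable_diff)
  then show ?thesis by (simp add: scaleR_conv_of_real algebra_simps)
qed

text \<open>A real upper bound on the energy makes the extended quartic term finite, which puts
  |\<Psi>|^2 into L2. The completed squares are then dropped, and \<epsilon>^2 \<Omega>^2 =
  \<Omega>0^2 turns the rest into the TF energy.\<close>

lemma GP_energy_lower_bound:
  assumes \<epsilon>: "\<epsilon> > 0" and \<Psi>: "\<Psi> \<in> H1_disc"
    and E: "GP_energy \<epsilon> (\<Omega>\<^sub>0 / \<epsilon>) \<Psi> \<le> ereal E"
  shows "(\<lambda>x. (norm (\<Psi> x))\<^sup>2) \<in> L2_disc" "TF_energy \<Omega>\<^sub>0 (\<lambda>x. (norm (\<Psi> x))\<^sup>2) \<le> \<epsilon>\<^sup>2 * E"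
proof -
  define \<Omega> where "\<Omega> = \<Omega>\<^sub>0 / \<epsilon>"
  define g where "g = (\<lambda>i. weak_partial i \<Psi>)"
  have L2: "\<Psi> \<in> L2_disc" using \<Psi> by (simp add: H1_disc_def)
  have g: "g i \<in> L2_disc" for i
  proof -
    have "\<exists>g. g \<in> L2_disc \<and> is_weak_partial i \<Psi> g" using \<Psi> by (auto simp: H1_disc_def)
    from someI_ex[OF this] show ?thesis by (simp add: g_def weak_partial_def)
  qed
  define Q where "Q = (\<lambda>x. of_real ((norm (g 1 x))\<^sup>2 + (norm (g 2 x))\<^sup>2) - of_real \<Omega> *
     (cnj (\<Psi> x) * (- \<i> * (of_real (x $ 1) * g 2 x - of_real (x $ 2) * g 1 x))))"
  have Q_int: "integrable disc_measure Q"
    unfolding Q_def by (intro GP_kinetic_integrable L2 g)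
  define r where "r = Re (LINT x|disc_measure. Q x)"
  define N where "N = (\<integral>\<^sup>+ x. ennreal ((norm (\<Psi> x)) ^ 4 / \<epsilon>\<^sup>2) \<partial>disc_measure)"
  have energy: "GP_energy \<epsilon> (\<Omega>\<^sub>0 / \<epsilon>) \<Psi> = ereal r + enn2ereal N"
    unfolding GP_energy_def r_def Q_def N_def grad_norm_sq_def ang_mom_def g_def \<Omega>_def
    by (simp add: sum_2)
  have meas: "\<Psi> \<in> borel_measurable disc_measure" using L2 by (simp add: L2_disc_def)
  have N_fin: "N < \<infinity>"
  proof (rule ccontr)
    assume "\<not> N < \<infinity>"
    then have "N = top" by (simp add: less_top[symmetric])
    then show False using E energy by simp
  qed
  have int4: "integrable disc_measure (\<lambda>x. (norm (\<Psi> x)) ^ 4 / \<epsilon>\<^sup>2)"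
    using N_fin meas unfolding N_def by (intro integrableI_nonneg) auto
  have int4': "integrable disc_measure (\<lambda>x. ((norm (\<Psi> x))\<^sup>2)\<^sup>2)"
    using integrable_mult_right[OF int4, of "\<epsilon>\<^sup>2"] \<epsilon> by simp
  show "(\<lambda>x. (norm (\<Psi> x))\<^sup>2) \<in> L2_disc"
    unfolding L2_disc_def using int4' meas by simp
  have "N = ennreal (LINT x|disc_measure. (norm (\<Psi> x)) ^ 4 / \<epsilon>\<^sup>2)"
    unfolding N_def using int4 by (intro nn_integral_eq_integral) auto
  with E energy have le: "r + (LINT x|disc_measure. (norm (\<Psi> x)) ^ 4 / \<epsilon>\<^sup>2) \<le> E"
    by (simp add: enn2ereal_ennreal)
  have "(LINT x|disc_measure. - (\<Omega>\<^sup>2 * (norm x)\<^sup>2 * (norm (\<Psi> x))\<^sup>2 / 4)) \<le> (LINT x|disc_measure. Re (Q x))"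
  proof (rule integral_mono)
    have "integrable disc_measure (\<lambda>x. (\<Omega>\<^sup>2 * (norm x)\<^sup>2 / 4) *\<^sub>R (norm (\<Psi> x))\<^sup>2)"
      using L2 by (intro integrable_continuous_mult_disc) (auto intro!: continuous_intros simp: L2_disc_def)
    then show "integrable disc_measure (\<lambda>x. - (\<Omega>\<^sup>2 * (norm x)\<^sup>2 * (norm (\<Psi> x))\<^sup>2 / 4))" by simp
    show "- (\<Omega>\<^sup>2 * (norm x)\<^sup>2 * (norm (\<Psi> x))\<^sup>2 / 4) \<le> Re (Q x)" for x
    proof -
      have "Re (Q x) = (cmod (g 1 x))\<^sup>2 + (cmod (g 2 x))\<^sup>2 - \<Omega> * Re (cnj (\<Psi> x) * (- \<i> * (of_real (x $ 1) * g 2 x - of_real (x $ 2) * g 1 x)))"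
        unfolding Q_def by (simp add: algebra_simps)
      then show ?thesis unfolding magnetic_square norm_vec2 by simp
    qed
  qed (use Q_int in auto)
  also have "\<dots> = r" unfolding r_def using Q_int by simp
  finally have "(LINT x|disc_measure. (norm (\<Psi> x)) ^ 4 / \<epsilon>\<^sup>2) - (LINT x|disc_measure. \<Omega>\<^sup>2 * (norm x)\<^sup>2 * (norm (\<Psi> x))\<^sup>2 / 4) \<le> E"
    using le by simp
  then have "\<epsilon>\<^sup>2 * ((LINT x|disc_measure. (norm (\<Psi> x)) ^ 4 / \<epsilon>\<^sup>2) - (LINT x|disc_measure. \<Omega>\<^sup>2 * (norm x)\<^sup>2 * (norm (\<Psi> x))\<^sup>2 / 4)) \<le> \<epsilon>\<^sup>2 * E"
    by (intro mult_left_mono) auto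
  also have "\<epsilon>\<^sup>2 * ((LINT x|disc_measure. (norm (\<Psi> x)) ^ 4 / \<epsilon>\<^sup>2) - (LINT x|disc_measure. \<Omega>\<^sup>2 * (norm x)\<^sup>2 * (norm (\<Psi> x))\<^sup>2 / 4))
     = TF_energy \<Omega>\<^sub>0 (\<lambda>x. (norm (\<Psi> x))\<^sup>2)"
  proof -
    have "integrable disc_measure (\<lambda>x. (\<Omega>\<^sub>0\<^sup>2 * (norm x)\<^sup>2 / 4) *\<^sub>R (norm (\<Psi> x))\<^sup>2)"
      using L2 by (intro integrable_continuous_mult_disc) (auto intro!: continuous_intros simp: L2_disc_def)
    then have "integrable disc_measure (\<lambda>x. \<Omega>\<^sub>0\<^sup>2 * (norm x)\<^sup>2 * (norm (\<Psi> x))\<^sup>2 / 4)" by simp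
    then have "TF_energy \<Omega>\<^sub>0 (\<lambda>x. (norm (\<Psi> x))\<^sup>2)
      = (LINT x|disc_measure. ((norm (\<Psi> x))\<^sup>2)\<^sup>2) - (LINT x|disc_measure. \<Omega>\<^sub>0\<^sup>2 * (norm x)\<^sup>2 * (norm (\<Psi> x))\<^sup>2 / 4)"
      unfolding TF_energy_def using int4' by (rule Bochner_Integration.integral_diff[rotated])
    then show ?thesis using \<epsilon> by (simp add: \<Omega>_def right_diff_distrib power_divide)
  qed
  finally show "TF_energy \<Omega>\<^sub>0 (\<lambda>x. (norm (\<Psi> x))\<^sup>2) \<le> \<epsilon>\<^sup>2 * E" .
qed

text \<open>For a trial state the energy must be evaluated and not only bounded from below, so the
  completed squares are kept. The chosen weak derivatives agree almost everywhere with the classical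
  ones.\<close>

lemma GP_energy_classical:
  fixes \<Phi> G\<^sub>1 G\<^sub>2 :: "real^2 \<Rightarrow> complex"
  assumes \<epsilon>: "\<epsilon> > 0"
    and d1: "\<And>x. ((\<lambda>s. \<Phi> (x + s *\<^sub>R axis 1 1)) has_vector_derivative G\<^sub>1 x) (at 0)"
    and d2: "\<And>x. ((\<lambda>s. \<Phi> (x + s *\<^sub>R axis 2 1)) has_vector_derivative G\<^sub>2 x) (at 0)"
    and cont: "continuous_on UNIV \<Phi>" "continuous_on UNIV G\<^sub>1" "continuous_on UNIV G\<^sub>2"
  shows "\<Phi> \<in> H1_disc"
    "GP_energy \<epsilon> (\<Omega>\<^sub>0 / \<epsilon>) \<Phi> = ereal (
      (LINT x|disc_measure. (cmod (G\<^sub>1 x + \<i> * of_real (\<Omega>\<^sub>0 / \<epsilon> * x $ 2 / 2) * \<Phi> x))\<^sup>2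
        + (cmod (G\<^sub>2 x - \<i> * of_real (\<Omega>\<^sub>0 / \<epsilon> * x $ 1 / 2) * \<Phi> x))\<^sup>2)
      + TF_energy \<Omega>\<^sub>0 (\<lambda>x. (cmod (\<Phi> x))\<^sup>2) / \<epsilon>\<^sup>2)"
proof -
  define \<Omega> where "\<Omega> = \<Omega>\<^sub>0 / \<epsilon>"
  have weak: "is_weak_partial 1 \<Phi> G\<^sub>1" "is_weak_partial 2 \<Phi> G\<^sub>2"
    using is_weak_partial_classical[OF d1 cont(1,2)] is_weak_partial_classical[OF d2 cont(1,3)] by auto
  have L2: "\<Phi> \<in> L2_disc" "G\<^sub>1 \<in> L2_disc" "G\<^sub>2 \<in> L2_disc"
    using cont by (auto intro: L2_disc_continuous)
  have "\<exists>g\<in>L2_disc. is_weak_partial i \<Phi> g" for i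
    using exhaust_2[of i] weak L2 by auto
  then show H1: "\<Phi> \<in> H1_disc" using L2 by (simp add: H1_disc_def)
  define Q where "Q = (\<lambda>x. of_real ((norm (G\<^sub>1 x))\<^sup>2 + (norm (G\<^sub>2 x))\<^sup>2) - of_real \<Omega> *
     (cnj (\<Phi> x) * (- \<i> * (of_real (x $ 1) * G\<^sub>2 x - of_real (x $ 2) * G\<^sub>1 x))))"
  have Q_int: "integrable disc_measure Q"
    unfolding Q_def by (intro GP_kinetic_integrable L2)
  have "\<exists>g. g \<in> L2_disc \<and> is_weak_partial i \<Phi> g" for i
    using H1 by (auto simp: H1_disc_def)
  from someI_ex[OF this] have wL2: "weak_partial i \<Phi> \<in> L2_disc" for i
    unfolding weak_partial_def by blast
  have "(LINT x|disc_measure. of_real (grad_norm_sq \<Phi> x) - of_real \<Omega> * (cnj (\<Phi> x) * ang_mom \<Phi> x))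
     = (LINT x|disc_measure. Q x)"
  proof (rule integral_cong_AE)
    show "AE x in disc_measure. of_real (grad_norm_sq \<Phi> x) - of_real \<Omega> * (cnj (\<Phi> x) * ang_mom \<Phi> x) = Q x"
      using weak_partial_classical[OF d1 cont(1,2)] weak_partial_classical[OF d2 cont(1,3)]
    proof eventually_elim
      case (elim x)
      then show ?case by (simp add: grad_norm_sq_def ang_mom_def Q_def sum_2)
    qed
    have "(\<lambda>x. of_real (grad_norm_sq \<Phi> x) - of_real \<Omega> * (cnj (\<Phi> x) * ang_mom \<Phi> x))
      = (\<lambda>x. of_real ((norm (weak_partial 1 \<Phi> x))\<^sup>2 + (norm (weak_partial 2 \<Phi> x))\<^sup>2) - of_real \<Omega> *
     (cnj (\<Phi> x) * (- \<i> * (of_real (x $ 1) * weak_partial 2 \<Phi> x - of_real (x $ 2) * weak_partial 1 \<Phi> x))))"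
      by (simp add: grad_norm_sq_def ang_mom_def sum_2)
    then show "(\<lambda>x. of_real (grad_norm_sq \<Phi> x) - of_real \<Omega> * (cnj (\<Phi> x) * ang_mom \<Phi> x))
        \<in> borel_measurable disc_measure"
      using GP_kinetic_integrable[OF L2(1) wL2 wL2] by simp
  qed (use Q_int in simp)
  moreover have "Re (LINT x|disc_measure. Q x) = (LINT x|disc_measure. Re (Q x))"
    using Q_int by simp
  moreover have "(LINT x|disc_measure. Re (Q x)) =
      (LINT x|disc_measure. (cmod (G\<^sub>1 x + \<i> * of_real (\<Omega> * x $ 2 / 2) * \<Phi> x))\<^sup>2
        + (cmod (G\<^sub>2 x - \<i> * of_real (\<Omega> * x $ 1 / 2) * \<Phi> x))\<^sup>2
        - \<Omega>\<^sup>2 * ((x $ 1)\<^sup>2 + (x $ 2)\<^sup>2) * (cmod (\<Phi> x))\<^sup>2 / 4)"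
  proof (rule Bochner_Integration.integral_cong[OF refl])
    fix x
    have "Re (Q x) = (cmod (G\<^sub>1 x))\<^sup>2 + (cmod (G\<^sub>2 x))\<^sup>2 - \<Omega> * Re (cnj (\<Phi> x) * (- \<i> * (of_real (x $ 1) * G\<^sub>2 x - of_real (x $ 2) * G\<^sub>1 x)))"
      unfolding Q_def by (simp add: algebra_simps)
    also note magnetic_square
    finally show "Re (Q x) = (cmod (G\<^sub>1 x + \<i> * of_real (\<Omega> * x $ 2 / 2) * \<Phi> x))\<^sup>2
        + (cmod (G\<^sub>2 x - \<i> * of_real (\<Omega> * x $ 1 / 2) * \<Phi> x))\<^sup>2
        - \<Omega>\<^sup>2 * ((x $ 1)\<^sup>2 + (x $ 2)\<^sup>2) * (cmod (\<Phi> x))\<^sup>2 / 4" .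
  qed
  moreover have "\<dots> = (LINT x|disc_measure. (cmod (G\<^sub>1 x + \<i> * of_real (\<Omega> * x $ 2 / 2) * \<Phi> x))\<^sup>2
        + (cmod (G\<^sub>2 x - \<i> * of_real (\<Omega> * x $ 1 / 2) * \<Phi> x))\<^sup>2)
     - (LINT x|disc_measure. \<Omega>\<^sup>2 * ((x $ 1)\<^sup>2 + (x $ 2)\<^sup>2) * (cmod (\<Phi> x))\<^sup>2 / 4)"
    using cont by (intro Bochner_Integration.integral_diff integrable_continuous_disc) (auto intro!: continuous_intros)
  moreover have "(\<integral>\<^sup>+ x. ennreal ((norm (\<Phi> x)) ^ 4 / \<epsilon>\<^sup>2) \<partial>disc_measure)
     = ennreal (LINT x|disc_measure. (norm (\<Phi> x)) ^ 4 / \<epsilon>\<^sup>2)"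
    using cont \<epsilon> by (intro nn_integral_eq_integral integrable_continuous_disc) (auto intro!: continuous_intros)
  moreover have "TF_energy \<Omega>\<^sub>0 (\<lambda>x. (cmod (\<Phi> x))\<^sup>2) / \<epsilon>\<^sup>2 = (LINT x|disc_measure. (norm (\<Phi> x)) ^ 4 / \<epsilon>\<^sup>2)
      - (LINT x|disc_measure. \<Omega>\<^sup>2 * ((x $ 1)\<^sup>2 + (x $ 2)\<^sup>2) * (cmod (\<Phi> x))\<^sup>2 / 4)"
  proof -
    have "TF_energy \<Omega>\<^sub>0 (\<lambda>x. (cmod (\<Phi> x))\<^sup>2) / \<epsilon>\<^sup>2 = (LINT x|disc_measure.
       (((cmod (\<Phi> x))\<^sup>2)\<^sup>2 - \<Omega>\<^sub>0\<^sup>2 * (norm x)\<^sup>2 * (cmod (\<Phi> x))\<^sup>2 / 4) / \<epsilon>\<^sup>2)"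
      by (simp add: TF_energy_def)
    also have "\<dots> = (LINT x|disc_measure. (norm (\<Phi> x)) ^ 4 / \<epsilon>\<^sup>2
       - \<Omega>\<^sup>2 * ((x $ 1)\<^sup>2 + (x $ 2)\<^sup>2) * (cmod (\<Phi> x))\<^sup>2 / 4)"
      using \<epsilon> by (intro Bochner_Integration.integral_cong) (auto simp: \<Omega>_def norm_vec2 power_divide field_simps)
    also have "\<dots> = (LINT x|disc_measure. (norm (\<Phi> x)) ^ 4 / \<epsilon>\<^sup>2)
      - (LINT x|disc_measure. \<Omega>\<^sup>2 * ((x $ 1)\<^sup>2 + (x $ 2)\<^sup>2) * (cmod (\<Phi> x))\<^sup>2 / 4)"
      using cont \<epsilon> by (intro Bochner_Integration.integral_diff integrable_continuous_disc) (auto intro!: continuous_intros)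
    finally show ?thesis .
  qed
  ultimately show "GP_energy \<epsilon> (\<Omega>\<^sub>0 / \<epsilon>) \<Phi> = ereal (
      (LINT x|disc_measure. (cmod (G\<^sub>1 x + \<i> * of_real (\<Omega>\<^sub>0 / \<epsilon> * x $ 2 / 2) * \<Phi> x))\<^sup>2
        + (cmod (G\<^sub>2 x - \<i> * of_real (\<Omega>\<^sub>0 / \<epsilon> * x $ 1 / 2) * \<Phi> x))\<^sup>2)
      + TF_energy \<Omega>\<^sub>0 (\<lambda>x. (cmod (\<Phi> x))\<^sup>2) / \<epsilon>\<^sup>2)"
    unfolding GP_energy_def \<Omega>_def[symmetric] by (simp add: enn2ereal_ennreal)
qed

section \<open>A lattice of vortices\<close>

text \<open>Squaring the positive part makes the bump continuously differentiable at its edges. It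
  also makes the difference of two neighbouring bumps factor as a difference of squares, which the
  lower bound on the modulus exploits.\<close>

definition strip_bump :: "real \<Rightarrow> real" where
  "strip_bump u = (max 0 (1 - u\<^sup>2))\<^sup>2"

definition strip_bump_deriv :: "real \<Rightarrow> real" where
  "strip_bump_deriv u = - 4 * u * max 0 (1 - u\<^sup>2)"

lemma DERIV_max_0_square: "((\<lambda>z::real. (max 0 z)\<^sup>2) has_real_derivative 2 * max 0 z) (at z)"
proof -
  consider "z > 0" | "z < 0" | "z = 0" by linarith
  then show ?thesis
  proof cases
    case 1
    have "((\<lambda>z. z\<^sup>2) has_real_derivative 2 * z) (at z)" by (auto intro!: derivative_eq_intros)
    moreover have "\<forall>\<^sub>F x in nhds z. (max 0 x)\<^sup>2 = x\<^sup>2"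
      using eventually_nhds_in_open[of "{0<..}" z] 1 by (auto elim: eventually_mono)
    ultimately show ?thesis using 1 by (subst DERIV_cong_ev[OF refl _ refl]) auto
  next
    case 2
    have "((\<lambda>z. (max 0 z)\<^sup>2) has_real_derivative 0) (at z)"
      by (rule has_field_derivative_transform_within_open[of "\<lambda>_. 0" 0 z "{..<0}"]) (use 2 in auto)
    then show ?thesis using 2 by simp
  next
    case 3
    have "((\<lambda>y::real. max 0 y) \<longlongrightarrow> 0) (at 0)"
      using tendsto_max[OF tendsto_const tendsto_ident_at, of "0::real" 0 UNIV] by simp
    then have "((\<lambda>y::real. (max 0 y)\<^sup>2 / y) \<longlongrightarrow> 0) (at 0)"
      by (rule Lim_transform_eventually) (auto simp: eventually_at_filter max_def power2_eq_square)
    then show ?thesis using 3 by (simp add: has_field_derivative_iff)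
  qed
qed

lemma DERIV_strip_bump: "(strip_bump has_real_derivative strip_bump_deriv u) (at u)"
proof -
  have "((\<lambda>u::real. 1 - u\<^sup>2) has_real_derivative - 2 * u) (at u)"
    by (auto intro!: derivative_eq_intros)
  from DERIV_chain2[OF DERIV_max_0_square this] show ?thesis
    by (simp add: strip_bump_def[abs_def] strip_bump_deriv_def mult_ac)
qed

lemma continuous_on_strip_bump [continuous_intros]:
  "continuous_on A f \<Longrightarrow> continuous_on A (\<lambda>x. strip_bump (f x))"
  "continuous_on A f \<Longrightarrow> continuous_on A (\<lambda>x. strip_bump_deriv (f x))"
  unfolding strip_bump_def strip_bump_deriv_def by (auto intro!: continuous_intros)

lemma strip_bump_eq_0: "\<bar>u\<bar> \<ge> 1 \<Longrightarrow> strip_bump u = 0" "\<bar>u\<bar> \<ge> 1 \<Longrightarrow> strip_bump_deriv u = 0"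
  by (auto simp: strip_bump_def strip_bump_deriv_def abs_le_square_iff[of 1 u, simplified] max_def)

lemma strip_bump_bounds: "\<bar>u * strip_bump u\<bar> \<le> 1" "\<bar>strip_bump_deriv u\<bar> \<le> 4"
proof -
  have "\<bar>u\<bar> \<le> 1 \<Longrightarrow> \<bar>max 0 (1 - u\<^sup>2)\<bar> \<le> 1" by (auto simp: abs_le_iff max_def)
  then have "\<bar>u\<bar> \<le> 1 \<Longrightarrow> \<bar>u\<bar> * (max 0 (1 - u\<^sup>2))\<^sup>2 \<le> 1 * 1" "\<bar>u\<bar> \<le> 1 \<Longrightarrow> \<bar>u\<bar> * \<bar>max 0 (1 - u\<^sup>2)\<bar> \<le> 1 * 1"
    by (intro mult_mono power_le_one; simp)+
  then show "\<bar>u * strip_bump u\<bar> \<le> 1" "\<bar>strip_bump_deriv u\<bar> \<le> 4"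
    using strip_bump_eq_0[of u] by (cases "\<bar>u\<bar> \<le> 1"; auto simp: strip_bump_def strip_bump_deriv_def abs_mult)+
qed

text \<open>Only the two integers next to z can be at distance less than 1 from it, so at most two
  strips are active at any height.\<close>

lemma sum_int_unit_window:
  fixes f :: "int \<Rightarrow> 'a::real_normed_vector" and z :: real
  assumes "finite K" and supp: "\<And>k. \<bar>z - of_int k\<bar> \<ge> 1 \<Longrightarrow> f k = 0"
  shows "sum f K = sum f (K \<inter> {\<lfloor>z\<rfloor>, \<lfloor>z\<rfloor> + 1})"
proof (rule sum.mono_neutral_right)
  show "\<forall>k\<in>K - K \<inter> {\<lfloor>z\<rfloor>, \<lfloor>z\<rfloor> + 1}. f k = 0"
  proof
    fix k assume "k \<in> K - K \<inter> {\<lfloor>z\<rfloor>, \<lfloor>z\<rfloor> + 1}"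
    then have "k \<le> \<lfloor>z\<rfloor> - 1 \<or> k \<ge> \<lfloor>z\<rfloor> + 2" by auto
    then have "\<bar>z - of_int k\<bar> \<ge> 1" by linarith
    then show "f k = 0" by (rule supp)
  qed
qed (use assms in auto)

lemma norm_sum_int_unit_window_le:
  fixes f :: "int \<Rightarrow> 'a::real_normed_vector" and z :: real
  assumes "finite K" and "\<And>k. \<bar>z - of_int k\<bar> \<ge> 1 \<Longrightarrow> f k = 0" and B: "\<And>k. norm (f k) \<le> B"
  shows "norm (sum f K) \<le> 2 * B"
proof -
  have "norm (sum f (K \<inter> {\<lfloor>z\<rfloor>, \<lfloor>z\<rfloor> + 1})) \<le> (\<Sum>k\<in>K \<inter> {\<lfloor>z\<rfloor>, \<lfloor>z\<rfloor> + 1}. norm (f k))"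
    by (rule norm_sum)
  also have "\<dots> \<le> (\<Sum>k\<in>{\<lfloor>z\<rfloor>, \<lfloor>z\<rfloor> + 1}. norm (f k))" by (intro sum_mono2) auto
  also have "\<dots> \<le> B + B" using add_mono[OF B B] by simp
  finally show ?thesis using sum_int_unit_window[OF assms(1,2)] by simp
qed

text \<open>In the Landau gauge the summands are plane waves in \<open>X\<close>, localized to strips of width
  \<open>1 / \<omega>\<close> in \<open>Y\<close> in which they compensate the vector potential of the field \<open>\<omega>\<^sup>2\<close>; the phase
  \<open>\<omega>\<^sup>2 X Y / 2\<close> passes to the symmetric gauge. Where two neighbouring strips overlap, the waves
  cancel at one point per period. The shifts \<open>s\<close> and \<open>t\<close> move this lattice of zeros.\<close>
definition vortex_term :: "real \<Rightarrow> real \<Rightarrow> real \<Rightarrow> real \<Rightarrow> real \<Rightarrow> int \<Rightarrow> complex" where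
  "vortex_term \<omega> s t X Y k =
     cis (\<omega>\<^sup>2 * X * Y / 2 + \<omega> * (t - of_int k) * X + 2 * pi * of_int k * s)"

definition vortex :: "real \<Rightarrow> int set \<Rightarrow> real \<Rightarrow> real \<Rightarrow> real \<Rightarrow> real \<Rightarrow> complex" where
  "vortex \<omega> K s t X Y = (\<Sum>k\<in>K. strip_bump (\<omega> * Y + t - of_int k) *\<^sub>R vortex_term \<omega> s t X Y k)"

text \<open>This and \<open>vortex_cov2\<close> are the covariant derivatives of the sum w, that is,
  d/dX w + i (\<omega>^2 Y / 2) w and d/dY w - i (\<omega>^2 X / 2) w. In the first, the phase
  contributes \<omega>^2 Y / 2 + \<omega> (t - k), which the potential completes to \<omega>
  (\<omega> Y + t - k); in the second it cancels and only the bump is differentiated.\<close>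

definition vortex_cov1 :: "real \<Rightarrow> int set \<Rightarrow> real \<Rightarrow> real \<Rightarrow> real \<Rightarrow> real \<Rightarrow> complex" where
  "vortex_cov1 \<omega> K s t X Y = (\<Sum>k\<in>K. (\<omega> * ((\<omega> * Y + t - of_int k) * strip_bump (\<omega> * Y + t - of_int k))) *\<^sub>R
     (\<i> * vortex_term \<omega> s t X Y k))"

definition vortex_cov2 :: "real \<Rightarrow> int set \<Rightarrow> real \<Rightarrow> real \<Rightarrow> real \<Rightarrow> real \<Rightarrow> complex" where
  "vortex_cov2 \<omega> K s t X Y = (\<Sum>k\<in>K. (\<omega> * strip_bump_deriv (\<omega> * Y + t - of_int k)) *\<^sub>R vortex_term \<omega> s t X Y k)"

lemma has_vector_derivative_cis:
  assumes "(f has_real_derivative f') (at x)"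
  shows "((\<lambda>x. cis (f x)) has_vector_derivative f' *\<^sub>R (\<i> * cis (f x))) (at x)"
proof -
  have "((\<lambda>x. cos (f x) *\<^sub>R 1 + sin (f x) *\<^sub>R \<i>) has_vector_derivative
     (- sin (f x) * f') *\<^sub>R 1 + (cos (f x) * f') *\<^sub>R \<i>) (at x)"
    using assms by (auto intro!: derivative_eq_intros)
  also have "(\<lambda>x. cos (f x) *\<^sub>R 1 + sin (f x) *\<^sub>R \<i>) = (\<lambda>x. cis (f x))"
    by (simp add: fun_eq_iff complex_eq_iff)
  also have "(- sin (f x) * f') *\<^sub>R 1 + (cos (f x) * f') *\<^sub>R \<i> = f' *\<^sub>R (\<i> * cis (f x))"
    by (simp add: complex_eq_iff)
  finally show ?thesis .
qed

lemma vortex_deriv1: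
  "((\<lambda>X. vortex \<omega> K s t X Y) has_vector_derivative
    vortex_cov1 \<omega> K s t X Y - \<i> * of_real (\<omega>\<^sup>2 * Y / 2) * vortex \<omega> K s t X Y) (at X)"
proof -
  let ?b = "\<lambda>k::int. \<omega> * Y + t - of_int k"
  have "((\<lambda>X. vortex_term \<omega> s t X Y k) has_vector_derivative
      (\<omega>\<^sup>2 * Y / 2 + \<omega> * (t - of_int k)) *\<^sub>R (\<i> * vortex_term \<omega> s t X Y k)) (at X)" for k
    unfolding vortex_term_def
    by (rule has_vector_derivative_cis) (auto intro!: derivative_eq_intros)
  then have "((\<lambda>X. vortex \<omega> K s t X Y) has_vector_derivative
     (\<Sum>k\<in>K. strip_bump (?b k) *\<^sub>R ((\<omega>\<^sup>2 * Y / 2 + \<omega> * (t - of_int k)) *\<^sub>R (\<i> * vortex_term \<omega> s t X Y k)))) (at X)"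
    unfolding vortex_def
    by (intro has_vector_derivative_sum bounded_linear.has_vector_derivative[OF bounded_linear_scaleR_right])
  also have "(\<Sum>k\<in>K. strip_bump (?b k) *\<^sub>R ((\<omega>\<^sup>2 * Y / 2 + \<omega> * (t - of_int k)) *\<^sub>R (\<i> * vortex_term \<omega> s t X Y k)))
    = vortex_cov1 \<omega> K s t X Y - \<i> * of_real (\<omega>\<^sup>2 * Y / 2) * vortex \<omega> K s t X Y"
    unfolding vortex_def vortex_cov1_def sum_distrib_left sum_subtractf[symmetric]
    by (intro sum.cong refl) (simp add: scaleR_conv_of_real algebra_simps power2_eq_square)
  finally show ?thesis .
qed

lemma vortex_deriv2:
  "((\<lambda>Y. vortex \<omega> K s t X Y) has_vector_derivative
    vortex_cov2 \<omega> K s t X Y + \<i> * of_real (\<omega>\<^sup>2 * X / 2) * vortex \<omega> K s t X Y) (at Y)"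
proof -
  let ?b = "\<lambda>k::int. \<omega> * Y + t - of_int k"
  have c: "((\<lambda>Y. vortex_term \<omega> s t X Y k) has_vector_derivative
      (\<omega>\<^sup>2 * X / 2) *\<^sub>R (\<i> * vortex_term \<omega> s t X Y k)) (at Y)" for k
    unfolding vortex_term_def
    by (rule has_vector_derivative_cis) (auto intro!: derivative_eq_intros)
  have b: "((\<lambda>Y. strip_bump (\<omega> * Y + t - of_int k)) has_real_derivative strip_bump_deriv (?b k) * \<omega>) (at Y)" for k
    by (rule DERIV_chain2[OF DERIV_strip_bump]) (auto intro!: derivative_eq_intros)
  have "((\<lambda>Y. vortex \<omega> K s t X Y) has_vector_derivative
     (\<Sum>k\<in>K. strip_bump (?b k) *\<^sub>R ((\<omega>\<^sup>2 * X / 2) *\<^sub>R (\<i> * vortex_term \<omega> s t X Y k))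
        + (strip_bump_deriv (?b k) * \<omega>) *\<^sub>R vortex_term \<omega> s t X Y k)) (at Y)"
    unfolding vortex_def
    by (intro has_vector_derivative_sum has_vector_derivative_scaleR b c)
  also have "(\<Sum>k\<in>K. strip_bump (?b k) *\<^sub>R ((\<omega>\<^sup>2 * X / 2) *\<^sub>R (\<i> * vortex_term \<omega> s t X Y k))
        + (strip_bump_deriv (?b k) * \<omega>) *\<^sub>R vortex_term \<omega> s t X Y k)
    = vortex_cov2 \<omega> K s t X Y + \<i> * of_real (\<omega>\<^sup>2 * X / 2) * vortex \<omega> K s t X Y"
    unfolding vortex_def vortex_cov2_def sum_distrib_left sum.distrib[symmetric]
    by (intro sum.cong refl) (simp add: scaleR_conv_of_real algebra_simps power2_eq_square)
  finally show ?thesis .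
qed

text \<open>Two active strips contribute at most \<omega> times the maximum of |u b(u)| or |b'(u)|
  each, where b is the bump. The cost is thus \<omega> = sqrt \<Omega> and not the size \<Omega> of
  the potential.\<close>

lemma norm_vortex_cov:
  assumes "finite K" "\<omega> \<ge> 0"
  shows "norm (vortex_cov1 \<omega> K s t X Y) \<le> 2 * \<omega>" "norm (vortex_cov2 \<omega> K s t X Y) \<le> 8 * \<omega>"
proof -
  have n: "norm (vortex_term \<omega> s t X Y k) = 1" for k by (simp add: vortex_term_def)
  show "norm (vortex_cov1 \<omega> K s t X Y) \<le> 2 * \<omega>"
    unfolding vortex_cov1_def
  proof (rule norm_sum_int_unit_window_le[where z = "\<omega> * Y + t"])
    show "norm ((\<omega> * ((\<omega> * Y + t - of_int k) * strip_bump (\<omega> * Y + t - of_int k))) *\<^sub>R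
     (\<i> * vortex_term \<omega> s t X Y k)) \<le> \<omega>" for k
      using mult_left_mono[OF strip_bump_bounds(1)[of "\<omega> * Y + t - of_int k"], of \<omega>] assms(2)
      by (simp add: norm_mult n abs_mult)
  qed (use assms in \<open>auto simp: strip_bump_eq_0\<close>)
  have "norm (vortex_cov2 \<omega> K s t X Y) \<le> 2 * (4 * \<omega>)"
    unfolding vortex_cov2_def
  proof (rule norm_sum_int_unit_window_le[where z = "\<omega> * Y + t"])
    show "norm ((\<omega> * strip_bump_deriv (\<omega> * Y + t - of_int k)) *\<^sub>R vortex_term \<omega> s t X Y k) \<le> 4 * \<omega>" for k
      using mult_left_mono[OF strip_bump_bounds(2)[of "\<omega> * Y + t - of_int k"], of \<omega>] assms(2)
      by (simp add: norm_mult n abs_mult mult.commute)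
  qed (use assms in \<open>auto simp: strip_bump_eq_0\<close>)
  then show "norm (vortex_cov2 \<omega> K s t X Y) \<le> 8 * \<omega>" by simp
qed

lemma continuous_on_vortex [continuous_intros]:
  assumes "continuous_on A s" "continuous_on A t" "continuous_on A X" "continuous_on A Y"
  shows "continuous_on A (\<lambda>x. vortex \<omega> K (s x) (t x) (X x) (Y x))"
    "continuous_on A (\<lambda>x. vortex_cov1 \<omega> K (s x) (t x) (X x) (Y x))"
    "continuous_on A (\<lambda>x. vortex_cov2 \<omega> K (s x) (t x) (X x) (Y x))"
  unfolding vortex_def vortex_cov1_def vortex_cov2_def vortex_term_def
  using assms by (auto intro!: continuous_intros)

section \<open>Lower bounds for the modulus of the vortex sum\<close>

text \<open>Jordan's inequality: by concavity the sine lies above its chord.\<close>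

lemma sin_ge_linear:
  assumes "0 \<le> x" "x \<le> pi / 2"
  shows "2 / pi * x \<le> sin x"
proof -
  have "concave_on {0..pi/2} sin"
  proof (rule f''_le0_imp_concave)
    show "(sin has_real_derivative cos x) (at x)" "(cos has_real_derivative - sin x) (at x)" for x :: real
      by (auto intro!: derivative_eq_intros)
    show "- sin x \<le> 0" if "x \<in> {0..pi/2}" for x :: real
      using that sin_ge_zero[of x] by auto
  qed auto
  moreover have "0 \<le> 2 / pi * x" "2 / pi * x \<le> 1" using assms by (auto simp: field_simps)
  ultimately have "sin ((1 - 2 / pi * x) *\<^sub>R 0 + (2 / pi * x) *\<^sub>R (pi / 2))
      \<ge> (1 - 2 / pi * x) * sin 0 + (2 / pi * x) * sin (pi / 2)"
    by (intro concave_onD) auto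
  then show ?thesis by simp
qed

text \<open>Both sides have period 1 and vanish at the half-integers; in terms of the offset
  \<open>v\<close> from 1 / 2 the cosine becomes a sine, to which Jordan's inequality
  applies.\<close>

lemma abs_cos_ge_frac:
  fixes x :: real
  shows "2 * \<bar>frac x - 1 / 2\<bar> \<le> \<bar>cos (pi * x)\<bar>"
proof -
  define v where "v = 1 / 2 - frac x"
  have v: "\<bar>v\<bar> \<le> 1 / 2" using frac_lt_1[of x] frac_ge_0[of x] unfolding v_def by linarith
  have "x = frac x + of_int \<lfloor>x\<rfloor>" by (simp add: frac_def)
  then have "cos (pi * x) = cos (pi * frac x + pi * of_int \<lfloor>x\<rfloor>)"
    by (metis distrib_left)
  then have "\<bar>cos (pi * x)\<bar> = \<bar>cos (pi * frac x)\<bar>"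
    by (simp add: cos_add cos_npi_int sin_npi_int)
  also have "cos (pi * frac x) = sin (pi * v)"
    by (simp add: sin_cos_eq v_def algebra_simps)
  also have "\<bar>sin (pi * v)\<bar> \<ge> 2 * \<bar>v\<bar>"
  proof -
    have "2 * u \<le> sin (pi * u)" if "0 \<le> u" "u \<le> 1 / 2" for u
      using sin_ge_linear[of "pi * u"] mult_left_mono[OF that(2), of pi] that(1) by simp
    from this[of v] this[of "- v"] v show ?thesis by (cases "v \<ge> 0") auto
  qed
  finally show ?thesis by (simp add: v_def abs_minus_commute)
qed

text \<open>The law of cosines, written with half the phase difference. In this form unequal
  amplitudes and phases that are not opposite each bound the modulus from below.\<close>

lemma cmod_two_waves:
  "(cmod (a *\<^sub>R cis \<alpha> + b *\<^sub>R cis \<beta>))\<^sup>2 = (a - b)\<^sup>2 * (sin ((\<beta> - \<alpha>) / 2))\<^sup>2 + (a + b)\<^sup>2 * (cos ((\<beta> - \<alpha>) / 2))\<^sup>2"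
proof -
  have "(cmod (a *\<^sub>R cis \<alpha> + b *\<^sub>R cis \<beta>))\<^sup>2
      = a\<^sup>2 * ((cos \<alpha>)\<^sup>2 + (sin \<alpha>)\<^sup>2) + b\<^sup>2 * ((cos \<beta>)\<^sup>2 + (sin \<beta>)\<^sup>2) + 2 * a * b * (cos \<beta> * cos \<alpha> + sin \<beta> * sin \<alpha>)"
  proof -
    have "Re (a *\<^sub>R cis \<alpha> + b *\<^sub>R cis \<beta>) = a * cos \<alpha> + b * cos \<beta>"
      "Im (a *\<^sub>R cis \<alpha> + b *\<^sub>R cis \<beta>) = a * sin \<alpha> + b * sin \<beta>" by simp_all
    then show ?thesis unfolding cmod_power2 by algebra
  qed
  also have "\<dots> = a\<^sup>2 + b\<^sup>2 + 2 * a * b * cos (\<beta> - \<alpha>)" by (simp add: cos_diff)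
  also have "cos (\<beta> - \<alpha>) = (cos ((\<beta> - \<alpha>) / 2))\<^sup>2 - (sin ((\<beta> - \<alpha>) / 2))\<^sup>2"
    using cos_double[of "(\<beta> - \<alpha>) / 2"] unfolding mult_2 field_sum_of_halves .
  finally show ?thesis
    using sin_cos_squared_add[of "(\<beta> - \<alpha>) / 2"] by algebra
qed

text \<open>Two neighbouring waves cancel only if their amplitudes agree, at half-integral t +
  \<omega> Y, and their phases are opposite, at half-integral s - \<omega> X / (2 pi). The modulus
  grows at least linearly in the distance from either condition. The first involves only t and the
  second only s, so the shifts can be averaged independently.\<close>

lemma norm_vortex_ge:
  fixes X Y :: real
  assumes "finite K" and K: "{\<lfloor>\<omega> * Y + t\<rfloor>, \<lfloor>\<omega> * Y + t\<rfloor> + 1} \<subseteq> K"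
  shows "\<bar>frac (t + \<omega> * Y) - 1 / 2\<bar> \<le> cmod (vortex \<omega> K s t X Y)"
    "\<bar>frac (s - \<omega> * X / (2 * pi)) - 1 / 2\<bar> \<le> cmod (vortex \<omega> K s t X Y)"
proof -
  define k where "k = \<lfloor>\<omega> * Y + t\<rfloor>"
  define \<tau> where "\<tau> = frac (\<omega> * Y + t)"
  have \<tau>: "0 \<le> \<tau>" "\<tau> < 1" by (auto simp: \<tau>_def frac_lt_1)
  define a where "a = strip_bump \<tau>"
  define b where "b = strip_bump (\<tau> - 1)"
  define \<alpha> where "\<alpha> = (\<lambda>k::int. \<omega>\<^sup>2 * X * Y / 2 + \<omega> * (t - of_int k) * X + 2 * pi * of_int k * s)"
  have "vortex \<omega> K s t X Y = (\<Sum>k\<in>K \<inter> {k, k + 1}. strip_bump (\<omega> * Y + t - of_int k) *\<^sub>R vortex_term \<omega> s t X Y k)"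
    unfolding vortex_def k_def using assms(1) by (intro sum_int_unit_window) (auto simp: strip_bump_eq_0)
  also have "K \<inter> {k, k + 1} = {k, k + 1}" using K by (auto simp: k_def)
  also have "(\<Sum>k\<in>{k, k + 1}. strip_bump (\<omega> * Y + t - of_int k) *\<^sub>R vortex_term \<omega> s t X Y k)
     = a *\<^sub>R cis (\<alpha> k) + b *\<^sub>R cis (\<alpha> (k + 1))"
    by (simp add: a_def b_def \<tau>_def frac_def k_def vortex_term_def \<alpha>_def algebra_simps)
  finally have w: "vortex \<omega> K s t X Y = a *\<^sub>R cis (\<alpha> k) + b *\<^sub>R cis (\<alpha> (k + 1))" .
  define \<theta> where "\<theta> = pi * (s - \<omega> * X / (2 * pi))"
  have "(\<alpha> (k + 1) - \<alpha> k) / 2 = \<theta>" by (simp add: \<alpha>_def \<theta>_def field_simps)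
  then have sq: "(cmod (vortex \<omega> K s t X Y))\<^sup>2 = (a - b)\<^sup>2 * (sin \<theta>)\<^sup>2 + (a + b)\<^sup>2 * (cos \<theta>)\<^sup>2"
    unfolding w cmod_two_waves by simp
  \<comment> \<open>The amplitudes are p^2 and q^2, so a - b = (p - q) (p + q), where p - q = 1 - 2
    \<tau> and p + q is at least 1; the latter also keeps a + b above 1 / 2.\<close>
  define p where "p = 1 - \<tau>\<^sup>2"
  define q where "q = 1 - (1 - \<tau>)\<^sup>2"
  have pq: "0 \<le> p" "0 \<le> q" using \<tau> by (auto simp: p_def q_def power_le_one)
  have ab: "a = p\<^sup>2" "b = q\<^sup>2"
    using pq by (auto simp: a_def b_def strip_bump_def p_def q_def power2_commute[of \<tau> 1])
  have "p + q = 1 + 2 * (\<tau> * (1 - \<tau>))" by (simp add: p_def q_def power2_eq_square algebra_simps)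
  then have sum: "p + q \<ge> 1" using \<tau> by simp
  have diff: "p - q = 1 - 2 * \<tau>" by (simp add: p_def q_def power2_eq_square algebra_simps)
  have "\<bar>1 - 2 * \<tau>\<bar> * 1 \<le> \<bar>p - q\<bar> * \<bar>p + q\<bar>" using sum diff by (intro mult_mono) auto
  also have "\<dots> = \<bar>a - b\<bar>" by (simp add: ab abs_mult[symmetric] power2_eq_square algebra_simps)
  finally have a_b: "\<bar>1 - 2 * \<tau>\<bar> \<le> \<bar>a - b\<bar>" by simp
  have nn: "a \<ge> 0" "b \<ge> 0" by (auto simp: ab)
  have "(a - b)\<^sup>2 = (a - b)\<^sup>2 * (sin \<theta>)\<^sup>2 + (a - b)\<^sup>2 * (cos \<theta>)\<^sup>2"
    by (simp flip: distrib_left)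
  also have "\<dots> \<le> (cmod (vortex \<omega> K s t X Y))\<^sup>2"
    unfolding sq using nn by (intro add_left_mono mult_right_mono abs_le_square_iff[THEN iffD1]) auto
  finally have "\<bar>a - b\<bar> \<le> cmod (vortex \<omega> K s t X Y)"
    by (simp flip: abs_le_square_iff)
  then show "\<bar>frac (t + \<omega> * Y) - 1 / 2\<bar> \<le> cmod (vortex \<omega> K s t X Y)"
    using a_b by (simp add: \<tau>_def add.commute)
  have "1\<^sup>2 \<le> (p + q)\<^sup>2" using sum by (intro power_mono) auto
  also have "\<dots> \<le> 2 * (a + b)" 
    using zero_le_power2[of "p - q"] by (simp add: ab power2_sum power2_diff)
  finally have "1 / 2 \<le> a + b" by simp
  then have "\<bar>cos \<theta> / 2\<bar> \<le> \<bar>(a + b) * cos \<theta>\<bar>"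
    using mult_right_mono[of "1/2" "a + b" "\<bar>cos \<theta>\<bar>"] nn by (simp add: abs_mult)
  moreover have "((a + b) * cos \<theta>)\<^sup>2 \<le> (cmod (vortex \<omega> K s t X Y))\<^sup>2"
    unfolding sq by (simp add: power_mult_distrib)
  then have "\<bar>(a + b) * cos \<theta>\<bar> \<le> cmod (vortex \<omega> K s t X Y)"
    by (simp flip: abs_le_square_iff)
  moreover have "2 * \<bar>frac (s - \<omega> * X / (2 * pi)) - 1 / 2\<bar> \<le> \<bar>cos \<theta>\<bar>"
    unfolding \<theta>_def by (rule abs_cos_ge_frac)
  ultimately show "\<bar>frac (s - \<omega> * X / (2 * pi)) - 1 / 2\<bar> \<le> cmod (vortex \<omega> K s t X Y)" by simp
qed

section \<open>Averaging over the shifts\<close>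

lemma nn_integral_translate:
  fixes f :: "real \<Rightarrow> ennreal"
  assumes "f \<in> borel_measurable borel"
  shows "(\<integral>\<^sup>+x. f (x + c) \<partial>lborel) = (\<integral>\<^sup>+x. f x \<partial>lborel)"
  using nn_integral_real_affine[OF assms, of 1 c] by (simp add: add.commute)

text \<open>Rotation invariance of the circle: the unit interval is cut where the shifted argument
  wraps around, and each piece is translated back.\<close>

lemma nn_integral_frac_shift:
  fixes g :: "real \<Rightarrow> ennreal"
  assumes [measurable]: "g \<in> borel_measurable borel"
  shows "(\<integral>\<^sup>+x. g (frac (x + c)) * indicator {0..<1} x \<partial>lborel) = (\<integral>\<^sup>+x. g x * indicator {0..<1} x \<partial>lborel)"
proof -
  define d where "d = frac c"
  have d: "0 \<le> d" "d < 1" by (auto simp: d_def frac_lt_1)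
  have "g (frac (x + c)) * indicator {0..<1} x
      = g (x + d) * indicator {d..<1} (x + d) + g (x + (d - 1)) * indicator {0..<d} (x + (d - 1))" for x
  proof (cases "0 \<le> x \<and> x < 1")
    case True
    then have "frac x = x" by (simp add: frac_eq)
    then show ?thesis using True d by (auto simp: frac_add d_def[symmetric] indicator_def algebra_simps)
  next
    case False
    then show ?thesis using d by (auto simp: indicator_def)
  qed
  then have "(\<integral>\<^sup>+x. g (frac (x + c)) * indicator {0..<1} x \<partial>lborel)
    = (\<integral>\<^sup>+x. g (x + d) * indicator {d..<1} (x + d) \<partial>lborel)
      + (\<integral>\<^sup>+x. g (x + (d - 1)) * indicator {0..<d} (x + (d - 1)) \<partial>lborel)"
    by (simp add: nn_integral_add)
  also have "\<dots> = (\<integral>\<^sup>+x. g x * indicator {d..<1} x \<partial>lborel) + (\<integral>\<^sup>+x. g x * indicator {0..<d} x \<partial>lborel)"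
    by (subst (1 2) nn_integral_translate) auto
  also have "\<dots> = (\<integral>\<^sup>+x. g x * indicator {d..<1} x + g x * indicator {0..<d} x \<partial>lborel)"
    by (subst nn_integral_add) auto
  also have "\<dots> = (\<integral>\<^sup>+x. g x * indicator {0..<1} x \<partial>lborel)"
    using d by (intro nn_integral_cong) (auto simp: indicator_def)
  finally show ?thesis .
qed

lemma nn_integral_frac_dist_le:
  fixes f F :: "real \<Rightarrow> real"
  assumes [measurable]: "f \<in> borel_measurable borel"
    and F: "\<And>v. 0 \<le> v \<Longrightarrow> v \<le> 1 / 2 \<Longrightarrow> (F has_real_derivative f v) (at v)"
    and nonneg: "\<And>v. 0 \<le> v \<Longrightarrow> 0 \<le> f v"
  shows "(\<integral>\<^sup>+x. ennreal (f \<bar>frac (x + c) - 1 / 2\<bar>) * indicator {0..<1} x \<partial>lborel)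
    \<le> ennreal (2 * (F (1 / 2) - F 0))"
proof -
  have "(\<integral>\<^sup>+x. ennreal (f \<bar>frac (x + c) - 1 / 2\<bar>) * indicator {0..<1} x \<partial>lborel)
    = (\<integral>\<^sup>+x. ennreal (f \<bar>x - 1 / 2\<bar>) * indicator {0..<1} x \<partial>lborel)"
    by (rule nn_integral_frac_shift[of "\<lambda>y. ennreal (f \<bar>y - 1/2\<bar>)"]) simp
  \<comment> \<open>The closed halves that suit the fundamental theorem overlap at 1 / 2 and add the
    endpoint 1, whence an inequality.\<close>
  also have "\<dots> \<le> (\<integral>\<^sup>+x. ennreal (f (1 / 2 - x)) * indicator {0..1/2} x + ennreal (f (x - 1 / 2)) * indicator {1/2..1} x \<partial>lborel)"
    by (intro nn_integral_mono) (auto simp: indicator_def abs_if)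
  also have "\<dots> = (\<integral>\<^sup>+x. ennreal (f (1 / 2 - x)) * indicator {0..1/2} x \<partial>lborel)
     + (\<integral>\<^sup>+x. ennreal (f (x - 1 / 2)) * indicator {1/2..1} x \<partial>lborel)"
    by (subst nn_integral_add) auto
  also have "(\<integral>\<^sup>+x. ennreal (f (1 / 2 - x)) * indicator {0..1/2} x \<partial>lborel) = ennreal (- F (1/2 - 1/2) - (- F (1/2 - 0)))"
  proof (rule nn_integral_FTC_Icc)
    show "((\<lambda>x. - F (1 / 2 - x)) has_real_derivative f (1 / 2 - x)) (at x)" if "x \<in> {0..1/2}" for x
    proof -
      have "(F has_real_derivative f (1 / 2 - x)) (at (1 / 2 - x))" using that by (intro F) auto
      moreover have "((\<lambda>x. 1 / 2 - x) has_real_derivative - 1) (at x)"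
        by (auto intro!: derivative_eq_intros)
      ultimately have "((\<lambda>x. F (1 / 2 - x)) has_real_derivative f (1 / 2 - x) * - 1) (at x)"
        by (rule DERIV_chain2)
      from DERIV_minus[OF this] show ?thesis by simp
    qed
  qed (use nonneg in auto)
  also have "(\<integral>\<^sup>+x. ennreal (f (x - 1 / 2)) * indicator {1/2..1} x \<partial>lborel) = ennreal (F (1 - 1/2) - F (1/2 - 1/2))"
  proof (rule nn_integral_FTC_Icc)
    show "((\<lambda>x. F (x - 1 / 2)) has_real_derivative f (x - 1 / 2)) (at x)" if "x \<in> {1/2..1}" for x
    proof -
      have "(F has_real_derivative f (x - 1 / 2)) (at (x - 1 / 2))" using that by (intro F) auto
      moreover have "((\<lambda>x. x - 1 / 2) has_real_derivative 1) (at x)"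
        by (auto intro!: derivative_eq_intros)
      ultimately have "((\<lambda>x. F (x - 1 / 2)) has_real_derivative f (x - 1 / 2) * 1) (at x)"
        by (rule DERIV_chain2)
      then show ?thesis by simp
    qed
  qed (use nonneg in auto)
  also have "ennreal (- F (1/2 - 1/2) - (- F (1/2 - 0))) + ennreal (F (1 - 1/2) - F (1/2 - 1/2)) = ennreal (2 * (F (1 / 2) - F 0))"
  proof -
    have "F 0 \<le> F (1/2)"
    proof (rule DERIV_nonneg_imp_nondecreasing[of 0 "1 / 2" F])
      show "\<exists>y. (F has_real_derivative y) (at v) \<and> 0 \<le> y" if "0 \<le> v" "v \<le> 1 / 2" for v
        using F[OF that] nonneg[OF that(1)] by blast
    qed simp
    then show ?thesis by (subst ennreal_plus[symmetric]) auto
  qed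
  finally show ?thesis .
qed

lemma nn_integral_inverse_square_frac_le:
  assumes "B > 0"
  shows "(\<integral>\<^sup>+s. ennreal (1 / (B + \<bar>frac (s + c) - 1 / 2\<bar>)\<^sup>2) * indicator {0..<1} s \<partial>lborel) \<le> ennreal (2 / B)"
proof -
  have "(\<integral>\<^sup>+s. ennreal (1 / (B + \<bar>frac (s + c) - 1 / 2\<bar>)\<^sup>2) * indicator {0..<1} s \<partial>lborel)
    \<le> ennreal (2 * (- 1 / (B + 1 / 2) - - 1 / (B + 0)))"
    using assms by (intro nn_integral_frac_dist_le)
      (auto intro!: derivative_eq_intros simp: power2_eq_square field_simps)
  also have "\<dots> \<le> ennreal (2 / B)" using assms by (intro ennreal_leI) simp
  finally show ?thesis .
qed

lemma nn_integral_inverse_frac_le: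
  assumes "0 < \<epsilon>" "\<epsilon> \<le> 1 / 4"
  shows "(\<integral>\<^sup>+t. ennreal (1 / (sqrt \<epsilon> + \<bar>frac (t + c) - 1 / 2\<bar>)) * indicator {0..<1} t \<partial>lborel) \<le> ennreal (- ln \<epsilon>)"
proof -
  have "sqrt \<epsilon> \<le> sqrt ((1 / 2)\<^sup>2)" using assms by (intro real_sqrt_le_mono) (simp add: power2_eq_square)
  then have e: "0 < sqrt \<epsilon>" "sqrt \<epsilon> \<le> 1 / 2" using assms by auto
  have "(\<integral>\<^sup>+t. ennreal (1 / (sqrt \<epsilon> + \<bar>frac (t + c) - 1 / 2\<bar>)) * indicator {0..<1} t \<partial>lborel)
    \<le> ennreal (2 * (ln (sqrt \<epsilon> + 1 / 2) - ln (sqrt \<epsilon> + 0)))"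
  proof (rule nn_integral_frac_dist_le[where F = "\<lambda>v. ln (sqrt \<epsilon> + v)"])
    show "((\<lambda>v. ln (sqrt \<epsilon> + v)) has_real_derivative 1 / (sqrt \<epsilon> + v)) (at v)" if "0 \<le> v" for v
      using add_pos_nonneg[OF e(1) that] by (auto intro!: derivative_eq_intros)
  qed (use e(1) in auto)
  also have "\<dots> \<le> ennreal (- ln \<epsilon>)"
  proof (intro ennreal_leI)
    have "ln (sqrt \<epsilon> + 1 / 2) \<le> 0" using e add_pos_nonneg[OF e(1), of "1 / 2"] by (subst ln_le_zero_iff) auto
    then show "2 * (ln (sqrt \<epsilon> + 1 / 2) - ln (sqrt \<epsilon> + 0)) \<le> - ln \<epsilon>"
      using assms by (simp add: ln_sqrt)
  qed
  finally show ?thesis .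
qed

lemma measurable_pair_continuous:
  fixes f :: "'a::euclidean_space \<times> 'b::euclidean_space \<Rightarrow> 'c::topological_space"
  assumes "continuous_on UNIV f"
  shows "f \<in> borel_measurable (lborel \<Otimes>\<^sub>M lborel)"
proof -
  have "f \<in> borel_measurable (borel \<Otimes>\<^sub>M borel)"
    unfolding borel_prod using assms by (rule borel_measurable_continuous_onI)
  moreover have "sets (lborel \<Otimes>\<^sub>M lborel) = sets ((borel :: 'a measure) \<Otimes>\<^sub>M (borel :: 'b measure))"
    by (intro sets_pair_measure_cong) auto
  ultimately show ?thesis by (simp cong: measurable_cong_sets)
qed

text \<open>The square of a sum of three terms is at most three times the sum of their squares, and
  u^2 and v^2 are each at most w^2: hence 6 = 3 * 2.\<close>

lemma inverse_square_le:
  fixes w u v \<epsilon> :: real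
  assumes "\<epsilon> > 0" "\<bar>u\<bar> \<le> w" "\<bar>v\<bar> \<le> w"
  shows "1 / (w\<^sup>2 + \<epsilon>) \<le> 6 * (1 / (sqrt \<epsilon> + \<bar>u\<bar> + \<bar>v\<bar>)\<^sup>2)"
proof -
  have "(sqrt \<epsilon> + \<bar>u\<bar> + \<bar>v\<bar>)\<^sup>2 \<le> 3 * ((sqrt \<epsilon>)\<^sup>2 + \<bar>u\<bar>\<^sup>2 + \<bar>v\<bar>\<^sup>2)"
    using zero_le_power2[of "sqrt \<epsilon> - \<bar>u\<bar>"] zero_le_power2[of "sqrt \<epsilon> - \<bar>v\<bar>"] zero_le_power2[of "\<bar>u\<bar> - \<bar>v\<bar>"]
    unfolding power2_eq_square by (simp add: algebra_simps)
  also have "\<dots> \<le> 3 * (\<epsilon> + w\<^sup>2 + w\<^sup>2)"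
    using assms by (intro mult_left_mono add_mono power_mono) auto
  also have "\<dots> \<le> 6 * (w\<^sup>2 + \<epsilon>)" using assms by simp
  finally have "(sqrt \<epsilon> + \<bar>u\<bar> + \<bar>v\<bar>)\<^sup>2 \<le> 6 * (w\<^sup>2 + \<epsilon>)" .
  moreover have "0 < (sqrt \<epsilon> + \<bar>u\<bar> + \<bar>v\<bar>)\<^sup>2"
    using assms by (intro zero_less_power add_pos_nonneg) auto
  moreover have "0 < w\<^sup>2 + \<epsilon>" using assms by (simp add: add_nonneg_pos)
  ultimately show ?thesis by (simp add: field_simps)
qed

lemma borel_measurable_frac [measurable]: "frac \<in> borel_measurable (borel :: real measure)"
  unfolding frac_def by measurable

lemma borel_measurable_mult_indicator_pair:
  fixes g :: "'a::euclidean_space \<times> 'b::euclidean_space \<Rightarrow> ennreal"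
  assumes [measurable]: "g \<in> borel_measurable (lborel \<Otimes>\<^sub>M lborel)" "A \<in> sets borel" "B \<in> sets borel"
  shows "(\<lambda>z. g z * indicator A (snd z) * indicator B (fst z)) \<in> borel_measurable (lborel \<Otimes>\<^sub>M lborel)"
  by measurable

text \<open>At a fixed point the integral over s turns the inverse square into 2 / (sqrt \<epsilon>
  + |u|), and the integral over t turns this into the logarithm, so 12 = 6 * 2. Pairs are ordered as
  (t, s) to have s inside. The bound depends neither on the point nor on \<omega>.\<close>

lemma vortex_shift_average:
  fixes X Y :: real
  assumes \<epsilon>: "0 < \<epsilon>" "\<epsilon> \<le> 1 / 4" and "finite K"
    and K: "\<And>t. t \<in> {0..<1} \<Longrightarrow> {\<lfloor>\<omega> * Y + t\<rfloor>, \<lfloor>\<omega> * Y + t\<rfloor> + 1} \<subseteq> K"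
  shows "(\<integral>\<^sup>+p. ennreal (1 / ((cmod (vortex \<omega> K (snd p) (fst p) X Y))\<^sup>2 + \<epsilon>))
      * indicator ({0..<1} \<times> {0..<1}) p \<partial>lborel) \<le> ennreal (12 * - ln \<epsilon>)"
proof -
  let ?u = "\<lambda>t. \<bar>frac (t + \<omega> * Y) - 1 / 2\<bar>"
  let ?v = "\<lambda>s. \<bar>frac (s + - (\<omega> * X / (2 * pi))) - 1 / 2\<bar>"
  let ?h = "\<lambda>p. ennreal (1 / ((cmod (vortex \<omega> K (snd p) (fst p) X Y))\<^sup>2 + \<epsilon>))"
  have pos: "(cmod z)\<^sup>2 + \<epsilon> \<noteq> 0" for z using \<epsilon> by (smt (verit) zero_le_power2)
  have [measurable]: "?h \<in> borel_measurable (lborel \<Otimes>\<^sub>M lborel)"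
    by (intro measurable_compose[OF _ measurable_ennreal] measurable_pair_continuous)
      (auto intro!: continuous_intros simp: pos)
  have "(\<integral>\<^sup>+p. ?h p * indicator ({0..<1} \<times> {0..<1}) p \<partial>lborel)
    = (\<integral>\<^sup>+p. ?h p * indicator ({0..<1} \<times> {0..<1}) p \<partial>(lborel \<Otimes>\<^sub>M lborel))"
    by (simp add: lborel_prod)
  also have "\<dots> = (\<integral>\<^sup>+t. (\<integral>\<^sup>+s. ?h (t, s) * indicator ({0..<1} \<times> {0..<1}) (t, s) \<partial>lborel) \<partial>lborel)"
    by (rule lborel.nn_integral_fst[symmetric]) measurable
  also have "\<dots> \<le> (\<integral>\<^sup>+t. ennreal 12 * (ennreal (1 / (sqrt \<epsilon> + ?u t)) * indicator {0..<1} t) \<partial>lborel)"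
  proof (rule nn_integral_mono)
    fix t :: real
    show "(\<integral>\<^sup>+s. ?h (t, s) * indicator ({0..<1} \<times> {0..<1}) (t, s) \<partial>lborel)
      \<le> ennreal 12 * (ennreal (1 / (sqrt \<epsilon> + ?u t)) * indicator {0..<1} t)"
    proof (cases "t \<in> {0..<1}")
      case True
      have B: "sqrt \<epsilon> + ?u t > 0" using \<epsilon> by (intro add_pos_nonneg) auto
      have "(\<integral>\<^sup>+s. ?h (t, s) * indicator ({0..<1} \<times> {0..<1}) (t, s) \<partial>lborel)
        \<le> (\<integral>\<^sup>+s. ennreal 6 * (ennreal (1 / (sqrt \<epsilon> + ?u t + ?v s)\<^sup>2) * indicator {0..<1} s) \<partial>lborel)"
      proof (rule nn_integral_mono)
        fix s :: real
        have "1 / ((cmod (vortex \<omega> K s t X Y))\<^sup>2 + \<epsilon>) \<le> 6 * (1 / (sqrt \<epsilon> + ?u t + ?v s)\<^sup>2)"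
          using norm_vortex_ge[OF assms(3) K[OF True], of s X] \<epsilon>(1) by (intro inverse_square_le) auto
        then have "?h (t, s) \<le> ennreal 6 * ennreal (1 / (sqrt \<epsilon> + ?u t + ?v s)\<^sup>2)"
          by (subst ennreal_mult'[symmetric]) (auto intro!: ennreal_leI)
        then show "?h (t, s) * indicator ({0..<1} \<times> {0..<1}) (t, s)
            \<le> ennreal 6 * (ennreal (1 / (sqrt \<epsilon> + ?u t + ?v s)\<^sup>2) * indicator {0..<1} s)"
          by (auto simp: indicator_def)
      qed
      also have "\<dots> = ennreal 6 * (\<integral>\<^sup>+s. ennreal (1 / (sqrt \<epsilon> + ?u t + ?v s)\<^sup>2) * indicator {0..<1} s \<partial>lborel)"
        by (rule nn_integral_cmult) measurable
      also have "\<dots> \<le> ennreal 6 * ennreal (2 / (sqrt \<epsilon> + ?u t))"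
        by (intro mult_left_mono nn_integral_inverse_square_frac_le B) auto
      also have "\<dots> = ennreal 12 * (ennreal (1 / (sqrt \<epsilon> + ?u t)) * indicator {0..<1} t)"
        proof -
        have "6 * (2 / (sqrt \<epsilon> + ?u t)) = 12 * (1 / (sqrt \<epsilon> + ?u t))" by simp
        then have "ennreal 6 * ennreal (2 / (sqrt \<epsilon> + ?u t)) = ennreal 12 * ennreal (1 / (sqrt \<epsilon> + ?u t))"
          by (metis ennreal_mult' zero_le_numeral)
        then show ?thesis using True by simp
      qed
      finally show ?thesis .
    qed auto
  qed
  also have "\<dots> = ennreal 12 * (\<integral>\<^sup>+t. ennreal (1 / (sqrt \<epsilon> + ?u t)) * indicator {0..<1} t \<partial>lborel)"
    by (rule nn_integral_cmult) measurable
  also have "\<dots> \<le> ennreal 12 * ennreal (- ln \<epsilon>)"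
    by (intro mult_left_mono nn_integral_inverse_frac_le \<epsilon>) auto
  also have "\<dots> = ennreal (12 * - ln \<epsilon>)"
    by (rule ennreal_mult'[symmetric]) simp
  finally show ?thesis .
qed

lemma vortex_shift_exists:
  assumes \<epsilon>: "0 < \<epsilon>" "\<epsilon> \<le> 1 / 4" and "finite K"
    and K: "\<And>x t. x \<in> unit_disc \<Longrightarrow> t \<in> {0..<1} \<Longrightarrow> {\<lfloor>\<omega> * x $ 2 + t\<rfloor>, \<lfloor>\<omega> * x $ 2 + t\<rfloor> + 1} \<subseteq> K"
  obtains s t where "(LINT x|disc_measure. 1 / ((cmod (vortex \<omega> K s t (x $ 1) (x $ 2)))\<^sup>2 + \<epsilon>))
    \<le> 24 * measure lborel unit_disc * - ln \<epsilon>"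
proof -
  define m where "m = measure lborel unit_disc"
  define C where "C = 12 * - ln \<epsilon> * m"
  let ?Q = "{0..<1::real} \<times> {0..<1::real}"
  let ?h = "\<lambda>p x. 1 / ((cmod (vortex \<omega> K (snd p) (fst p) (x $ 1) (x $ 2)))\<^sup>2 + \<epsilon>)"
  have ln: "- ln \<epsilon> > 0" using \<epsilon> by simp
  have m: "m > 0" "emeasure lborel unit_disc = ennreal m"
    using content_ball_pos[of 1 "0::real^2"] emeasure_lborel_ball_finite[of "0::real^2" 1]
    by (auto simp: m_def unit_disc_def emeasure_eq_ennreal_measure top_unique less_top)
  have C: "C > 0" using ln m(1) unfolding C_def by (intro mult_pos_pos) auto
  have pos: "(cmod z)\<^sup>2 + \<epsilon> \<noteq> 0" for z using \<epsilon> by (smt (verit) zero_le_power2)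
  have cont: "continuous_on UNIV (?h p)" for p
    by (auto intro!: continuous_intros simp: pos)
  have h_meas: "(\<lambda>z. ennreal (?h (snd z) (fst z))) \<in> borel_measurable (lborel \<Otimes>\<^sub>M lborel)"
    by (intro measurable_compose[OF _ measurable_ennreal] measurable_pair_continuous)
      (auto intro!: continuous_intros simp: pos)
  have "(\<integral>\<^sup>+p. (\<integral>\<^sup>+x. ennreal (?h p x) * indicator ?Q p * indicator unit_disc x \<partial>lborel) \<partial>lborel)
     = (\<integral>\<^sup>+x. (\<integral>\<^sup>+p. ennreal (?h p x) * indicator ?Q p * indicator unit_disc x \<partial>lborel) \<partial>lborel)"
  proof (rule lborel_pair.Fubini')
    have "(\<lambda>z. ennreal (?h (snd z) (fst z)) * indicator ?Q (snd z) * indicator unit_disc (fst z))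
        \<in> borel_measurable (lborel \<Otimes>\<^sub>M lborel)"
      by (intro borel_measurable_mult_indicator_pair h_meas) (auto simp: borel_prod[symmetric])
    then show "(\<lambda>(x, p). ennreal (?h p x) * indicator ?Q p * indicator unit_disc x)
        \<in> borel_measurable (lborel \<Otimes>\<^sub>M lborel)" 
      by (simp add: case_prod_beta)
  qed
  also have "\<dots> \<le> (\<integral>\<^sup>+x. ennreal (12 * - ln \<epsilon>) * indicator unit_disc x \<partial>lborel)"
  proof (rule nn_integral_mono)
    fix x :: "real^2"
    show "(\<integral>\<^sup>+p. ennreal (?h p x) * indicator ?Q p * indicator unit_disc x \<partial>lborel)
      \<le> ennreal (12 * - ln \<epsilon>) * indicator unit_disc x"
    proof (cases "x \<in> unit_disc")
      case True
      then show ?thesis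
        using vortex_shift_average[OF \<epsilon> assms(3), of \<omega> "x $ 2" "x $ 1"] K[OF True] by simp
    qed simp
  qed
  also have "\<dots> = ennreal C"
  proof -
    have "(\<integral>\<^sup>+x. ennreal (12 * - ln \<epsilon>) * indicator unit_disc x \<partial>lborel) = ennreal (12 * - ln \<epsilon>) * ennreal m"
      using m(2) by (subst nn_integral_cmult_indicator) auto
    also have "\<dots> = ennreal C"
      unfolding C_def using ln by (intro ennreal_mult'[symmetric]) simp
    finally show ?thesis .
  qed
  finally have le: "(\<integral>\<^sup>+p. (\<integral>\<^sup>+x. ennreal (?h p x) * indicator ?Q p * indicator unit_disc x \<partial>lborel) \<partial>lborel)
    \<le> ennreal C" .
  \<comment> \<open>By Tonelli the mean over the unit square of shifts is at most \<open>C\<close>.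
    Asking for twice the mean lets the contradiction 2 C \<le> C come from non-strict inequalities
    alone.\<close>
  have "\<exists>p\<in>?Q. (\<integral>\<^sup>+x. ennreal (?h p x) \<partial>disc_measure) \<le> ennreal (2 * C)"
  proof (rule ccontr)
    assume neg: "\<not> (\<exists>p\<in>?Q. (\<integral>\<^sup>+x. ennreal (?h p x) \<partial>disc_measure) \<le> ennreal (2 * C))"
    have gt: "ennreal (2 * C) \<le> (\<integral>\<^sup>+x. ennreal (?h p x) * indicator unit_disc x \<partial>lborel)" if "p \<in> ?Q" for p
    proof -
      have "\<not> (\<integral>\<^sup>+x. ennreal (?h p x) \<partial>disc_measure) \<le> ennreal (2 * C)"
        using neg that by blast
      then show ?thesis unfolding nn_integral_disc_borel by (simp add: not_le less_imp_le)
    qed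
    have "emeasure lborel ?Q = 1"
      by (simp add: lborel_prod[symmetric] lborel.emeasure_pair_measure_Times)
    then have "ennreal (2 * C) = (\<integral>\<^sup>+p. ennreal (2 * C) * indicator ?Q p \<partial>lborel)"
      by (subst nn_integral_cmult_indicator) (auto simp: borel_prod[symmetric])
    also have "\<dots> \<le> (\<integral>\<^sup>+p. (\<integral>\<^sup>+x. ennreal (?h p x) * indicator ?Q p * indicator unit_disc x \<partial>lborel) \<partial>lborel)"
    proof (rule nn_integral_mono)
      fix p
      show "ennreal (2 * C) * indicator ?Q p \<le> (\<integral>\<^sup>+x. ennreal (?h p x) * indicator ?Q p * indicator unit_disc x \<partial>lborel)"
        using gt[of p] by (cases "p \<in> ?Q") auto
    qed
    also note le
    finally show False using C by (simp add: ennreal_le_iff)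
  qed
  then obtain p where p: "(\<integral>\<^sup>+x. ennreal (?h p x) \<partial>disc_measure) \<le> ennreal (2 * C)" by blast
  have "(\<integral>\<^sup>+x. ennreal (?h p x) \<partial>disc_measure) = ennreal (LINT x|disc_measure. ?h p x)"
    using \<epsilon> by (intro nn_integral_eq_integral integrable_continuous_disc cont) auto
  with p C have "(LINT x|disc_measure. ?h p x) \<le> 2 * C" by (simp add: ennreal_le_iff)
  then show ?thesis
    by (intro that[of "snd p" "fst p"]) (simp add: C_def m_def mult_ac)
qed

section \<open>The trial state\<close>

text \<open>The summand \<epsilon> keeps the root away from zero, so the quotient is differentiable
  also at the zeros of w. The last term comes from differentiating 1 / R.\<close>

lemma regularized_has_derivative:
  fixes f :: "real \<Rightarrow> real" and w :: "real \<Rightarrow> complex"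
  assumes f: "(f has_real_derivative f') (at x)" and w: "(w has_vector_derivative w') (at x)"
    and \<epsilon>: "\<epsilon> > 0"
  defines "R \<equiv> sqrt ((cmod (w x))\<^sup>2 + \<epsilon>)"
  shows "((\<lambda>y. (f y / sqrt ((cmod (w y))\<^sup>2 + \<epsilon>)) *\<^sub>R w y) has_vector_derivative
    (f' / R) *\<^sub>R w x + (f x / R) *\<^sub>R w' - (f x * inner (w x) w' / R ^ 3) *\<^sub>R w x) (at x)"
proof -
  have pos: "(cmod z)\<^sup>2 + \<epsilon> > 0" for z using \<epsilon> by (simp add: add_nonneg_pos)
  have R: "R > 0" "R\<^sup>2 = (cmod (w x))\<^sup>2 + \<epsilon>" using pos[of "w x"] by (auto simp: R_def)
  have "((\<lambda>y. inner (w y) (w y)) has_vector_derivative inner (w x) w' + inner w' (w x)) (at x)"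
    by (rule bounded_bilinear.has_vector_derivative[OF bounded_bilinear_inner w w])
  then have d: "((\<lambda>y. (cmod (w y))\<^sup>2 + \<epsilon>) has_real_derivative 2 * inner (w x) w' + 0) (at x)"
    unfolding has_real_derivative_iff_has_vector_derivative
    by (intro has_vector_derivative_add) (auto simp: power2_norm_eq_inner inner_commute)
  have "(sqrt has_real_derivative inverse R / 2) (at ((cmod (w x))\<^sup>2 + \<epsilon>))"
    unfolding R_def by (rule DERIV_real_sqrt[OF pos])
  from DERIV_chain2[OF this d]
  have "((\<lambda>y. sqrt ((cmod (w y))\<^sup>2 + \<epsilon>)) has_real_derivative inverse R / 2 * (2 * inner (w x) w' + 0)) (at x)" .
  also have "inverse R / 2 * (2 * inner (w x) w' + 0) = inner (w x) w' / R"
    by (simp add: inverse_eq_divide)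
  finally have sqrt: "((\<lambda>y. sqrt ((cmod (w y))\<^sup>2 + \<epsilon>)) has_real_derivative inner (w x) w' / R) (at x)" .
  from DERIV_divide[OF f sqrt]
  have "((\<lambda>y. f y / sqrt ((cmod (w y))\<^sup>2 + \<epsilon>)) has_real_derivative f' / R - f x * inner (w x) w' / R ^ 3) (at x)"
    using R(1) unfolding R_def[symmetric]
    by (simp add: field_simps power2_eq_square power3_eq_cube)
  from has_vector_derivative_scaleR[OF this w] show ?thesis
    unfolding R_def[symmetric] by (simp add: algebra_simps)
qed

text \<open>The vector i a w is orthogonal to w in the real inner product, so w' may be replaced by
  the covariant derivative \<open>D\<close> also in the radial term. Since |w| \<le> R, the two
  terms containing \<open>D\<close> are each at most \<open>A\<close>, and (x + 2 A)^2 \<le> 2 x^2 +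
  8 A^2.\<close>

lemma regularized_covariant_bound:
  fixes f f' a \<epsilon> :: real and w w' :: complex
  assumes \<epsilon>: "\<epsilon> > 0"
  defines "R \<equiv> sqrt ((cmod w)\<^sup>2 + \<epsilon>)"
  shows "(cmod ((f' / R) *\<^sub>R w + (f / R) *\<^sub>R w' - (f * inner w w' / R ^ 3) *\<^sub>R w + \<i> * of_real a * ((f / R) *\<^sub>R w)))\<^sup>2
    \<le> 2 * f'\<^sup>2 + 8 * f\<^sup>2 * (cmod (w' + \<i> * of_real a * w))\<^sup>2 / R\<^sup>2"
proof -
  define D where "D = w' + \<i> * of_real a * w"
  have R: "R > 0" "cmod w \<le> R"
    using \<epsilon> by (auto simp: R_def add_nonneg_pos intro!: real_le_rsqrt)
  have "inner w (\<i> * of_real a * w) = 0" by (simp add: inner_complex_def)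
  then have iD: "inner w w' = inner w D" by (simp add: D_def inner_add_right)
  have eq: "(f' / R) *\<^sub>R w + (f / R) *\<^sub>R w' - (f * inner w w' / R ^ 3) *\<^sub>R w + \<i> * of_real a * ((f / R) *\<^sub>R w)
    = (f' / R) *\<^sub>R w + (f / R) *\<^sub>R D - (f * inner w D / R ^ 3) *\<^sub>R w"
    unfolding iD by (simp add: D_def algebra_simps)
  define A where "A = \<bar>f\<bar> * cmod D / R"
  have "cmod ((f' / R) *\<^sub>R w) \<le> \<bar>f'\<bar>"
    using R mult_left_mono[OF R(2), of "\<bar>f'\<bar>"] by (simp add: field_simps)
  moreover have "cmod ((f / R) *\<^sub>R D) = A" using R by (simp add: A_def)
  moreover have "cmod ((f * inner w D / R ^ 3) *\<^sub>R w) \<le> A"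
  proof -
    have "\<bar>f * inner w D\<bar> * cmod w \<le> \<bar>f\<bar> * (R * cmod D) * R"
      using R Cauchy_Schwarz_ineq2[of w D]
      by (auto simp: abs_mult intro!: mult_mono order_trans[OF Cauchy_Schwarz_ineq2])
    then show ?thesis using R by (simp add: A_def field_simps power3_eq_cube)
  qed
  ultimately have "cmod ((f' / R) *\<^sub>R w + (f / R) *\<^sub>R D - (f * inner w D / R ^ 3) *\<^sub>R w) \<le> \<bar>f'\<bar> + A + A"
    by (intro norm_triangle_le_diff add_mono order_trans[OF norm_triangle_ineq4] order_trans[OF norm_triangle_ineq]) auto
  then have "(cmod ((f' / R) *\<^sub>R w + (f / R) *\<^sub>R D - (f * inner w D / R ^ 3) *\<^sub>R w))\<^sup>2 \<le> (\<bar>f'\<bar> + A + A)\<^sup>2"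
    by (intro power_mono) auto
  also have "\<dots> \<le> 2 * f'\<^sup>2 + 8 * A\<^sup>2"
    using zero_le_power2[of "\<bar>f'\<bar> - 2 * A"] by (simp add: power2_eq_square algebra_simps)
  also have "8 * A\<^sup>2 = 8 * f\<^sup>2 * (cmod D)\<^sup>2 / R\<^sup>2"
    by (simp add: A_def power_mult_distrib power_divide)
  finally show ?thesis unfolding eq D_def .
qed

lemma GP_energy_regularized:
  fixes f f\<^sub>1 f\<^sub>2 :: "real^2 \<Rightarrow> real" and w w\<^sub>1 w\<^sub>2 :: "real^2 \<Rightarrow> complex"
  assumes \<epsilon>: "\<epsilon> > 0"
    and f1: "\<And>x. ((\<lambda>s. f (x + s *\<^sub>R axis 1 1)) has_real_derivative f\<^sub>1 x) (at 0)"
    and f2: "\<And>x. ((\<lambda>s. f (x + s *\<^sub>R axis 2 1)) has_real_derivative f\<^sub>2 x) (at 0)"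
    and w1: "\<And>x. ((\<lambda>s. w (x + s *\<^sub>R axis 1 1)) has_vector_derivative w\<^sub>1 x) (at 0)"
    and w2: "\<And>x. ((\<lambda>s. w (x + s *\<^sub>R axis 2 1)) has_vector_derivative w\<^sub>2 x) (at 0)"
    and cont: "continuous_on UNIV f" "continuous_on UNIV f\<^sub>1" "continuous_on UNIV f\<^sub>2"
      "continuous_on UNIV w" "continuous_on UNIV w\<^sub>1" "continuous_on UNIV w\<^sub>2"
  defines "\<Phi> \<equiv> \<lambda>x. (f x / sqrt ((cmod (w x))\<^sup>2 + \<epsilon>)) *\<^sub>R w x"
  shows "\<Phi> \<in> H1_disc"
    "GP_energy \<epsilon> (\<Omega>\<^sub>0 / \<epsilon>) \<Phi> \<le> ereal (
      (LINT x|disc_measure. 2 * ((f\<^sub>1 x)\<^sup>2 + (f\<^sub>2 x)\<^sup>2) + 8 * (f x)\<^sup>2 *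
        ((cmod (w\<^sub>1 x + \<i> * of_real (\<Omega>\<^sub>0 / \<epsilon> * x $ 2 / 2) * w x))\<^sup>2
          + (cmod (w\<^sub>2 x - \<i> * of_real (\<Omega>\<^sub>0 / \<epsilon> * x $ 1 / 2) * w x))\<^sup>2) / ((cmod (w x))\<^sup>2 + \<epsilon>))
      + TF_energy \<Omega>\<^sub>0 (\<lambda>x. (cmod (\<Phi> x))\<^sup>2) / \<epsilon>\<^sup>2)"
proof -
  have pos: "(cmod z)\<^sup>2 + \<epsilon> > 0" for z using \<epsilon> by (simp add: add_nonneg_pos)
  then have nz: "(cmod z)\<^sup>2 + \<epsilon> \<noteq> 0" for z by (metis less_irrefl)
  define R where "R = (\<lambda>x. sqrt ((cmod (w x))\<^sup>2 + \<epsilon>))"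
  define G where "G = (\<lambda>(f' :: real^2 \<Rightarrow> real) w' x.
    (f' x / R x) *\<^sub>R w x + (f x / R x) *\<^sub>R w' x - (f x * inner (w x) (w' x) / R x ^ 3) *\<^sub>R w x)"
  have d: "((\<lambda>s. \<Phi> (x + s *\<^sub>R axis 1 1)) has_vector_derivative G f\<^sub>1 w\<^sub>1 x) (at 0)"
    "((\<lambda>s. \<Phi> (x + s *\<^sub>R axis 2 1)) has_vector_derivative G f\<^sub>2 w\<^sub>2 x) (at 0)" for x
    using regularized_has_derivative[OF f1 w1 \<epsilon>, of x] regularized_has_derivative[OF f2 w2 \<epsilon>, of x]
    by (simp_all add: \<Phi>_def G_def R_def)
  have c\<Phi>: "continuous_on UNIV \<Phi>"
    unfolding \<Phi>_def using cont by (intro continuous_intros) (auto simp: nz)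
  have cG: "continuous_on UNIV (G f' w')" if "continuous_on UNIV f'" "continuous_on UNIV w'" for f' w'
    unfolding G_def R_def using cont that by (intro continuous_intros) (auto simp: nz)
  note classical = GP_energy_classical[OF \<epsilon> d c\<Phi> cG[OF cont(2,5)] cG[OF cont(3,6)]]
  show "\<Phi> \<in> H1_disc" by (rule classical)
  have b: "(cmod (G f' w' x + \<i> * of_real a * \<Phi> x))\<^sup>2
     \<le> 2 * (f' x)\<^sup>2 + 8 * (f x)\<^sup>2 * (cmod (w' x + \<i> * of_real a * w x))\<^sup>2 / ((cmod (w x))\<^sup>2 + \<epsilon>)" for f' w' x a
    using regularized_covariant_bound[OF \<epsilon>, of "f' x" "w x" "f x" "w' x" a] pos[of "w x"]
    by (simp add: G_def R_def \<Phi>_def less_imp_le)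
  have "(LINT x|disc_measure. (cmod (G f\<^sub>1 w\<^sub>1 x + \<i> * of_real (\<Omega>\<^sub>0 / \<epsilon> * x $ 2 / 2) * \<Phi> x))\<^sup>2
        + (cmod (G f\<^sub>2 w\<^sub>2 x - \<i> * of_real (\<Omega>\<^sub>0 / \<epsilon> * x $ 1 / 2) * \<Phi> x))\<^sup>2)
    \<le> (LINT x|disc_measure. 2 * ((f\<^sub>1 x)\<^sup>2 + (f\<^sub>2 x)\<^sup>2) + 8 * (f x)\<^sup>2 *
        ((cmod (w\<^sub>1 x + \<i> * of_real (\<Omega>\<^sub>0 / \<epsilon> * x $ 2 / 2) * w x))\<^sup>2
          + (cmod (w\<^sub>2 x - \<i> * of_real (\<Omega>\<^sub>0 / \<epsilon> * x $ 1 / 2) * w x))\<^sup>2) / ((cmod (w x))\<^sup>2 + \<epsilon>))"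
  proof (rule integral_mono)
    show "integrable disc_measure (\<lambda>x. (cmod (G f\<^sub>1 w\<^sub>1 x + \<i> * of_real (\<Omega>\<^sub>0 / \<epsilon> * x $ 2 / 2) * \<Phi> x))\<^sup>2
        + (cmod (G f\<^sub>2 w\<^sub>2 x - \<i> * of_real (\<Omega>\<^sub>0 / \<epsilon> * x $ 1 / 2) * \<Phi> x))\<^sup>2)"
      using c\<Phi> cG[OF cont(2,5)] cG[OF cont(3,6)] \<epsilon>
      by (intro integrable_continuous_disc continuous_intros) auto
    show "integrable disc_measure (\<lambda>x. 2 * ((f\<^sub>1 x)\<^sup>2 + (f\<^sub>2 x)\<^sup>2) + 8 * (f x)\<^sup>2 *
        ((cmod (w\<^sub>1 x + \<i> * of_real (\<Omega>\<^sub>0 / \<epsilon> * x $ 2 / 2) * w x))\<^sup>2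
          + (cmod (w\<^sub>2 x - \<i> * of_real (\<Omega>\<^sub>0 / \<epsilon> * x $ 1 / 2) * w x))\<^sup>2) / ((cmod (w x))\<^sup>2 + \<epsilon>))"
      using cont \<epsilon> by (intro integrable_continuous_disc continuous_intros) (auto simp: nz)
    show "(cmod (G f\<^sub>1 w\<^sub>1 x + \<i> * of_real (\<Omega>\<^sub>0 / \<epsilon> * x $ 2 / 2) * \<Phi> x))\<^sup>2
        + (cmod (G f\<^sub>2 w\<^sub>2 x - \<i> * of_real (\<Omega>\<^sub>0 / \<epsilon> * x $ 1 / 2) * \<Phi> x))\<^sup>2
      \<le> 2 * ((f\<^sub>1 x)\<^sup>2 + (f\<^sub>2 x)\<^sup>2) + 8 * (f x)\<^sup>2 *
        ((cmod (w\<^sub>1 x + \<i> * of_real (\<Omega>\<^sub>0 / \<epsilon> * x $ 2 / 2) * w x))\<^sup>2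
          + (cmod (w\<^sub>2 x - \<i> * of_real (\<Omega>\<^sub>0 / \<epsilon> * x $ 1 / 2) * w x))\<^sup>2) / ((cmod (w x))\<^sup>2 + \<epsilon>)" for x
      using add_mono[OF b[of f\<^sub>1 w\<^sub>1 x "\<Omega>\<^sub>0 / \<epsilon> * x $ 2 / 2"] b[of f\<^sub>2 w\<^sub>2 x "- (\<Omega>\<^sub>0 / \<epsilon> * x $ 1 / 2)"]]
      by (simp add: distrib_left add_divide_distrib)
  qed
  then show "GP_energy \<epsilon> (\<Omega>\<^sub>0 / \<epsilon>) \<Phi> \<le> ereal (
      (LINT x|disc_measure. 2 * ((f\<^sub>1 x)\<^sup>2 + (f\<^sub>2 x)\<^sup>2) + 8 * (f x)\<^sup>2 *
        ((cmod (w\<^sub>1 x + \<i> * of_real (\<Omega>\<^sub>0 / \<epsilon> * x $ 2 / 2) * w x))\<^sup>2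
          + (cmod (w\<^sub>2 x - \<i> * of_real (\<Omega>\<^sub>0 / \<epsilon> * x $ 1 / 2) * w x))\<^sup>2) / ((cmod (w x))\<^sup>2 + \<epsilon>))
      + TF_energy \<Omega>\<^sub>0 (\<lambda>x. (cmod (\<Phi> x))\<^sup>2) / \<epsilon>\<^sup>2)"
    unfolding classical(2) by simp
qed

section \<open>Smoothing the Thomas-Fermi density\<close>

text \<open>The positive root y of y (y - z) = \<epsilon>^2 / 4, a smooth, strictly positive
  substitute for \<open>max 0 z\<close>, whose square root has unbounded slope at 0.\<close>

definition soft_pos :: "real \<Rightarrow> real \<Rightarrow> real" where
  "soft_pos \<epsilon> z = (z + sqrt (z\<^sup>2 + \<epsilon>\<^sup>2)) / 2"

lemma soft_pos_bounds:
  assumes "\<epsilon> > 0"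
  shows "0 < soft_pos \<epsilon> z" "max 0 z \<le> soft_pos \<epsilon> z" "soft_pos \<epsilon> z \<le> max 0 z + \<epsilon> / 2"
    "soft_pos \<epsilon> z \<le> sqrt (z\<^sup>2 + \<epsilon>\<^sup>2)"
proof -
  have "sqrt (z\<^sup>2) < sqrt (z\<^sup>2 + \<epsilon>\<^sup>2)" using assms by (intro real_sqrt_less_mono) simp
  then have gt: "\<bar>z\<bar> < sqrt (z\<^sup>2 + \<epsilon>\<^sup>2)" by simp
  moreover have "sqrt (z\<^sup>2 + \<epsilon>\<^sup>2) \<le> \<bar>z\<bar> + \<epsilon>"
    using assms by (intro real_le_lsqrt) (auto simp: power2_sum)
  ultimately show "0 < soft_pos \<epsilon> z" "max 0 z \<le> soft_pos \<epsilon> z" "soft_pos \<epsilon> z \<le> max 0 z + \<epsilon> / 2"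
    "soft_pos \<epsilon> z \<le> sqrt (z\<^sup>2 + \<epsilon>\<^sup>2)"
    by (auto simp: soft_pos_def field_simps abs_if max_def split: if_splits)
qed

lemma continuous_on_soft_pos [continuous_intros]:
  "continuous_on A f \<Longrightarrow> continuous_on A (\<lambda>x. soft_pos \<epsilon> (f x))"
  unfolding soft_pos_def by (intro continuous_intros) auto

text \<open>With S = sqrt (z^2 + \<epsilon>^2) the derivative of \<open>soft_pos\<close> is
  \<open>soft_pos\<close> divided by S, so its root has the logarithmic derivative 1 / (2
  S).\<close>

lemma DERIV_sqrt_soft_pos:
  assumes "\<epsilon> > 0"
  shows "((\<lambda>z. sqrt (soft_pos \<epsilon> z)) has_real_derivative sqrt (soft_pos \<epsilon> z) / (2 * sqrt (z\<^sup>2 + \<epsilon>\<^sup>2))) (at z)"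
proof -
  define S where "S = sqrt (z\<^sup>2 + \<epsilon>\<^sup>2)"
  have p: "z\<^sup>2 + \<epsilon>\<^sup>2 > 0" using assms by (simp add: add_nonneg_pos)
  then have S: "S > 0" by (simp add: S_def)
  have "((\<lambda>z. soft_pos \<epsilon> z) has_real_derivative (1 + z / S) / 2) (at z)"
    unfolding soft_pos_def S_def using p by (auto intro!: derivative_eq_intros simp: inverse_eq_divide)
  also have "(1 + z / S) / 2 = soft_pos \<epsilon> z / S"
    unfolding soft_pos_def S_def[symmetric] using S by (simp add: field_simps)
  finally have "((\<lambda>z. sqrt (soft_pos \<epsilon> z)) has_real_derivative
      inverse (sqrt (soft_pos \<epsilon> z)) / 2 * (soft_pos \<epsilon> z / S)) (at z)"
    using soft_pos_bounds(1)[OF assms] by (intro DERIV_chain2[OF DERIV_real_sqrt])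
  also have "inverse (sqrt (soft_pos \<epsilon> z)) / 2 * (soft_pos \<epsilon> z / S) = sqrt (soft_pos \<epsilon> z) / (2 * S)"
    using S soft_pos_bounds(1)[OF assms, of z]
    by (simp add: field_simps)
  finally show ?thesis by (simp add: S_def)
qed

text \<open>\<open>soft_pos\<close> is at most S, and S is at least \<epsilon>. Smoothing at height
  \<epsilon> thus costs kinetic energy of order 1 / \<epsilon>, within the admissible |ln
  \<epsilon>| / \<epsilon>.\<close>

lemma DERIV_sqrt_soft_pos_square_le:
  assumes "\<epsilon> > 0"
  shows "(sqrt (soft_pos \<epsilon> z) / (2 * sqrt (z\<^sup>2 + \<epsilon>\<^sup>2)))\<^sup>2 \<le> 1 / (4 * \<epsilon>)"
proof -
  define S where "S = sqrt (z\<^sup>2 + \<epsilon>\<^sup>2)"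
  have "\<epsilon> \<le> S" unfolding S_def using assms by (intro real_le_rsqrt) auto
  then have S: "S > 0" "\<epsilon> \<le> S" using assms by auto
  have "(sqrt (soft_pos \<epsilon> z) / (2 * S))\<^sup>2 = soft_pos \<epsilon> z / (4 * S\<^sup>2)"
    using soft_pos_bounds(1)[OF assms, of z] by (simp add: power_divide power_mult_distrib)
  also have "\<dots> \<le> S / (4 * S\<^sup>2)"
    using soft_pos_bounds(4)[OF assms, of z] by (intro divide_right_mono) (auto simp: S_def)
  also have "\<dots> = 1 / (4 * S)" using S by (simp add: power2_eq_square)
  also have "\<dots> \<le> 1 / (4 * \<epsilon>)" using S assms by (intro divide_left_mono) auto
  finally show ?thesis by (simp add: S_def)
qed

text \<open>One finite index set, chosen independently of the point and the shift, has to contain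
  both active strips everywhere on the disc; there |\<omega> x2| is at most \<omega>.\<close>

lemma vortex_window:
  assumes "x \<in> unit_disc" "t \<in> {0..<1}" "\<omega> \<ge> 0"
  shows "{\<lfloor>\<omega> * x $ 2 + t\<rfloor>, \<lfloor>\<omega> * x $ 2 + t\<rfloor> + 1} \<subseteq> {- (\<lceil>\<omega>\<rceil> + 2)..\<lceil>\<omega>\<rceil> + 2}"
proof -
  have "\<bar>x $ 2\<bar> \<le> 1"
    using component_le_norm_cart[of x 2] norm_le_1_unit_disc[OF assms(1)] by linarith
  then have "\<omega> * \<bar>x $ 2\<bar> \<le> \<omega> * 1" using assms(3) by (intro mult_left_mono) auto
  then have "\<bar>\<omega> * x $ 2\<bar> \<le> \<omega>" using assms(3) by (simp add: abs_mult)
  then have "- of_int \<lceil>\<omega>\<rceil> \<le> \<omega> * x $ 2 + t" "\<omega> * x $ 2 + t < of_int \<lceil>\<omega>\<rceil> + 1"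
    using assms(2) le_of_int_ceiling[of \<omega>] unfolding atLeastLessThan_iff by linarith+
  then have "- \<lceil>\<omega>\<rceil> \<le> \<lfloor>\<omega> * x $ 2 + t\<rfloor>" "\<lfloor>\<omega> * x $ 2 + t\<rfloor> < \<lceil>\<omega>\<rceil> + 1"
    by linarith+
  then show ?thesis by auto
qed

text \<open>With q = \<Omega>0^2 r^2 / 4 the integrands differ by (\<sigma> + \<rho> - q) (\<sigma>
  - \<rho>), whose first factor is bounded. So an L1 estimate of the density error controls the
  energy error.\<close>

lemma TF_energy_diff_le:
  assumes L2: "\<sigma> \<in> L2_disc" "\<rho> \<in> L2_disc"
    and bounds: "\<And>x. x \<in> unit_disc \<Longrightarrow> 0 \<le> \<sigma> x" "\<And>x. x \<in> unit_disc \<Longrightarrow> \<sigma> x \<le> A"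
      "\<And>x. x \<in> unit_disc \<Longrightarrow> 0 \<le> \<rho> x" "\<And>x. x \<in> unit_disc \<Longrightarrow> \<rho> x \<le> B"
  shows "TF_energy \<Omega>\<^sub>0 \<sigma> - TF_energy \<Omega>\<^sub>0 \<rho> \<le> (A + B + \<Omega>\<^sub>0\<^sup>2 / 4) * (LINT x|disc_measure. \<bar>\<sigma> x - \<rho> x\<bar>)"
proof -
  note int = TF_energy_integrable[OF L2(1), of \<Omega>\<^sub>0] TF_energy_integrable[OF L2(2), of \<Omega>\<^sub>0]
  have abs: "integrable disc_measure (\<lambda>x. \<bar>\<sigma> x - \<rho> x\<bar>)"
    by (intro integrable_abs L2_disc_integrable L2_disc_diff L2)
  have "TF_energy \<Omega>\<^sub>0 \<sigma> - TF_energy \<Omega>\<^sub>0 \<rho> = (LINT x|disc_measure.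
      ((\<sigma> x)\<^sup>2 - \<Omega>\<^sub>0\<^sup>2 * (norm x)\<^sup>2 * \<sigma> x / 4) - ((\<rho> x)\<^sup>2 - \<Omega>\<^sub>0\<^sup>2 * (norm x)\<^sup>2 * \<rho> x / 4))"
    unfolding TF_energy_def by (rule Bochner_Integration.integral_diff[OF int, symmetric])
  also have "\<dots> \<le> (LINT x|disc_measure. (A + B + \<Omega>\<^sub>0\<^sup>2 / 4) * \<bar>\<sigma> x - \<rho> x\<bar>)"
  proof (rule integral_mono)
    fix x assume "x \<in> space disc_measure"
    then have x: "x \<in> unit_disc" by simp
    define q where "q = \<Omega>\<^sub>0\<^sup>2 * (norm x)\<^sup>2 / 4"
    have "(norm x)\<^sup>2 \<le> 1" using norm_le_1_unit_disc[OF x] by (simp add: power_le_one)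
    then have q: "0 \<le> q" "q \<le> \<Omega>\<^sub>0\<^sup>2 / 4"
      unfolding q_def using mult_left_mono[of "(norm x)\<^sup>2" 1 "\<Omega>\<^sub>0\<^sup>2"] by auto
    have "\<bar>\<sigma> x + \<rho> x - q\<bar> \<le> A + B + \<Omega>\<^sub>0\<^sup>2 / 4"
      using bounds[OF x] q by linarith
    then have "\<bar>\<sigma> x + \<rho> x - q\<bar> * \<bar>\<sigma> x - \<rho> x\<bar> \<le> (A + B + \<Omega>\<^sub>0\<^sup>2 / 4) * \<bar>\<sigma> x - \<rho> x\<bar>"
      by (rule mult_right_mono) simp
    then have "(\<sigma> x + \<rho> x - q) * (\<sigma> x - \<rho> x) \<le> (A + B + \<Omega>\<^sub>0\<^sup>2 / 4) * \<bar>\<sigma> x - \<rho> x\<bar>"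
      unfolding abs_mult[symmetric] by (rule order_trans[OF abs_ge_self])
    moreover have "\<Omega>\<^sub>0\<^sup>2 * (norm x)\<^sup>2 * \<sigma> x / 4 = q * \<sigma> x" "\<Omega>\<^sub>0\<^sup>2 * (norm x)\<^sup>2 * \<rho> x / 4 = q * \<rho> x"
      by (simp_all add: q_def)
    ultimately show "((\<sigma> x)\<^sup>2 - \<Omega>\<^sub>0\<^sup>2 * (norm x)\<^sup>2 * \<sigma> x / 4) - ((\<rho> x)\<^sup>2 - \<Omega>\<^sub>0\<^sup>2 * (norm x)\<^sup>2 * \<rho> x / 4)
        \<le> (A + B + \<Omega>\<^sub>0\<^sup>2 / 4) * \<bar>\<sigma> x - \<rho> x\<bar>"
      by (simp only:) (simp add: algebra_simps power2_eq_square)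
  next
    show "integrable disc_measure (\<lambda>x. ((\<sigma> x)\<^sup>2 - \<Omega>\<^sub>0\<^sup>2 * (norm x)\<^sup>2 * \<sigma> x / 4)
        - ((\<rho> x)\<^sup>2 - \<Omega>\<^sub>0\<^sup>2 * (norm x)\<^sup>2 * \<rho> x / 4))"
      by (rule Bochner_Integration.integrable_diff[OF int])
    show "integrable disc_measure (\<lambda>x. (A + B + \<Omega>\<^sub>0\<^sup>2 / 4) * \<bar>\<sigma> x - \<rho> x\<bar>)"
      by (rule integrable_mult_right) (rule abs)
  qed
  finally show ?thesis by simp
qed

text \<open>The derivative of z \<mapsto> sqrt (soft_pos \<epsilon> z) at z = \<kappa> |x|^2 + l;
  the chain rule supplies the factor 2 \<kappa> x.\<close>

definition soft_slope :: "real \<Rightarrow> real \<Rightarrow> real \<Rightarrow> real^2 \<Rightarrow> real" where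
  "soft_slope \<epsilon> \<kappa> l x = sqrt (soft_pos \<epsilon> (\<kappa> * (norm x)\<^sup>2 + l)) / (2 * sqrt ((\<kappa> * (norm x)\<^sup>2 + l)\<^sup>2 + \<epsilon>\<^sup>2))"

lemma soft_profile_deriv:
  fixes x :: "real^2"
  assumes "\<epsilon> > 0"
  shows "((\<lambda>s. c * sqrt (soft_pos \<epsilon> (\<kappa> * (norm (x + s *\<^sub>R axis i 1))\<^sup>2 + l))) has_real_derivative
    c * (soft_slope \<epsilon> \<kappa> l x * (2 * \<kappa> * x $ i))) (at 0)"
proof -
  have eq: "(norm (x + s *\<^sub>R axis i 1))\<^sup>2 = (norm x)\<^sup>2 + 2 * s * x $ i + s\<^sup>2" for s
  proof -
    have "(norm (x + s *\<^sub>R axis i 1))\<^sup>2 = inner x x + 2 * s * inner x (axis i 1) + s\<^sup>2 * inner (axis i 1) (axis i (1::real))"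
      unfolding power2_norm_eq_inner
      by (simp add: inner_add_left inner_add_right inner_commute[of "axis i 1" x] power2_eq_square algebra_simps)
    then show ?thesis by (simp add: inner_axis inner_axis_axis power2_norm_eq_inner)
  qed
  have g: "((\<lambda>s. \<kappa> * ((norm x)\<^sup>2 + 2 * s * x $ i + s\<^sup>2) + l) has_real_derivative 2 * \<kappa> * x $ i) (at 0)"
    by (auto intro!: derivative_eq_intros)
  have "((\<lambda>z. sqrt (soft_pos \<epsilon> z)) has_real_derivative soft_slope \<epsilon> \<kappa> l x)
      (at (\<kappa> * ((norm x)\<^sup>2 + 2 * 0 * x $ i + 0\<^sup>2) + l))"
    using DERIV_sqrt_soft_pos[OF assms, of "\<kappa> * (norm x)\<^sup>2 + l"] by (simp add: soft_slope_def)
  from DERIV_cmult[OF DERIV_chain2[OF this g]] show ?thesis unfolding eq .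
qed

lemma continuous_on_soft_slope:
  assumes "\<epsilon> > 0"
  shows "continuous_on UNIV (soft_slope \<epsilon> \<kappa> l)"
proof -
  have "z\<^sup>2 + \<epsilon>\<^sup>2 \<noteq> 0" for z using assms by (simp add: add_nonneg_eq_0_iff)
  then show ?thesis unfolding soft_slope_def by (intro continuous_intros) auto
qed

lemma vortex_directional:
  fixes x :: "real^2"
  shows "((\<lambda>r. vortex \<omega> K s t ((x + r *\<^sub>R axis 1 1) $ 1) ((x + r *\<^sub>R axis 1 1) $ 2)) has_vector_derivative
      vortex_cov1 \<omega> K s t (x $ 1) (x $ 2) - \<i> * of_real (\<omega>\<^sup>2 * x $ 2 / 2) * vortex \<omega> K s t (x $ 1) (x $ 2)) (at 0)"
    "((\<lambda>r. vortex \<omega> K s t ((x + r *\<^sub>R axis 2 1) $ 1) ((x + r *\<^sub>R axis 2 1) $ 2)) has_vector_derivative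
      vortex_cov2 \<omega> K s t (x $ 1) (x $ 2) + \<i> * of_real (\<omega>\<^sup>2 * x $ 1 / 2) * vortex \<omega> K s t (x $ 1) (x $ 2)) (at 0)"
proof -
  have shift: "((\<lambda>r. F (a + r)) has_vector_derivative D) (at 0)"
    if "(F has_vector_derivative D) (at a)" for F :: "real \<Rightarrow> complex" and a D
  proof -
    have "((\<lambda>r. a + r) has_vector_derivative 1) (at 0)" by (auto intro!: derivative_eq_intros)
    moreover have "(F has_vector_derivative D) (at (a + 0))" using that by simp
    ultimately have "((F \<circ> (\<lambda>r. a + r)) has_vector_derivative 1 *\<^sub>R D) (at 0)"
      by (rule vector_diff_chain_at)
    then show ?thesis by (simp add: o_def)
  qed
  show "((\<lambda>r. vortex \<omega> K s t ((x + r *\<^sub>R axis 1 1) $ 1) ((x + r *\<^sub>R axis 1 1) $ 2)) has_vector_derivative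
      vortex_cov1 \<omega> K s t (x $ 1) (x $ 2) - \<i> * of_real (\<omega>\<^sup>2 * x $ 2 / 2) * vortex \<omega> K s t (x $ 1) (x $ 2)) (at 0)"
    using shift[OF vortex_deriv1[of \<omega> K s t "x $ 2" "x $ 1"]] by (simp add: axis_def)
  show "((\<lambda>r. vortex \<omega> K s t ((x + r *\<^sub>R axis 2 1) $ 1) ((x + r *\<^sub>R axis 2 1) $ 2)) has_vector_derivative
      vortex_cov2 \<omega> K s t (x $ 1) (x $ 2) + \<i> * of_real (\<omega>\<^sup>2 * x $ 1 / 2) * vortex \<omega> K s t (x $ 1) (x $ 2)) (at 0)"
    using shift[OF vortex_deriv2[of \<omega> K s t "x $ 1" "x $ 2"]] by (simp add: axis_def)
qed

section \<open>Energy of the trial state\<close>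

text \<open>\<open>A\<close> measures the L1 error of the density in units of \<epsilon> |ln
  \<epsilon>|: m / 2 comes from smoothing and 24 M m from the vortices. The hypothesis
  \<open>small\<close> keeps the mass above 1 / 2, so that normalizing at most doubles the density,
  and 1 \<le> -ln \<epsilon> absorbs the errors without logarithm. The three summands of the final
  constant stem from the TF energy, the gradient of the amplitude and the vortices.\<close>

lemma GP_trial_state:
  fixes \<Omega>\<^sub>0 l \<epsilon> :: real
  defines "m \<equiv> measure lborel unit_disc" and "M \<equiv> \<Omega>\<^sub>0\<^sup>2 / 8 + \<bar>l\<bar> + 1"
  defines "A \<equiv> m / 2 + 24 * M * m"
  assumes \<Omega>\<^sub>0: "\<Omega>\<^sub>0 > 0" and l: "(LINT x|disc_measure. TF_profile \<Omega>\<^sub>0 l x) = 1"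
    and \<epsilon>: "0 < \<epsilon>" "\<epsilon> \<le> 1 / 4" "1 \<le> - ln \<epsilon>" and small: "A * (\<epsilon> * - ln \<epsilon>) \<le> 1 / 2"
  shows "\<exists>\<Phi>\<in>H1_disc. L2_norm_disc \<Phi> = 1 \<and> GP_energy \<epsilon> (\<Omega>\<^sub>0 / \<epsilon>) \<Phi>
    \<le> ereal (TF_energy \<Omega>\<^sub>0 (TF_profile \<Omega>\<^sub>0 l) / \<epsilon>\<^sup>2
      + (2 * A * (3 * M + \<Omega>\<^sub>0\<^sup>2 / 4) + \<Omega>\<^sub>0 ^ 4 * m / 16 + 26112 * M * \<Omega>\<^sub>0 * m) * (- ln \<epsilon> / \<epsilon>))"
proof -
  define L where "L = - ln \<epsilon>"
  define \<kappa> where "\<kappa> = \<Omega>\<^sub>0\<^sup>2 / 8"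
  \<comment> \<open>This makes the field \<omega>^2 of the lattice equal to the angular velocity, so
    its potential is the one in the completed square.\<close>
  define \<omega> where "\<omega> = sqrt (\<Omega>\<^sub>0 / \<epsilon>)"
  define K where "K = {- (\<lceil>\<omega>\<rceil> + 2)..\<lceil>\<omega>\<rceil> + 2}"
  have L: "L \<ge> 1" using \<epsilon> by (simp add: L_def)
  have \<omega>: "\<omega> \<ge> 0" "\<omega>\<^sup>2 = \<Omega>\<^sub>0 / \<epsilon>" using \<Omega>\<^sub>0 \<epsilon> by (auto simp: \<omega>_def)
  have m: "m > 0" "measure disc_measure (space disc_measure) = m"
    unfolding m_def by (rule measure_disc)+
  have M: "M \<ge> 1" by (simp add: M_def)
  have A: "A > 0" using m M by (simp add: A_def add_pos_pos)
  obtain s t where st: "(LINT x|disc_measure. 1 / ((cmod (vortex \<omega> K s t (x $ 1) (x $ 2)))\<^sup>2 + \<epsilon>)) \<le> 24 * m * L"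
    unfolding m_def L_def
    by (rule vortex_shift_exists[OF \<epsilon>(1,2), of K \<omega>]) (use vortex_window \<omega>(1) in \<open>auto simp: K_def\<close>)
  define w where "w = (\<lambda>x::real^2. vortex \<omega> K s t (x $ 1) (x $ 2))"
  define h where "h = (\<lambda>x. 1 / ((cmod (w x))\<^sup>2 + \<epsilon>))"
  have h_int: "(LINT x|disc_measure. h x) \<le> 24 * m * L" using st by (simp add: h_def w_def)
  have pos: "(cmod z)\<^sup>2 + \<epsilon> > 0" for z using \<epsilon> by (simp add: add_nonneg_pos)
  then have nz: "(cmod z)\<^sup>2 + \<epsilon> \<noteq> 0" for z by (metis less_irrefl)
  have w_cont: "continuous_on UNIV w" unfolding w_def by (intro continuous_intros)
  have h_cont: "continuous_on UNIV h" unfolding h_def using w_cont by (intro continuous_intros) (auto simp: nz)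
  have h_pos: "h x > 0" "\<epsilon> * h x \<le> 1" for x using pos[of "w x"] by (auto simp: h_def divide_simps)

  define \<rho> where "\<rho> = TF_profile \<Omega>\<^sub>0 l"
  define q where "q = (\<lambda>x::real^2. soft_pos \<epsilon> (\<kappa> * (norm x)\<^sup>2 + l))"
  have q_cont: "continuous_on UNIV q" unfolding q_def by (intro continuous_intros)
  have \<rho>_cont: "continuous_on UNIV \<rho>" unfolding \<rho>_def by (rule continuous_on_TF_profile)
  have q: "0 < q x" "\<rho> x \<le> q x" "q x \<le> \<rho> x + \<epsilon> / 2" for x
    using soft_pos_bounds[OF \<epsilon>(1), of "\<kappa> * (norm x)\<^sup>2 + l"]
    by (auto simp: q_def \<rho>_def TF_profile_def \<kappa>_def)
  have \<rho>_nonneg: "0 \<le> \<rho> x" for x by (simp add: \<rho>_def TF_profile_def)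
  have \<rho>_le: "\<rho> x \<le> M - 1" if "x \<in> unit_disc" for x
  proof -
    have "(norm x)\<^sup>2 \<le> 1" using norm_le_1_unit_disc[OF that] by (simp add: power_le_one)
    then have "\<Omega>\<^sub>0\<^sup>2 / 8 * (norm x)\<^sup>2 \<le> \<Omega>\<^sub>0\<^sup>2 / 8 * 1" by (intro mult_left_mono) auto
    then show ?thesis by (auto simp: \<rho>_def TF_profile_def M_def)
  qed
  have q_le: "q x \<le> M" if "x \<in> unit_disc" for x
    using \<rho>_le[OF that] q(3)[of x] \<epsilon>(2) by simp

  \<comment> \<open>The density of the trial state before normalization: |w|^2 / (|w|^2 +
    \<epsilon>) = 1 - \<epsilon> h.\<close>
  define \<tau> where "\<tau> = (\<lambda>x. q x * (1 - \<epsilon> * h x))"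
  have \<tau>_cont: "continuous_on UNIV \<tau>" unfolding \<tau>_def using q_cont h_cont by (intro continuous_intros)
  have \<tau>_nonneg: "0 \<le> \<tau> x" and \<tau>_le: "\<tau> x \<le> q x" for x
    using h_pos[of x] q(1)[of x] \<epsilon>(1)
    by (auto simp: \<tau>_def intro!: mult_nonneg_nonneg mult_left_le)
  define \<delta> where "\<delta> = (LINT x|disc_measure. \<bar>\<tau> x - \<rho> x\<bar>)"
  have \<delta>: "\<delta> \<le> A * (\<epsilon> * L)"
  proof -
    have "\<delta> \<le> (LINT x|disc_measure. \<epsilon> / 2 + \<epsilon> * M * h x)"
      unfolding \<delta>_def
    proof (rule integral_mono)
      fix x assume "x \<in> space disc_measure"
      then have x: "x \<in> unit_disc" by simp
      have "\<tau> x = q x - q x * (\<epsilon> * h x)" by (simp add: \<tau>_def algebra_simps)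
      moreover have "q x * (\<epsilon> * h x) \<le> M * (\<epsilon> * h x)"
        using q_le[OF x] h_pos[of x] \<epsilon>(1) by (intro mult_right_mono) auto
      moreover have "0 \<le> q x * (\<epsilon> * h x)"
        using q(1)[of x] h_pos(1)[of x] \<epsilon>(1) by (intro mult_nonneg_nonneg) auto
      ultimately have "\<bar>\<tau> x - \<rho> x\<bar> \<le> \<epsilon> / 2 + M * (\<epsilon> * h x)"
        using q(2,3)[of x] by linarith
      then show "\<bar>\<tau> x - \<rho> x\<bar> \<le> \<epsilon> / 2 + \<epsilon> * M * h x" by (simp add: mult_ac)
    qed (use \<tau>_cont \<rho>_cont h_cont in \<open>auto intro!: integrable_continuous_disc continuous_intros\<close>)
    also have "\<dots> = \<epsilon> / 2 * m + \<epsilon> * M * (LINT x|disc_measure. h x)"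
      using integrable_continuous_disc[OF h_cont] m(2) by simp
    also have "\<dots> \<le> \<epsilon> / 2 * m * L + \<epsilon> * M * (24 * m * L)"
      using h_int \<epsilon>(1) M m(1) L mult_left_mono[of 1 L "\<epsilon> / 2 * m"]
      by (intro add_mono mult_left_mono) auto
    also have "\<dots> = A * (\<epsilon> * L)" by (simp add: A_def algebra_simps)
    finally show ?thesis .
  qed
  have \<delta>2: "\<delta> \<le> 1 / 2" using \<delta> small by (simp add: L_def)
  define \<mu> where "\<mu> = (LINT x|disc_measure. \<tau> x)"
  note \<tau>_int = integrable_continuous_disc[OF \<tau>_cont] and \<rho>_int = integrable_continuous_disc[OF \<rho>_cont]
  have \<mu>: "\<bar>\<mu> - 1\<bar> \<le> \<delta>"
  proof -
    have "\<mu> - 1 = (LINT x|disc_measure. \<tau> x - \<rho> x)"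
      using \<tau>_int \<rho>_int l by (simp add: \<mu>_def \<rho>_def)
    then show ?thesis unfolding \<delta>_def by (metis integral_abs_bound)
  qed
  define c where "c = sqrt (1 / \<mu>)"
  have \<mu>2: "\<mu> \<ge> 1 / 2" using \<mu> \<delta>2 by linarith
  have c: "c > 0" "c\<^sup>2 = 1 / \<mu>" "c\<^sup>2 \<le> 2" using \<mu>2 by (auto simp: c_def divide_simps)

  define f where "f = (\<lambda>x. c * sqrt (q x))"
  define D where "D = (\<lambda>i x. c * (soft_slope \<epsilon> \<kappa> l x * (2 * \<kappa> * x $ i)))"
  define W1 where "W1 = (\<lambda>x::real^2. vortex_cov1 \<omega> K s t (x $ 1) (x $ 2) - \<i> * of_real (\<omega>\<^sup>2 * x $ 2 / 2) * w x)"
  define W2 where "W2 = (\<lambda>x::real^2. vortex_cov2 \<omega> K s t (x $ 1) (x $ 2) + \<i> * of_real (\<omega>\<^sup>2 * x $ 1 / 2) * w x)"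
  define \<Phi> where "\<Phi> = (\<lambda>x. (f x / sqrt ((cmod (w x))\<^sup>2 + \<epsilon>)) *\<^sub>R w x)"
  have f_cont: "continuous_on UNIV f" unfolding f_def using q_cont by (intro continuous_intros)
  have D_cont: "continuous_on UNIV (D i)" for i
    unfolding D_def by (intro continuous_intros continuous_on_soft_slope \<epsilon>)
  have W_cont: "continuous_on UNIV W1" "continuous_on UNIV W2"
    unfolding W1_def W2_def using w_cont by (auto intro!: continuous_intros)
  have f_deriv: "((\<lambda>r. f (x + r *\<^sub>R axis i 1)) has_real_derivative D i x) (at 0)" for i x
    unfolding f_def q_def D_def by (rule soft_profile_deriv[OF \<epsilon>(1)])
  have w_deriv: "((\<lambda>r. w (x + r *\<^sub>R axis 1 1)) has_vector_derivative W1 x) (at 0)"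
    "((\<lambda>r. w (x + r *\<^sub>R axis 2 1)) has_vector_derivative W2 x) (at 0)" for x
    unfolding w_def W1_def W2_def by (rule vortex_directional)+
  define T where "T = (\<lambda>x. 2 * ((D 1 x)\<^sup>2 + (D 2 x)\<^sup>2) + 8 * (f x)\<^sup>2 *
        ((cmod (W1 x + \<i> * of_real (\<Omega>\<^sub>0 / \<epsilon> * x $ 2 / 2) * w x))\<^sup>2
          + (cmod (W2 x - \<i> * of_real (\<Omega>\<^sub>0 / \<epsilon> * x $ 1 / 2) * w x))\<^sup>2) / ((cmod (w x))\<^sup>2 + \<epsilon>))"
  have H1: "\<Phi> \<in> H1_disc"
    unfolding \<Phi>_def
    by (rule GP_energy_regularized(1)[OF \<epsilon>(1) f_deriv f_deriv w_deriv f_cont D_cont D_cont w_cont W_cont])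
  have energy: "GP_energy \<epsilon> (\<Omega>\<^sub>0 / \<epsilon>) \<Phi> \<le> ereal ((LINT x|disc_measure. T x)
      + TF_energy \<Omega>\<^sub>0 (\<lambda>x. (cmod (\<Phi> x))\<^sup>2) / \<epsilon>\<^sup>2)"
    unfolding \<Phi>_def T_def
    by (rule GP_energy_regularized(2)[OF \<epsilon>(1) f_deriv f_deriv w_deriv f_cont D_cont D_cont w_cont W_cont])

  have \<Phi>_sq: "(cmod (\<Phi> x))\<^sup>2 = c\<^sup>2 * \<tau> x" for x
  proof -
    have "(cmod (\<Phi> x))\<^sup>2 = (f x)\<^sup>2 * ((cmod (w x))\<^sup>2 / ((cmod (w x))\<^sup>2 + \<epsilon>))"
      using pos[of "w x"] by (simp add: \<Phi>_def power_mult_distrib power_divide)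
    also have "(cmod (w x))\<^sup>2 / ((cmod (w x))\<^sup>2 + \<epsilon>) = 1 - \<epsilon> * h x"
      using nz[of "w x"] by (simp add: h_def field_simps)
    also have "(f x)\<^sup>2 = c\<^sup>2 * q x" using q(1)[of x] by (simp add: f_def power_mult_distrib)
    finally show ?thesis by (simp add: \<tau>_def)
  qed
  have norm: "L2_norm_disc \<Phi> = 1"
    using \<mu>2 c(2) by (simp add: L2_norm_disc_def \<Phi>_sq \<mu>_def[symmetric])
  have TF: "TF_energy \<Omega>\<^sub>0 (\<lambda>x. (cmod (\<Phi> x))\<^sup>2) - TF_energy \<Omega>\<^sub>0 \<rho> \<le> (3 * M + \<Omega>\<^sub>0\<^sup>2 / 4) * (2 * A * (\<epsilon> * L))"
  proof -
    have "TF_energy \<Omega>\<^sub>0 (\<lambda>x. c\<^sup>2 * \<tau> x) - TF_energy \<Omega>\<^sub>0 \<rho>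
      \<le> (2 * M + M + \<Omega>\<^sub>0\<^sup>2 / 4) * (LINT x|disc_measure. \<bar>c\<^sup>2 * \<tau> x - \<rho> x\<bar>)"
    proof (rule TF_energy_diff_le)
      show "(\<lambda>x. c\<^sup>2 * \<tau> x) \<in> L2_disc" "\<rho> \<in> L2_disc"
        using \<tau>_cont \<rho>_cont by (auto intro!: L2_disc_continuous continuous_intros)
      fix x assume x: "x \<in> unit_disc"
      show "0 \<le> c\<^sup>2 * \<tau> x" using \<tau>_nonneg by simp
      show "c\<^sup>2 * \<tau> x \<le> 2 * M"
        using c(3) \<tau>_nonneg[of x] \<tau>_le[of x] q_le[OF x] by (intro mult_mono) auto
      show "0 \<le> \<rho> x" by (rule \<rho>_nonneg)
      show "\<rho> x \<le> M" using \<rho>_le[OF x] by simp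
    qed
    \<comment> \<open>The normalization error integrates to |\<mu> - 1|, which is again at most
      \<delta>; hence the factor 2 in 2 A.\<close>
    also have "(LINT x|disc_measure. \<bar>c\<^sup>2 * \<tau> x - \<rho> x\<bar>) \<le> (LINT x|disc_measure. \<bar>c\<^sup>2 - 1\<bar> * \<tau> x + \<bar>\<tau> x - \<rho> x\<bar>)"
    proof (rule integral_mono)
      show "\<bar>c\<^sup>2 * \<tau> x - \<rho> x\<bar> \<le> \<bar>c\<^sup>2 - 1\<bar> * \<tau> x + \<bar>\<tau> x - \<rho> x\<bar>" for x
      proof -
        have "c\<^sup>2 * \<tau> x - \<rho> x = (c\<^sup>2 - 1) * \<tau> x + (\<tau> x - \<rho> x)" by (simp add: algebra_simps)
        also have "\<bar>\<dots>\<bar> \<le> \<bar>(c\<^sup>2 - 1) * \<tau> x\<bar> + \<bar>\<tau> x - \<rho> x\<bar>" by (rule abs_triangle_ineq)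
        finally show ?thesis using \<tau>_nonneg[of x] by (simp add: abs_mult)
      qed
    qed (use \<tau>_cont \<rho>_cont in \<open>auto intro!: integrable_continuous_disc continuous_intros\<close>)
    also have "\<dots> = \<bar>c\<^sup>2 - 1\<bar> * \<mu> + \<delta>"
      using \<tau>_int \<rho>_int by (simp add: \<mu>_def \<delta>_def)
    also have "\<bar>c\<^sup>2 - 1\<bar> * \<mu> = \<bar>\<mu> - 1\<bar>"
    proof -
      have "\<bar>c\<^sup>2 - 1\<bar> * \<mu> = \<bar>(c\<^sup>2 - 1) * \<mu>\<bar>" using \<mu>2 by (simp add: abs_mult)
      also have "(c\<^sup>2 - 1) * \<mu> = 1 - \<mu>" using \<mu>2 c(2) by (simp add: left_diff_distrib)
      finally show ?thesis by (simp add: abs_minus_commute)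
    qed
    also have "\<bar>\<mu> - 1\<bar> + \<delta> \<le> 2 * A * (\<epsilon> * L)" using \<mu> \<delta> by simp
    finally show ?thesis using M by (simp add: \<Phi>_sq mult_left_mono)
  qed
  have kin: "(LINT x|disc_measure. T x)
     \<le> (\<Omega>\<^sub>0 ^ 4 * m / 16 + 26112 * M * \<Omega>\<^sub>0 * m) * (L / \<epsilon>)"
  proof -
    \<comment> \<open>Here 1088 = 8 * 2 * 68, with 2 M bounding the squared amplitude and 68 = 2^2 +
      8^2 from the covariant derivatives; the integral of h later supplies 24, and 26112 = 1088 *
      24.\<close>
    have "(LINT x|disc_measure. T x)
      \<le> (LINT x|disc_measure. 4 * \<kappa>\<^sup>2 / \<epsilon> + 1088 * M * (\<Omega>\<^sub>0 / \<epsilon>) * h x)"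
    proof (rule integral_mono)
      fix x assume "x \<in> space disc_measure"
      then have x: "x \<in> unit_disc" by simp
      have "(D 1 x)\<^sup>2 + (D 2 x)\<^sup>2 = c\<^sup>2 * (soft_slope \<epsilon> \<kappa> l x)\<^sup>2 * (4 * \<kappa>\<^sup>2) * ((x $ 1)\<^sup>2 + (x $ 2)\<^sup>2)"
        by (simp add: D_def power_mult_distrib algebra_simps)
      also have "\<dots> \<le> 2 * (1 / (4 * \<epsilon>)) * (4 * \<kappa>\<^sup>2) * 1"
      proof (intro mult_mono)
        show "(soft_slope \<epsilon> \<kappa> l x)\<^sup>2 \<le> 1 / (4 * \<epsilon>)"
          unfolding soft_slope_def by (rule DERIV_sqrt_soft_pos_square_le[OF \<epsilon>(1)])
        show "(x $ 1)\<^sup>2 + (x $ 2)\<^sup>2 \<le> 1"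
          using norm_le_1_unit_disc[OF x] by (simp flip: norm_vec2 add: power_le_one)
      qed (use c(3) \<epsilon>(1) in auto)
      also have "\<dots> = 2 * \<kappa>\<^sup>2 / \<epsilon>" by simp
      finally have 1: "2 * ((D 1 x)\<^sup>2 + (D 2 x)\<^sup>2) \<le> 4 * \<kappa>\<^sup>2 / \<epsilon>" by simp
      have cov: "W1 x + \<i> * of_real (\<Omega>\<^sub>0 / \<epsilon> * x $ 2 / 2) * w x = vortex_cov1 \<omega> K s t (x $ 1) (x $ 2)"
        "W2 x - \<i> * of_real (\<Omega>\<^sub>0 / \<epsilon> * x $ 1 / 2) * w x = vortex_cov2 \<omega> K s t (x $ 1) (x $ 2)"
        unfolding W1_def W2_def \<omega>(2) by auto
      have "(cmod (vortex_cov1 \<omega> K s t (x $ 1) (x $ 2)))\<^sup>2 \<le> (2 * \<omega>)\<^sup>2"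
        "(cmod (vortex_cov2 \<omega> K s t (x $ 1) (x $ 2)))\<^sup>2 \<le> (8 * \<omega>)\<^sup>2"
        by (intro power_mono norm_vortex_cov \<omega>(1) norm_ge_zero; simp add: K_def)+
      then have "(cmod (vortex_cov1 \<omega> K s t (x $ 1) (x $ 2)))\<^sup>2 + (cmod (vortex_cov2 \<omega> K s t (x $ 1) (x $ 2)))\<^sup>2 \<le> 68 * (\<Omega>\<^sub>0 / \<epsilon>)"
        by (simp add: power_mult_distrib \<omega>(2))
      moreover have "8 * (f x)\<^sup>2 \<le> 8 * (2 * M)"
      proof -
        have "(f x)\<^sup>2 = c\<^sup>2 * q x" using q(1)[of x] by (simp add: f_def power_mult_distrib)
        also have "\<dots> \<le> 2 * M" using q(1)[of x] q_le[OF x] c(3) by (intro mult_mono) auto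
        finally show ?thesis by simp
      qed
      ultimately have "8 * (f x)\<^sup>2 * ((cmod (vortex_cov1 \<omega> K s t (x $ 1) (x $ 2)))\<^sup>2 + (cmod (vortex_cov2 \<omega> K s t (x $ 1) (x $ 2)))\<^sup>2) * h x
        \<le> 8 * (2 * M) * (68 * (\<Omega>\<^sub>0 / \<epsilon>)) * h x"
        using M h_pos(1)[of x] by (intro mult_right_mono mult_mono) auto
      with 1 show "T x
        \<le> 4 * \<kappa>\<^sup>2 / \<epsilon> + 1088 * M * (\<Omega>\<^sub>0 / \<epsilon>) * h x"
        unfolding T_def cov by (simp add: h_def)
    next
      show "integrable disc_measure (\<lambda>x. T x)"
        unfolding T_def using D_cont f_cont W_cont w_cont \<epsilon>(1)
        by (intro integrable_continuous_disc continuous_intros) (auto simp: nz)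
      show "integrable disc_measure (\<lambda>x. 4 * \<kappa>\<^sup>2 / \<epsilon> + 1088 * M * (\<Omega>\<^sub>0 / \<epsilon>) * h x)"
        using h_cont \<epsilon>(1) by (intro integrable_continuous_disc continuous_intros) auto
    qed
    also have "\<dots> = 4 * \<kappa>\<^sup>2 / \<epsilon> * m + 1088 * M * (\<Omega>\<^sub>0 / \<epsilon>) * (LINT x|disc_measure. h x)"
      using integrable_continuous_disc[OF h_cont] m(2) by simp
    also have "\<dots> \<le> 4 * \<kappa>\<^sup>2 / \<epsilon> * m * L + 1088 * M * (\<Omega>\<^sub>0 / \<epsilon>) * (24 * m * L)"
      using h_int \<epsilon>(1) M m(1) L \<Omega>\<^sub>0 mult_left_mono[of 1 L "4 * \<kappa>\<^sup>2 / \<epsilon> * m"]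
      by (intro add_mono mult_left_mono) auto
    also have "\<dots> = (\<Omega>\<^sub>0 ^ 4 * m / 16 + 26112 * M * \<Omega>\<^sub>0 * m) * (L / \<epsilon>)"
      using \<epsilon>(1) by (simp add: \<kappa>_def power_divide field_simps)
    finally show ?thesis .
  qed
  have "TF_energy \<Omega>\<^sub>0 (\<lambda>x. (cmod (\<Phi> x))\<^sup>2) / \<epsilon>\<^sup>2 \<le> (TF_energy \<Omega>\<^sub>0 \<rho> + (3 * M + \<Omega>\<^sub>0\<^sup>2 / 4) * (2 * A * (\<epsilon> * L))) / \<epsilon>\<^sup>2"
    using TF by (intro divide_right_mono) auto
  also have "\<dots> = TF_energy \<Omega>\<^sub>0 \<rho> / \<epsilon>\<^sup>2 + 2 * A * (3 * M + \<Omega>\<^sub>0\<^sup>2 / 4) * (L / \<epsilon>)"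
    using \<epsilon>(1) by (simp add: add_divide_distrib power2_eq_square)
  finally have "(LINT x|disc_measure. T x)
      + TF_energy \<Omega>\<^sub>0 (\<lambda>x. (cmod (\<Phi> x))\<^sup>2) / \<epsilon>\<^sup>2
    \<le> (\<Omega>\<^sub>0 ^ 4 * m / 16 + 26112 * M * \<Omega>\<^sub>0 * m) * (L / \<epsilon>)
      + (TF_energy \<Omega>\<^sub>0 \<rho> / \<epsilon>\<^sup>2 + 2 * A * (3 * M + \<Omega>\<^sub>0\<^sup>2 / 4) * (L / \<epsilon>))"
    using kin by (intro add_mono)
  also have "\<dots> = TF_energy \<Omega>\<^sub>0 \<rho> / \<epsilon>\<^sup>2
      + (2 * A * (3 * M + \<Omega>\<^sub>0\<^sup>2 / 4) + \<Omega>\<^sub>0 ^ 4 * m / 16 + 26112 * M * \<Omega>\<^sub>0 * m) * (L / \<epsilon>)"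
    by (simp only: distrib_right add_ac)
  finally have "ereal ((LINT x|disc_measure. T x)
      + TF_energy \<Omega>\<^sub>0 (\<lambda>x. (cmod (\<Phi> x))\<^sup>2) / \<epsilon>\<^sup>2)
    \<le> ereal (TF_energy \<Omega>\<^sub>0 \<rho> / \<epsilon>\<^sup>2
      + (2 * A * (3 * M + \<Omega>\<^sub>0\<^sup>2 / 4) + \<Omega>\<^sub>0 ^ 4 * m / 16 + 26112 * M * \<Omega>\<^sub>0 * m) * (L / \<epsilon>))"
    unfolding ereal_less_eq(3) .
  from order_trans[OF energy this] show ?thesis
    using H1 norm unfolding \<rho>_def L_def by blast
qed

section \<open>The rate of convergence\<close>

theorem corollary2p1:
  fixes \<Omega>\<^sub>0 :: real
  assumes "\<Omega>\<^sub>0 > 0"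
  shows "\<exists>C > 0. \<exists>\<epsilon>\<^sub>0 > 0. \<forall>\<epsilon>. 0 < \<epsilon> \<and> \<epsilon> < \<epsilon>\<^sub>0 \<longrightarrow>
    (\<forall>\<Psi>. GP_minimizer \<epsilon> (\<Omega>\<^sub>0 / \<epsilon>) \<Psi> \<longrightarrow>
      L1_norm_disc (\<lambda>x. (norm (\<Psi> x))\<^sup>2 - rho_TF \<Omega>\<^sub>0 x) \<le> C * sqrt (\<epsilon> * \<bar>ln \<epsilon>\<bar>))"
proof -
  obtain l where l: "(LINT x|disc_measure. TF_profile \<Omega>\<^sub>0 l x) = 1"
    by (rule TF_profile_normalized_exists)
  \<comment> \<open>The constant \<open>l\<close> is fixed before \<epsilon>, so all constants
    defined from it depend on \<Omega>0 only.\<close>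
  define \<rho> where "\<rho> = TF_profile \<Omega>\<^sub>0 l"
  define m where "m = measure lborel unit_disc"
  define M where "M = \<Omega>\<^sub>0\<^sup>2 / 8 + \<bar>l\<bar> + 1"
  define A where "A = m / 2 + 24 * M * m"
  define B where "B = 2 * A * (3 * M + \<Omega>\<^sub>0\<^sup>2 / 4) + \<Omega>\<^sub>0 ^ 4 * m / 16 + 26112 * M * \<Omega>\<^sub>0 * m"
  have m: "m > 0" "measure disc_measure (space disc_measure) = m"
    unfolding m_def by (rule measure_disc)+
  have "M > 0" by (simp add: M_def add_nonneg_pos)
  then have B: "B > 0" unfolding B_def A_def using m(1) assms by (intro add_pos_pos mult_pos_pos) auto
  have "((\<lambda>\<epsilon>. A * (\<epsilon> * - ln \<epsilon>)) \<longlongrightarrow> 0) (at_right (0::real))" by real_asymp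
  then have "\<forall>\<^sub>F \<epsilon> in at_right 0. A * (\<epsilon> * - ln \<epsilon>) < 1 / 2" by (rule order_tendstoD) simp
  then obtain \<epsilon>\<^sub>1 where \<epsilon>\<^sub>1: "\<epsilon>\<^sub>1 > 0" "\<And>\<epsilon>. 0 < \<epsilon> \<Longrightarrow> \<epsilon> < \<epsilon>\<^sub>1 \<Longrightarrow> A * (\<epsilon> * - ln \<epsilon>) < 1 / 2"
    by (auto simp: eventually_at_right_field)
  have bound: "L1_norm_disc (\<lambda>x. (norm (\<Psi> x))\<^sup>2 - rho_TF \<Omega>\<^sub>0 x) \<le> sqrt (m * B) * sqrt (\<epsilon> * \<bar>ln \<epsilon>\<bar>)"
    if \<epsilon>: "0 < \<epsilon>" "\<epsilon> < \<epsilon>\<^sub>1" "\<epsilon> \<le> 1 / 4" "\<epsilon> \<le> exp (- 1)" and \<Psi>: "GP_minimizer \<epsilon> (\<Omega>\<^sub>0 / \<epsilon>) \<Psi>" for \<epsilon> \<Psi>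
  proof -
    have "ln \<epsilon> \<le> ln (exp (- 1))" using \<epsilon> by (subst ln_le_cancel_iff) auto
    then have L: "1 \<le> - ln \<epsilon>" by simp
    define E where "E = TF_energy \<Omega>\<^sub>0 \<rho> / \<epsilon>\<^sup>2 + B * (- ln \<epsilon> / \<epsilon>)"
    obtain \<Phi> where \<Phi>: "\<Phi> \<in> H1_disc" "L2_norm_disc \<Phi> = 1" "GP_energy \<epsilon> (\<Omega>\<^sub>0 / \<epsilon>) \<Phi> \<le> ereal E"
      using GP_trial_state[OF assms l \<epsilon>(1,3) L] \<epsilon>\<^sub>1(2)[OF \<epsilon>(1,2)]
      unfolding E_def B_def A_def M_def m_def \<rho>_def by auto
    have H1: "\<Psi> \<in> H1_disc" and norm: "L2_norm_disc \<Psi> = 1"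
      and le: "GP_energy \<epsilon> (\<Omega>\<^sub>0 / \<epsilon>) \<Psi> \<le> GP_energy \<epsilon> (\<Omega>\<^sub>0 / \<epsilon>) \<Phi>"
      using \<Psi> \<Phi> by (auto simp: GP_minimizer_def)
    note lower = GP_energy_lower_bound[OF \<epsilon>(1) H1 order_trans[OF le \<Phi>(3)]]
    define \<sigma> where "\<sigma> = (\<lambda>x. (norm (\<Psi> x))\<^sup>2)"
    have \<sigma>: "\<sigma> \<in> TF_domain" using lower(1) by (simp add: TF_domain_def \<sigma>_def)
    have "(LINT x|disc_measure. \<sigma> x) = 1"
      using norm by (simp add: L2_norm_disc_def \<sigma>_def)
    note gap = TF_energy_gap[OF l \<sigma> this]
    have diff: "(\<lambda>x. \<sigma> x - \<rho> x) \<in> L2_disc"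
      using \<sigma> TF_profile_in_domain by (intro L2_disc_diff) (auto simp: TF_domain_def \<rho>_def)
    have "(L1_norm_disc (\<lambda>x. \<sigma> x - \<rho> x))\<^sup>2 \<le> m * (LINT x|disc_measure. (\<sigma> x - \<rho> x)\<^sup>2)"
      using L1_norm_disc_le[OF diff] m(2) by simp
    also have "\<dots> \<le> m * (\<epsilon>\<^sup>2 * E - TF_energy \<Omega>\<^sub>0 \<rho>)"
      using gap lower(2) m(1) by (intro mult_left_mono) (auto simp: \<sigma>_def \<rho>_def)
    \<comment> \<open>The leading terms of the upper and the lower bound cancel exactly, and only
      the error of the trial state survives.\<close>
    also have "\<epsilon>\<^sup>2 * E - TF_energy \<Omega>\<^sub>0 \<rho> = B * (\<epsilon> * \<bar>ln \<epsilon>\<bar>)"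
    proof -
      have "\<bar>ln \<epsilon>\<bar> = - ln \<epsilon>" using L by simp
      then show ?thesis using \<epsilon>(1) by (simp add: E_def field_simps power2_eq_square)
    qed
    finally have "L1_norm_disc (\<lambda>x. \<sigma> x - \<rho> x) \<le> sqrt (m * (B * (\<epsilon> * \<bar>ln \<epsilon>\<bar>)))"
      by (rule real_le_rsqrt)
    also have "\<dots> = sqrt (m * B) * sqrt (\<epsilon> * \<bar>ln \<epsilon>\<bar>)"
      by (simp add: mult.assoc flip: real_sqrt_mult)
    also have "L1_norm_disc (\<lambda>x. \<sigma> x - \<rho> x) = L1_norm_disc (\<lambda>x. (norm (\<Psi> x))\<^sup>2 - rho_TF \<Omega>\<^sub>0 x)"
      unfolding L1_norm_disc_def
    proof (rule integral_cong_AE)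
      have meas: "\<sigma> \<in> borel_measurable disc_measure" "\<rho> \<in> borel_measurable disc_measure"
        using \<sigma> TF_profile_in_domain by (auto simp: TF_domain_def L2_disc_def \<rho>_def)
      show "(\<lambda>x. norm (\<sigma> x - \<rho> x)) \<in> borel_measurable disc_measure" using meas by measurable
      show "(\<lambda>x. norm ((norm (\<Psi> x))\<^sup>2 - rho_TF \<Omega>\<^sub>0 x)) \<in> borel_measurable disc_measure"
        using meas(1) rho_TF_AE_eq_profile(1)[OF l] unfolding \<sigma>_def by measurable
      show "AE x in disc_measure. norm (\<sigma> x - \<rho> x) = norm ((norm (\<Psi> x))\<^sup>2 - rho_TF \<Omega>\<^sub>0 x)"
        using rho_TF_AE_eq_profile(2)[OF l] by eventually_elim (simp add: \<sigma>_def \<rho>_def)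
    qed
    finally show ?thesis .
  qed
  show ?thesis
  proof (rule exI[of _ "sqrt (m * B)"], intro conjI)
    show "\<exists>\<epsilon>\<^sub>0>0. \<forall>\<epsilon>. 0 < \<epsilon> \<and> \<epsilon> < \<epsilon>\<^sub>0 \<longrightarrow> (\<forall>\<Psi>. GP_minimizer \<epsilon> (\<Omega>\<^sub>0 / \<epsilon>) \<Psi> \<longrightarrow>
        L1_norm_disc (\<lambda>x. (norm (\<Psi> x))\<^sup>2 - rho_TF \<Omega>\<^sub>0 x) \<le> sqrt (m * B) * sqrt (\<epsilon> * \<bar>ln \<epsilon>\<bar>))"
    \<comment> \<open>\<open>\<epsilon>\<^sub>1\<close> keeps the mass error of the trial state
      small, 1 / 4 is required by the logarithmic integral, and exp (-1) makes |ln \<epsilon>| at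
      least 1.\<close>
    proof (intro exI[of _ "min \<epsilon>\<^sub>1 (min (1 / 4) (exp (- 1)))"] conjI allI impI bound)
      show "0 < min \<epsilon>\<^sub>1 (min (1 / 4) (exp (- 1)))" using \<epsilon>\<^sub>1(1) by simp
    qed auto
  qed (use m(1) B in simp)
qed

end
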